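(* Let $d>1$ be an integer and let $m,t$ be positive integers such that $t$ divides $m$, and let $\theta:\mathbb{D}^d\to\theta(\mathbb{D}^d)$ be the basic polynomial map associated to the group $G(m,t,d)$. Any function $f$ in the closed norm unit ball of $H^\infty(\theta(\mathbb{D}^d))$ can be approximated by convex combinations of rational inner functions in $\mathcal{A}(\theta(\mathbb{D}^d))$ with respect to the $L^2$-norm on $\partial\theta(\mathbb{D}^d)$ equipped with the measure $\mu$; that is, for every $\varepsilon>0$ there is a convex combination $h$ of rational inner functions in $\mathcal{A}(\theta(\mathbb{D}^d))$ such that $\|f^*-h^*\|_{L^2(\partial\theta(\mathbb{D}^d),\mu)}<\varepsilon$.
   Context: $\mathbb{D}$ is the open unit disc, $\mathbb{T}$ the unit circle. The map $\theta=(\theta_1,\dots,\theta_d)$ is given by $\theta_j(\boldsymbol z)=E_j(z_1^m,\dots,z_d^m)$ for $1\le j\le d-1$ and $\theta_d(\boldsymbol z)=(z_1\cdots z_d)^{m/t}$, where $E_j$ is the $j$-th elementary symmetric polynomial in $d$ variables. ($G(m,t,d)$ is the group of maps $\boldsymbol z\mapsto(\alpha^{\nu_1}z_{\sigma(1)},\dots,\alpha^{\nu_d}z_{\sigma(d)})$ with $\alpha=e^{2\pi i/m}$, $\sigma\in S_d$ and integers $\nu_1,\dots,\nu_d$ whose sum is divisible by $t$; $\theta(\mathbb{D}^d)$ is a domain in $\mathbb{C}^d$ biholomorphic to $\mathbb{D}^d/G(m,t,d)$.) $H^\infty(\theta(\mathbb{D}^d))$ is the Banach algebra of bounded holomorphic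 functions on $\theta(\mathbb{D}^d)$ with the sup norm, and $\mathcal{A}(\theta(\mathbb{D}^d))$ is the algebra of continuous functions on $\overline{\theta(\mathbb{D}^d)}$ that are holomorphic in $\theta(\mathbb{D}^d)$. Write $\partial\theta(\mathbb{D}^d)=\theta(\mathbb{T}^d)$, and let $\mu$ be the push-forward under $\theta$ of the normalized Haar measure $\nu$ on $\mathbb{T}^d$. Each $f\in H^\infty(\theta(\mathbb{D}^d))$ has a boundary function $f^*(\boldsymbol q)=\lim_{r\to1^-}f(r^mq_1,r^{2m}q_2,\dots,r^{(d-1)m}q_{d-1},r^{dm/t}q_d)$, defined for $\mu$-almost every $\boldsymbol q\in\partial\theta(\mathbb{D}^d)$. A function $f\in H^\infty(\theta(\mathbb{D}^d))$ is called inner if $|f^*|=1$ $\mu$-almost everywhere on $\partial\theta(\mathbb{D}^d)$; a rational inner function is a rational function with poles off $\theta(\mathbb{D}^d)$ which is also inner. *)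

theory Defs
  imports "HOL-Probability.Probability"
begin

text \<open>
  The space of \<open>d\<close>-tuples of complex numbers is the type \<^typ>\<open>complex^'n\<close> with \<open>d = CARD('n)\<close>.
  Where the numbering of the coordinates matters, it is given by a bijection
  \<open>ix :: 'n \<Rightarrow> nat\<close> from the index type onto \<open>{1..CARD('n)}\<close>.
\<close>

text \<open>
  Holomorphy is complex Frechet differentiability: the real derivative exists at every point and
  is complex linear. It is only used on open sets.
\<close>

definition holomorphic_sev :: "(complex^'n \<Rightarrow> complex) \<Rightarrow> (complex^'n) set \<Rightarrow> bool" where
  "holomorphic_sev f U \<longleftrightarrow>
     (\<forall>z\<in>U. \<exists>D. (f has_derivative D) (at z) \<and> (\<forall>c v. D (c *s v) = c * D v))"

definition polynomial_sev :: "(complex^'n \<Rightarrow> complex) \<Rightarrow> bool" where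
  "polynomial_sev p \<longleftrightarrow>
     (\<exists>(A :: ('n \<Rightarrow> nat) set) c. finite A \<and> p = (\<lambda>z. \<Sum>a\<in>A. c a * (\<Prod>i\<in>UNIV. z $ i ^ a i)))"

text \<open>
  A rational function with poles off \<open>U\<close>, seen as a function on \<open>U\<close>. As polynomials have unique
  factorization, asking for some representation \<open>p / q\<close> with \<open>q\<close> zero-free on \<open>U\<close> is the same as
  asking it for the reduced one.
\<close>

definition rational_poles_off :: "(complex^'n \<Rightarrow> complex) \<Rightarrow> (complex^'n) set \<Rightarrow> bool" where
  "rational_poles_off f U \<longleftrightarrow>
     (\<exists>p q. polynomial_sev p \<and> polynomial_sev q \<and> (\<forall>z\<in>U. q z \<noteq> 0 \<and> f z = p z / q z))"

definition Hinf :: "(complex^'n) set \<Rightarrow> (complex^'n \<Rightarrow> complex) set" where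
  "Hinf U = {f. holomorphic_sev f U \<and> bounded (f ` U)}"

definition Hinf_norm :: "(complex^'n) set \<Rightarrow> (complex^'n \<Rightarrow> complex) \<Rightarrow> real" where
  "Hinf_norm U f = (SUP z\<in>U. cmod (f z))"

definition disc_algebra :: "(complex^'n) set \<Rightarrow> (complex^'n \<Rightarrow> complex) set" where
  "disc_algebra U = {f. continuous_on (closure U) f \<and> holomorphic_sev f U}"

definition polydisc :: "(complex^'n) set" where
  "polydisc = {z. \<forall>i. cmod (z $ i) < 1}"

definition torus :: "(complex^'n) set" where
  "torus = {z. \<forall>i. cmod (z $ i) = 1}"

text \<open>
  Normalized Haar measure on the torus is the product of normalized arc length on the unit circle;
  \<open>prob_space_torus_haar\<close> and \<open>torus_haar_invariant\<close> below confirm that it is a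
  rotation invariant probability measure on the Borel sets of the torus.
\<close>

definition circle_haar :: "complex measure" where
  "circle_haar = distr (uniform_measure lborel {0..2 * pi}) (restrict_space borel (sphere 0 1)) cis"

definition torus_haar :: "(complex^'n) measure" where
  "torus_haar = distr (\<Pi>\<^sub>M i\<in>UNIV. circle_haar) (restrict_space borel torus) vec_lambda"

definition elem_sym :: "nat \<Rightarrow> complex^'n \<Rightarrow> complex" where
  "elem_sym j z = (\<Sum>S | S \<subseteq> UNIV \<and> card S = j. \<Prod>i\<in>S. z $ i)"

definition theta :: "('n \<Rightarrow> nat) \<Rightarrow> nat \<Rightarrow> nat \<Rightarrow> complex^'n \<Rightarrow> complex^'n" where
  "theta ix m t z =
     (\<chi> i. if ix i = CARD('n) then (\<Prod>k\<in>UNIV. z $ k) ^ (m div t)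
          else elem_sym (ix i) (\<chi> k. z $ k ^ m))"

abbreviation theta_domain :: "('n \<Rightarrow> nat) \<Rightarrow> nat \<Rightarrow> nat \<Rightarrow> (complex^'n) set" where
  "theta_domain ix m t \<equiv> theta ix m t ` polydisc"

abbreviation theta_boundary :: "('n \<Rightarrow> nat) \<Rightarrow> nat \<Rightarrow> nat \<Rightarrow> (complex^'n) set" where
  "theta_boundary ix m t \<equiv> theta ix m t ` torus"

definition theta_measure :: "('n \<Rightarrow> nat) \<Rightarrow> nat \<Rightarrow> nat \<Rightarrow> (complex^'n) measure" where
  "theta_measure ix m t =
     distr torus_haar (restrict_space borel (theta_boundary ix m t)) (theta ix m t)"

definition dilation :: "('n \<Rightarrow> nat) \<Rightarrow> nat \<Rightarrow> nat \<Rightarrow> real \<Rightarrow> complex^'n \<Rightarrow> complex^'n" where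
  "dilation ix m t r q =
     (\<chi> i. if ix i = CARD('n) then of_real (r ^ (CARD('n) * m div t)) * q $ i
          else of_real (r ^ (ix i * m)) * q $ i)"

text \<open>
  \<^const>\<open>Lim\<close> is total, so at the points of the exceptional null set where the radial limit does
  not exist, the boundary function takes an unspecified constant value.
\<close>

definition boundary_fun ::
  "('n \<Rightarrow> nat) \<Rightarrow> nat \<Rightarrow> nat \<Rightarrow> (complex^'n \<Rightarrow> complex) \<Rightarrow> complex^'n \<Rightarrow> complex" where
  "boundary_fun ix m t f q = Lim (at_left 1) (\<lambda>r. f (dilation ix m t r q))"

definition inner_fun :: "('n \<Rightarrow> nat) \<Rightarrow> nat \<Rightarrow> nat \<Rightarrow> (complex^'n \<Rightarrow> complex) \<Rightarrow> bool" where
  "inner_fun ix m t f \<longleftrightarrow> f \<in> Hinf (theta_domain ix m t) \<and>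
     (AE q in theta_measure ix m t. cmod (boundary_fun ix m t f q) = 1)"

definition rational_inner :: "('n \<Rightarrow> nat) \<Rightarrow> nat \<Rightarrow> nat \<Rightarrow> (complex^'n \<Rightarrow> complex) set" where
  "rational_inner ix m t =
     {f. rational_poles_off f (theta_domain ix m t) \<and> inner_fun ix m t f}"

definition convex_combination_of :: "('a \<Rightarrow> complex) set \<Rightarrow> ('a \<Rightarrow> complex) \<Rightarrow> bool" where
  "convex_combination_of S h \<longleftrightarrow>
     (\<exists>(N::nat) (w :: nat \<Rightarrow> real) g. (\<forall>k<N. 0 \<le> w k \<and> g k \<in> S) \<and> (\<Sum>k<N. w k) = 1 \<and>
        h = (\<lambda>x. \<Sum>k<N. of_real (w k) * g k x))"

definition L2_space :: "'a measure \<Rightarrow> ('a \<Rightarrow> complex) set" where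
  "L2_space M = {g \<in> borel_measurable M. integrable M (\<lambda>x. (cmod (g x))\<^sup>2)}"

definition L2_norm :: "'a measure \<Rightarrow> ('a \<Rightarrow> complex) \<Rightarrow> real" where
  "L2_norm M g = sqrt (LINT x|M. (cmod (g x))\<^sup>2)"

lemma measurable_cis_circle [measurable]: "cis \<in> borel \<rightarrow>\<^sub>M restrict_space borel (sphere 0 1)"
  by (intro measurable_restrict_space2 borel_measurable_continuous_onI)
     (auto intro!: continuous_intros)

lemma space_circle_haar: "space circle_haar = sphere 0 1"
  and sets_circle_haar [measurable_cong]: "sets circle_haar = sets (restrict_space borel (sphere 0 1))"
  by (auto simp: circle_haar_def space_restrict_space)

lemma prob_space_circle_haar: "prob_space circle_haar"
proof -
  interpret prob_space "uniform_measure lborel {0..2 * pi :: real}"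
    by (rule prob_space_uniform_measure) auto
  show ?thesis unfolding circle_haar_def
    by (rule prob_space_distr) (simp cong: measurable_cong_sets)
qed

lemma emeasure_circle_haar:
  assumes "A \<in> sets (restrict_space borel (sphere 0 1))"
  shows "emeasure circle_haar A =
    emeasure lborel ({0..<2 * pi} \<inter> cis -` A) / ennreal (2 * pi)"
proof -
  have m: "cis -` A \<in> sets borel"
    using measurable_sets[OF measurable_cis_circle assms] by simp
  have "emeasure circle_haar A = emeasure lborel ({0..2 * pi} \<inter> cis -` A) / ennreal (2 * pi)"
    unfolding circle_haar_def
    by (subst emeasure_distr) (use m assms in \<open>auto simp: emeasure_uniform_measure Int_commute
         cong: measurable_cong_sets\<close>)
  also have "emeasure lborel ({0..2 * pi} \<inter> cis -` A) = emeasure lborel ({0..<2 * pi} \<inter> cis -` A)"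
    by (rule emeasure_eq_AE) (use m AE_lborel_singleton[of "2 * pi"] in \<open>auto elim!: eventually_mono\<close>)
  finally show ?thesis .
qed

lemma circle_haar_invariant:
  assumes "cmod w = 1"
  shows "distr circle_haar circle_haar (\<lambda>z. w * z) = circle_haar"
proof (rule measure_eqI)
  show "sets (distr circle_haar circle_haar ((*) w)) = sets circle_haar" by simp
  fix A assume "A \<in> sets (distr circle_haar circle_haar ((*) w))"
  then have A: "A \<in> sets circle_haar" by simp
  then have A': "A \<in> sets (restrict_space borel (sphere 0 1))" by (simp add: sets_circle_haar)
  have rot: "(\<lambda>z. w * z) \<in> restrict_space borel (sphere 0 1) \<rightarrow>\<^sub>M restrict_space borel (sphere 0 1)"
    by (intro measurable_restrict_space3) (auto simp: norm_mult assms)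
  define B where "B = (\<lambda>z. w * z) -` A \<inter> sphere 0 1"
  have B: "B \<in> sets (restrict_space borel (sphere 0 1))"
    using measurable_sets[OF rot A'] by (simp add: B_def space_restrict_space)
  define X where "X = cis -` A"
  have X [measurable]: "X \<in> sets borel"
    unfolding X_def using measurable_sets[OF measurable_cis_circle A'] by simp
  obtain a where a: "w = cis a" "0 \<le> a" "a < 2 * pi"
    using assms by (metis Arg2pi_eq Arg2pi_ge_0 Arg2pi_lt_2pi cis_conv_exp mult.left_neutral
        mult.commute of_real_1)
  have per: "x - 2 * pi \<in> X \<longleftrightarrow> x \<in> X" for x
    by (simp add: X_def flip: cis_divide)
  have shift: "emeasure lborel Y = emeasure lborel ((\<lambda>x. c + x) -` Y)" if "Y \<in> sets borel"
    for Y and c :: real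
    using that by (subst lborel_distr_plus[symmetric, of c], subst emeasure_distr) auto
  have "cis -` B = (\<lambda>x. a + x) -` X"
    by (auto simp: B_def X_def a cis_mult)
  then have "emeasure lborel ({0..<2 * pi} \<inter> cis -` B)
      = emeasure lborel ((\<lambda>x. a + x) -` ({a..<a + 2 * pi} \<inter> X))"
    by (intro arg_cong[where f = "emeasure lborel"]) auto
  also have "\<dots> = emeasure lborel ({a..<a + 2 * pi} \<inter> X)"
    by (rule shift[symmetric]) auto
  also have "{a..<a + 2 * pi} \<inter> X = ({a..<2 * pi} \<inter> X) \<union> ({2 * pi..<a + 2 * pi} \<inter> X)"
    using a by auto
  also have "emeasure lborel \<dots> = emeasure lborel ({a..<2 * pi} \<inter> X)
      + emeasure lborel ({2 * pi..<a + 2 * pi} \<inter> X)"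
    by (rule plus_emeasure[symmetric]) auto
  also have "emeasure lborel ({2 * pi..<a + 2 * pi} \<inter> X) = emeasure lborel ({0..<a} \<inter> X)"
  proof -
    have "(\<lambda>x. - (2 * pi) + x) -` ({0..<a} \<inter> X) = {2 * pi..<a + 2 * pi} \<inter> X"
      using per by auto
    moreover have "{0..<a} \<inter> X \<in> sets borel" by auto
    ultimately show ?thesis using shift[of "{0..<a} \<inter> X" "- (2 * pi)"] by metis
  qed
  also have "emeasure lborel ({a..<2 * pi} \<inter> X) + emeasure lborel ({0..<a} \<inter> X)
      = emeasure lborel (({a..<2 * pi} \<inter> X) \<union> ({0..<a} \<inter> X))"
    by (rule plus_emeasure) auto
  also have "({a..<2 * pi} \<inter> X) \<union> ({0..<a} \<inter> X) = {0..<2 * pi} \<inter> X"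
    using a by auto
  finally have "emeasure circle_haar B = emeasure circle_haar A"
    by (simp add: emeasure_circle_haar A' B X_def)
  moreover have "emeasure (distr circle_haar circle_haar ((*) w)) A = emeasure circle_haar B"
    using rot A by (subst emeasure_distr)
      (auto simp: B_def space_circle_haar measurable_cong_sets[OF sets_circle_haar sets_circle_haar])
  ultimately show "emeasure (distr circle_haar circle_haar ((*) w)) A = emeasure circle_haar A"
    by simp
qed

lemma measurable_vec_lambda_torus [measurable]:
  "vec_lambda \<in> (\<Pi>\<^sub>M i\<in>UNIV. circle_haar) \<rightarrow>\<^sub>M restrict_space borel (torus :: (complex^'n) set)"
proof (rule measurable_restrict_space2)
  show "vec_lambda \<in> space (\<Pi>\<^sub>M i\<in>UNIV. circle_haar) \<rightarrow> (torus :: (complex^'n) set)"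
    by (auto simp: space_PiM space_circle_haar torus_def PiE_def Pi_def)
  have id: "(\<lambda>z. z) \<in> circle_haar \<rightarrow>\<^sub>M borel"
    by (simp add: measurable_cong_sets[OF sets_circle_haar refl] measurable_restrict_space1)
  have "(\<lambda>x. x i) \<in> (\<Pi>\<^sub>M i\<in>UNIV. circle_haar) \<rightarrow>\<^sub>M borel" for i :: 'n
    by (rule measurable_compose[OF _ id]) simp
  then show "vec_lambda \<in> (\<Pi>\<^sub>M i\<in>UNIV. circle_haar) \<rightarrow>\<^sub>M (borel :: (complex^'n) measure)"
    by (subst borel_measurable_euclidean_space) (auto simp: Basis_vec_def inner_axis)
qed

lemma space_torus_haar: "space torus_haar = torus"
  and sets_torus_haar [measurable_cong]: "sets torus_haar = sets (restrict_space borel torus)"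
  by (auto simp: torus_haar_def space_restrict_space)

lemma prob_space_torus_haar: "prob_space torus_haar"
proof -
  interpret prob_space "\<Pi>\<^sub>M i\<in>(UNIV :: 'n set). circle_haar"
    by (intro prob_space_PiM prob_space_circle_haar)
  show ?thesis unfolding torus_haar_def by (rule prob_space_distr) measurable
qed

lemma torus_haar_invariant:
  fixes w :: "complex^'n"
  assumes "w \<in> torus"
  shows "distr torus_haar torus_haar (\<lambda>z. \<chi> i. w $ i * z $ i) = torus_haar"
proof -
  let ?P = "\<Pi>\<^sub>M i\<in>(UNIV :: 'n set). circle_haar"
  let ?T = "restrict_space borel (torus :: (complex^'n) set)"
  let ?r = "\<lambda>x i. w $ i * x i"
  interpret circle: prob_space circle_haar by (rule prob_space_circle_haar)
  interpret product_sigma_finite "\<lambda>i::'n. circle_haar" ..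
  have w: "cmod (w $ i) = 1" for i using assms by (simp add: torus_def)
  have rc: "(\<lambda>z. w $ i * z) \<in> circle_haar \<rightarrow>\<^sub>M circle_haar" for i
    unfolding measurable_cong_sets[OF sets_circle_haar sets_circle_haar]
    by (intro measurable_restrict_space3) (auto simp: norm_mult w)
  have "(\<lambda>x. w $ i * x i) \<in> ?P \<rightarrow>\<^sub>M circle_haar" for i
    by (rule measurable_compose[OF _ rc]) simp
  then have r: "?r \<in> ?P \<rightarrow>\<^sub>M ?P"
    by (intro measurable_PiM_single') (auto simp: space_PiM space_circle_haar norm_mult w PiE_def Pi_def)
  have "distr ?P ?P ?r = ?P"
  proof (rule PiM_eqI)
    fix A :: "'n \<Rightarrow> complex set" assume A: "\<And>i. i \<in> UNIV \<Longrightarrow> A i \<in> sets circle_haar"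
    let ?B = "\<lambda>i. (\<lambda>z. w $ i * z) -` A i \<inter> space circle_haar"
    have B: "?B i \<in> sets circle_haar" for i
      by (rule measurable_sets[OF rc]) (simp add: A)
    have PA: "Pi\<^sub>E UNIV A \<in> sets ?P"
      using A by (intro sets_PiM_I_finite) auto
    have pre: "?r -` Pi\<^sub>E UNIV A \<inter> space ?P = Pi\<^sub>E UNIV ?B"
      by (auto simp: space_PiM PiE_def Pi_def)
    have "emeasure (distr ?P ?P ?r) (Pi\<^sub>E UNIV A) = emeasure ?P (Pi\<^sub>E UNIV ?B)"
      by (simp only: emeasure_distr[OF r PA] pre)
    also have "\<dots> = (\<Prod>i\<in>UNIV. emeasure circle_haar (?B i))"
      using B by (intro emeasure_PiM) auto
    also have "\<dots> = (\<Prod>i\<in>UNIV. emeasure circle_haar (A i))"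
    proof (intro prod.cong refl)
      fix i
      show "emeasure circle_haar (?B i) = emeasure circle_haar (A i)"
        using emeasure_distr[OF rc[of i] A[of i]] circle_haar_invariant[OF w, of i] by simp
    qed
    finally show "emeasure (distr ?P ?P ?r) (Pi\<^sub>E UNIV A) = (\<Prod>i\<in>UNIV. emeasure circle_haar (A i))" .
  qed auto
  moreover have rt: "(\<lambda>z. \<chi> i. w $ i * z $ i) \<in> ?T \<rightarrow>\<^sub>M ?T"
    by (intro measurable_restrict_space3 borel_measurable_continuous_onI continuous_intros)
       (auto simp: torus_def norm_mult w)
  moreover have "distr torus_haar torus_haar (\<lambda>z. \<chi> i. w $ i * z $ i) = distr (distr ?P ?P ?r) ?T vec_lambda"
  proof -
    have "distr torus_haar torus_haar (\<lambda>z. \<chi> i. w $ i * z $ i)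
        = distr torus_haar ?T (\<lambda>z. \<chi> i. w $ i * z $ i)"
      by (intro distr_cong) (auto simp: sets_torus_haar)
    also have "\<dots> = distr ?P ?T ((\<lambda>z. \<chi> i. w $ i * z $ i) \<circ> vec_lambda)"
      unfolding torus_haar_def by (rule distr_distr[OF rt measurable_vec_lambda_torus])
    also have "\<dots> = distr ?P ?T (vec_lambda \<circ> ?r)" by (simp add: comp_def)
    also have "\<dots> = distr (distr ?P ?P ?r) ?T vec_lambda"
      by (rule distr_distr[OF measurable_vec_lambda_torus r, symmetric])
    finally show ?thesis .
  qed
  ultimately show ?thesis by (simp add: torus_haar_def)
qed

lemma continuous_on_theta: "continuous_on S (theta ix m t)"
proof -
  have "continuous_on S (\<lambda>z. theta ix m t z $ i)" for i
    by (cases "ix i = CARD('a)")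
       (auto simp: theta_def elem_sym_def intro!: continuous_intros)
  then have "continuous_on S (\<lambda>z. \<chi> i. theta ix m t z $ i)"
    by (rule continuous_on_vec_lambda)
  then show ?thesis by simp
qed

lemma prob_space_theta_measure: "prob_space (theta_measure ix m t)"
proof -
  interpret prob_space torus_haar by (rule prob_space_torus_haar)
  have "theta ix m t \<in> restrict_space borel torus \<rightarrow>\<^sub>M restrict_space borel (theta_boundary ix m t)"
    by (intro measurable_restrict_space3 borel_measurable_continuous_onI continuous_on_theta) auto
  then show ?thesis unfolding theta_measure_def
    by (intro prob_space_distr) (simp add: measurable_cong_sets[OF sets_torus_haar refl])
qed

lemma dilation_theta:
  assumes "t dvd m"
  shows "dilation ix m t r (theta ix m t z) = theta ix m t (\<chi> i. of_real r * z $ i)"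
proof -
  let ?r = "complex_of_real r"
  have S: "(\<Prod>k\<in>S. (?r * z $ k) ^ m) = ?r ^ (card S * m) * (\<Prod>k\<in>S. z $ k ^ m)" for S
    by (simp add: power_mult_distrib prod.distrib mult.commute flip: power_mult)
  have U: "(\<Prod>k\<in>UNIV. ?r * z $ k) ^ (m div t)
      = ?r ^ (CARD('a) * m div t) * (\<Prod>k\<in>UNIV. z $ k) ^ (m div t)"
    using assms by (simp add: power_mult_distrib prod.distrib div_mult_swap flip: power_mult)
  show ?thesis
    by (simp add: vec_eq_iff dilation_def theta_def elem_sym_def S U sum_distrib_left)
qed

end

theory Submission
  imports Defs "HOL-Complex_Analysis.Conformal_Mappings"
begin

text \<open>
  Pull \<open>f\<close> back to the bounded holomorphic function \<open>F = f \<circ> theta\<close> on the polydisc. By Fatou's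
  theorem on the diagonal slices \<open>w \<mapsto> F (w z)\<close> and Fubini, \<open>F (r z)\<close> converges for almost every \<open>z\<close> in
  the torus, hence in \<open>L\<^sup>2\<close> by dominated convergence. For fixed \<open>r < 1\<close> the dilate is a
  uniform limit of polynomials on the closed polydisc; averaging these over \<open>G(m,t,d)\<close> yields
  polynomials in \<open>theta\<close>, and after scaling down one is left with \<open>P \<circ> theta\<close>, where \<open>P\<close> has sup norm
  less than \<open>1\<close> on the boundary. On \<open>theta(T\<^sup>d)\<close> the conjugate of \<open>q\<^sub>j\<close> is \<open>q\<^sub>d\<^sub>-\<^sub>j / q\<^sub>d\<^sup>t\<close>, so that
  \<open>Q = q\<^sub>d\<^sup>K * cnj P\<close> agrees with a polynomial there for large \<open>K\<close>. The functions
  \<open>(P + l q\<^sub>d\<^sup>K) / (1 + l Q)\<close> with \<open>\<bar>l\<bar> = 1\<close> are then rational inner, and their mean over the \<open>N\<close>-th roots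
  of unity converges uniformly to \<open>P\<close>.
\<close>

subsection \<open>Polynomials in several variables\<close>

text \<open>Convex combinations from the disc algebra have continuous boundary functions, while that
  of \<open>f\<close> need not be continuous. So all uniform estimates concern a dilate of
  \<open>f\<close>, and only the passage to radius 1 is in the L^2 sense. The quotient comes from
  one variable: if |P| < 1 and |M| = 1, then (P + l M) / (1 + l M cnj P) is unimodular for |l| = 1,
  is holomorphic in l on the closed disc and has the value P at l = 0. Its circle average is
  therefore P, and N equally spaced nodes replace the circle with an error of order \<rho>^N, where
  |P| \<le> \<rho> < 1. The strict bound also keeps the denominators away from zero on the whole
  closed domain, by the maximum principle; this is why P is scaled down. Invariant theory enters
  only for group averages of monomials: a character sum decides between zero and an explicit
  product. Fatou's theorem rests on a primitive of the bounded function, which is Lipschitz up to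
  the circle: where it has a tangential derivative, its complex derivative has a radial
  limit.\<close>

lemma polynomial_sev_const: "polynomial_sev (\<lambda>_. c)"
  unfolding polynomial_sev_def
  by (rule exI[of _ "{\<lambda>_. 0}"], rule exI[of _ "\<lambda>_. c"]) auto

lemma polynomial_sev_coord: "polynomial_sev (\<lambda>z. z $ i)"
  unfolding polynomial_sev_def
proof (intro exI[of _ "{\<lambda>k. if k = i then 1 else 0}"] exI[of _ "\<lambda>_. 1"] conjI ext)
  fix z :: "complex^'a"
  have "(\<Prod>k\<in>UNIV. z $ k ^ (if k = i then 1 else 0)) = (\<Prod>k\<in>UNIV. if k = i then z $ k else 1)"
    by (intro prod.cong) auto
  then show "z $ i = (\<Sum>a\<in>{\<lambda>k. if k = i then 1 else 0}. 1 * (\<Prod>k\<in>UNIV. z $ k ^ a k))"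
    by simp
qed auto

lemma polynomial_sev_add:
  assumes "polynomial_sev p" "polynomial_sev q"
  shows "polynomial_sev (\<lambda>z. p z + q z)"
proof -
  obtain A c where A: "finite A" "p = (\<lambda>z. \<Sum>a\<in>A. c a * (\<Prod>i\<in>UNIV. z $ i ^ a i))"
    using assms(1) unfolding polynomial_sev_def by auto
  obtain B e where B: "finite B" "q = (\<lambda>z. \<Sum>a\<in>B. e a * (\<Prod>i\<in>UNIV. z $ i ^ a i))"
    using assms(2) unfolding polynomial_sev_def by auto
  let ?m = "\<lambda>z a. \<Prod>i\<in>UNIV. z $ i ^ a i"
  have p: "p z = (\<Sum>a\<in>A \<union> B. (if a \<in> A then c a else 0) * ?m z a)" for z
    unfolding A(2) by (rule sum.mono_neutral_cong_left) (use A(1) B(1) in auto)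
  have q: "q z = (\<Sum>a\<in>A \<union> B. (if a \<in> B then e a else 0) * ?m z a)" for z
    unfolding B(2) by (rule sum.mono_neutral_cong_left) (use A(1) B(1) in auto)
  show ?thesis unfolding polynomial_sev_def
    by (rule exI[of _ "A \<union> B"],
        rule exI[of _ "\<lambda>a. (if a \<in> A then c a else 0) + (if a \<in> B then e a else 0)"])
       (use A(1) B(1) in \<open>simp add: p q ring_distribs sum.distrib fun_eq_iff\<close>)
qed

lemma polynomial_sev_sum:
  "(\<And>k. k \<in> K \<Longrightarrow> polynomial_sev (p k)) \<Longrightarrow> polynomial_sev (\<lambda>z. \<Sum>k\<in>K. p k z)"
  by (induction K rule: infinite_finite_induct)
     (auto intro: polynomial_sev_const polynomial_sev_add)

lemma polynomial_sev_mult: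
  assumes "polynomial_sev p" "polynomial_sev q"
  shows "polynomial_sev (\<lambda>z. p z * q z)"
proof -
  obtain A c where A: "finite A" "p = (\<lambda>z. \<Sum>a\<in>A. c a * (\<Prod>i\<in>UNIV. z $ i ^ a i))"
    using assms(1) unfolding polynomial_sev_def by auto
  obtain B e where B: "finite B" "q = (\<lambda>z. \<Sum>a\<in>B. e a * (\<Prod>i\<in>UNIV. z $ i ^ a i))"
    using assms(2) unfolding polynomial_sev_def by auto
  have "polynomial_sev (\<lambda>z. (c a * (\<Prod>i\<in>UNIV. z $ i ^ a i)) * (e b * (\<Prod>i\<in>UNIV. z $ i ^ b i)))"
    for a b unfolding polynomial_sev_def
    by (rule exI[of _ "{\<lambda>i. a i + b i}"], rule exI[of _ "\<lambda>_. c a * e b"])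
       (auto simp: power_add prod.distrib)
  then have "polynomial_sev (\<lambda>z. \<Sum>a\<in>A. \<Sum>b\<in>B. (c a * (\<Prod>i\<in>UNIV. z $ i ^ a i)) * (e b * (\<Prod>i\<in>UNIV. z $ i ^ b i)))"
    by (intro polynomial_sev_sum)
  then show ?thesis by (simp add: A(2) B(2) sum_product)
qed

lemma polynomial_sev_prod:
  "(\<And>k. k \<in> K \<Longrightarrow> polynomial_sev (p k)) \<Longrightarrow> polynomial_sev (\<lambda>z. \<Prod>k\<in>K. p k z)"
  by (induction K rule: infinite_finite_induct)
     (auto intro: polynomial_sev_const polynomial_sev_mult)

lemma polynomial_sev_power: "polynomial_sev p \<Longrightarrow> polynomial_sev (\<lambda>z. p z ^ n)"
  by (induction n) (auto intro: polynomial_sev_const polynomial_sev_mult)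

lemmas polynomial_sev_intros = polynomial_sev_const polynomial_sev_coord polynomial_sev_add
  polynomial_sev_sum polynomial_sev_mult polynomial_sev_prod polynomial_sev_power

lemma polynomial_sev_induct [consumes 1, case_names const coord add mult]:
  assumes "polynomial_sev p"
    and const: "\<And>c. R (\<lambda>_. c)" and coord: "\<And>i. R (\<lambda>z. z $ i)"
    and add: "\<And>p q. R p \<Longrightarrow> R q \<Longrightarrow> R (\<lambda>z. p z + q z)"
    and mult: "\<And>p q. R p \<Longrightarrow> R q \<Longrightarrow> R (\<lambda>z. p z * q z)"
  shows "R p"
proof -
  obtain A c where A: "p = (\<lambda>z. \<Sum>a\<in>A. c a * (\<Prod>i\<in>UNIV. z $ i ^ a i))"
    using assms(1) unfolding polynomial_sev_def by auto
  have pow: "R (\<lambda>z. z $ i ^ n)" for i n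
    by (induction n) (auto intro: const mult coord)
  have prod: "R (\<lambda>z. \<Prod>i\<in>I. z $ i ^ a i)" for I a
    by (induction I rule: infinite_finite_induct) (auto intro: const mult pow)
  show ?thesis unfolding A
  proof (induction A rule: infinite_finite_induct)
    case (insert a A)
    then show ?case by (simp add: add[OF mult[OF const prod] insert.IH])
  qed (auto intro: const)
qed

lemma polynomial_sev_compose:
  assumes "polynomial_sev p" "\<And>i. polynomial_sev (\<lambda>z. g z $ i)"
  shows "polynomial_sev (\<lambda>z. p (g z))"
  using assms(1) by (induction rule: polynomial_sev_induct) (auto intro: polynomial_sev_intros assms(2))

lemma continuous_on_polynomial_sev: "polynomial_sev p \<Longrightarrow> continuous_on S p"
  by (induction rule: polynomial_sev_induct) (auto intro!: continuous_intros)

lemma polynomial_sev_has_derivative: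
  assumes "polynomial_sev p"
  shows "\<exists>D. (p has_derivative D) (at z) \<and> (\<forall>c v. D (c *s v) = c * D v)"
  using assms
proof (induction rule: polynomial_sev_induct)
  case (const c)
  show ?case by (rule exI[of _ "\<lambda>_. 0"]) auto
next
  case (coord i)
  show ?case
    by (rule exI[of _ "\<lambda>v. v $ i"]) (auto intro!: bounded_linear_imp_has_derivative bounded_linear_vec_nth)
next
  case (add p q)
  then obtain D E where "(p has_derivative D) (at z)" "\<forall>c v. D (c *s v) = c * D v"
    "(q has_derivative E) (at z)" "\<forall>c v. E (c *s v) = c * E v" by blast
  then show ?case
    by (intro exI[of _ "\<lambda>v. D v + E v"]) (auto intro!: has_derivative_add simp: ring_distribs)
next
  case (mult p q)
  then obtain D E where "(p has_derivative D) (at z)" "\<forall>c v. D (c *s v) = c * D v"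
    "(q has_derivative E) (at z)" "\<forall>c v. E (c *s v) = c * E v" by blast
  then show ?case
    by (intro exI[of _ "\<lambda>v. p z * E v + D v * q z"] conjI has_derivative_mult) (auto simp: algebra_simps)
qed

lemma holomorphic_sev_quotient:
  assumes "polynomial_sev p" "polynomial_sev q" "\<And>z. z \<in> U \<Longrightarrow> q z \<noteq> 0"
  shows "holomorphic_sev (\<lambda>z. p z / q z) U"
  unfolding holomorphic_sev_def
proof
  fix z assume z: "z \<in> U"
  obtain D where D: "(p has_derivative D) (at z)" "\<forall>c v. D (c *s v) = c * D v"
    using polynomial_sev_has_derivative[OF assms(1)] by blast
  obtain E where E: "(q has_derivative E) (at z)" "\<forall>c v. E (c *s v) = c * E v"
    using polynomial_sev_has_derivative[OF assms(2)] by blast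
  show "\<exists>D. ((\<lambda>z. p z / q z) has_derivative D) (at z) \<and> (\<forall>c v. D (c *s v) = c * D v)"
    by (intro exI[of _ "\<lambda>v. (D v * q z - p z * E v) / (q z * q z)"] conjI has_derivative_divide' D(1) E(1))
       (use assms(3)[OF z] D(2) E(2) in \<open>auto simp: algebra_simps diff_divide_distrib\<close>)
qed

text \<open>Complex linearity of \<open>D\<close> turns the real chain rule into a complex one: with
  v the vector of coordinate derivatives, \<open>D (h *s v) = h * D v\<close>, so the derivative of
  the composite is multiplication by \<open>D v\<close>. Coordinate slices and the diagonal slices
  of Fatou's theorem are both instances.\<close>

lemma holomorphic_sev_slice:
  assumes f: "holomorphic_sev f U" and \<gamma>: "\<And>i. (\<lambda>w. \<gamma> w $ i) field_differentiable (at w)"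
    and U: "\<gamma> w \<in> U"
  shows "(\<lambda>w. f (\<gamma> w)) field_differentiable (at w)"
proof -
  obtain D where D: "(f has_derivative D) (at (\<gamma> w))" "\<forall>c v. D (c *s v) = c * D v"
    using f U unfolding holomorphic_sev_def by blast
  obtain \<gamma>' where \<gamma>': "\<And>i. ((\<lambda>w. \<gamma> w $ i) has_field_derivative \<gamma>' i) (at w)"
    using \<gamma> unfolding field_differentiable_def by metis
  have "(\<gamma> has_derivative (\<lambda>h. h *s (\<chi> i. \<gamma>' i))) (at w)"
  proof (subst has_derivative_componentwise_within, intro ballI)
    fix b :: "complex^'a" assume "b \<in> Basis"
    then obtain i c where b: "b = axis i c" by (auto simp: Basis_vec_def)
    have "((\<lambda>w. \<gamma> w $ i \<bullet> c) has_derivative (\<lambda>h. (h * \<gamma>' i) \<bullet> c)) (at w)"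
      by (rule has_derivative_inner_left, rule has_derivative_eq_rhs)
         (rule \<gamma>'[of i, unfolded has_field_derivative_def], simp add: fun_eq_iff mult.commute)
    then show "((\<lambda>x. \<gamma> x \<bullet> b) has_derivative (\<lambda>x. (x *s (\<chi> i. \<gamma>' i)) \<bullet> b)) (at w)"
      by (simp add: b inner_axis)
  qed
  from has_derivative_compose[OF this D(1)]
  have "((\<lambda>w. f (\<gamma> w)) has_derivative (\<lambda>h. h * D (\<chi> i. \<gamma>' i))) (at w)"
    using D(2) by simp
  moreover have "(\<lambda>h. h * D (\<chi> i. \<gamma>' i)) = (*) (D (\<chi> i. \<gamma>' i))"
    by (rule mult_commute_abs)
  ultimately show ?thesis
    unfolding field_differentiable_def has_field_derivative_def by metis
qed

section \<open>The closed polydisc and the maximum principle on its distinguished boundary\<close>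

definition closed_polydisc :: "(complex^'n) set" where
  "closed_polydisc = {z. \<forall>i. cmod (z $ i) \<le> 1}"

lemma polydisc_subset_closed: "polydisc \<subseteq> closed_polydisc"
  by (auto simp: polydisc_def closed_polydisc_def less_imp_le)

lemma torus_subset_closed: "torus \<subseteq> closed_polydisc"
  by (auto simp: torus_def closed_polydisc_def)

lemma compact_closed_polydisc: "compact (closed_polydisc :: (complex^'n) set)"
proof -
  have "closed (closed_polydisc :: (complex^'n) set)"
  proof -
    have "closed {z :: complex^'n. cmod (z $ i) \<le> 1}" for i
      by (intro closed_Collect_le continuous_intros)
    then have "closed (\<Inter>i. {z :: complex^'n. cmod (z $ i) \<le> 1})"
      by (intro closed_INT) blast
    also have "(\<Inter>i. {z :: complex^'n. cmod (z $ i) \<le> 1}) = closed_polydisc"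
      by (auto simp: closed_polydisc_def)
    finally show ?thesis .
  qed
  moreover have "bounded (closed_polydisc :: (complex^'n) set)"
  proof (rule boundedI)
    fix z :: "complex^'n" assume "z \<in> closed_polydisc"
    then have "(\<Sum>i\<in>UNIV. norm (z $ i)) \<le> (\<Sum>i\<in>(UNIV::'n set). 1)"
      by (intro sum_mono) (auto simp: closed_polydisc_def)
    then show "norm z \<le> (\<Sum>i\<in>(UNIV::'n set). 1)"
      unfolding norm_vec_def using L2_set_le_sum[of UNIV "\<lambda>i. norm (z $ i)"] by simp
  qed
  ultimately show ?thesis by (simp add: compact_eq_bounded_closed)
qed

definition upd :: "complex^'n \<Rightarrow> 'n \<Rightarrow> complex \<Rightarrow> complex^'n" where
  "upd z i w = (\<chi> k. if k = i then w else z $ k)"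

lemma upd_nth: "upd z i w $ k = (if k = i then w else z $ k)"
  by (simp add: upd_def)

lemma upd_same: "upd z i (z $ i) = z"
  by (simp add: vec_eq_iff upd_nth)

lemma holomorphic_on_upd_polynomial:
  "polynomial_sev p \<Longrightarrow> (\<lambda>w. p (upd z i w)) holomorphic_on S"
proof (induction rule: polynomial_sev_induct)
  case (coord k)
  show ?case by (cases "k = i") (auto simp: upd_nth intro!: holomorphic_intros)
qed (auto intro!: holomorphic_intros)

text \<open>The set \<open>I\<close> of the induction collects the coordinates that may lie inside
  the disc. With the others frozen, the one-variable maximum principle moves coordinate
  \<open>i\<close> to the circle, which removes it from \<open>I\<close>.\<close>

lemma polynomial_sev_max_torus:
  fixes p :: "complex^'n \<Rightarrow> complex"
  assumes p: "polynomial_sev p" and le: "\<And>z. z \<in> torus \<Longrightarrow> cmod (p z) \<le> c"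
    and z: "z \<in> closed_polydisc"
  shows "cmod (p z) \<le> c"
proof -
  have "cmod (p z) \<le> c"
    if "finite I" "\<forall>i. cmod (z $ i) \<le> 1" "\<forall>i. i \<notin> I \<longrightarrow> cmod (z $ i) = 1" for I and z :: "complex^'n"
    using that
  proof (induction I arbitrary: z rule: finite_induct)
    case empty
    then show ?case by (intro le) (auto simp: torus_def)
  next
    case (insert i I)
    have fr: "cmod (p (upd z i w)) \<le> c" if "w \<in> frontier (cball 0 1)" for w
      using that insert.prems by (intro insert.IH) (auto simp: upd_nth frontier_cball)
    have "cmod (p (upd z i (z $ i))) \<le> c"
      by (rule maximum_modulus_frontier[where f = "\<lambda>w. p (upd z i w)" and S = "cball 0 1"])
         (use fr insert.prems in \<open>auto intro!: holomorphic_on_upd_polynomial[OF p] holomorphic_on_imp_continuous_on\<close>)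
    then show ?case by (simp add: upd_same)
  qed
  from this[of UNIV z] z show ?thesis by (auto simp: closed_polydisc_def)
qed

subsection \<open>Polynomial approximation on the polydisc\<close>

definition unity_root :: "nat \<Rightarrow> nat \<Rightarrow> complex" where
  "unity_root N k = cis (2 * pi * real k / real N)"

lemma norm_unity_root [simp]: "cmod (unity_root N k) = 1"
  by (simp add: unity_root_def)

lemma unity_root_power: "unity_root N k ^ j = unity_root N (k * j)"
  by (simp add: unity_root_def Complex.DeMoivre field_simps)

lemma unity_root_power_self: "N > 0 \<Longrightarrow> unity_root N k ^ N = 1"
  by (simp add: unity_root_def Complex.DeMoivre cis_multiple_2pi)

lemma sum_unity_root_power:
  assumes "N > 0"
  shows "(\<Sum>k<N. unity_root N k ^ j) = (if N dvd j then of_nat N else 0)"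
proof -
  let ?w = "unity_root N j"
  have eq: "unity_root N k ^ j = ?w ^ k" for k by (simp add: unity_root_power mult.commute)
  have wN: "?w ^ N = 1"
    using assms by (rule unity_root_power_self)
  have "?w = 1 \<longleftrightarrow> N dvd j"
  proof
    assume "?w = 1"
    then have "exp (2 * of_real pi * \<i> * of_nat j / of_nat N) = 1"
      by (simp add: unity_root_def cis_conv_exp algebra_simps)
    then show "N dvd j" using assms complex_root_unity_eq_1[of N j] by simp
  next
    assume "N dvd j"
    then obtain q where q: "j = N * q" by blast
    have "?w = cis (2 * pi) ^ q"
      using assms by (simp add: unity_root_def Complex.DeMoivre q field_simps)
    then show "?w = 1" by simp
  qed
  then show ?thesis
    unfolding eq using wN sum_gp_strict[of ?w N] by auto
qed

text \<open>
  Interpolation of \<open>w \<mapsto> g (s w)\<close> at the \<open>N\<close>-th roots of unity. The coefficients of \<open>g\<close> are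
  bounded by \<open>1\<close>, and the interpolation maps the monomial of degree \<open>k\<close> to that of degree
  \<open>k mod N\<close>.
\<close>
lemma unity_root_interpolation:
  assumes hol: "g holomorphic_on ball 0 1" and bdd: "\<And>z. cmod z < 1 \<Longrightarrow> cmod (g z) \<le> 1"
    and s: "0 < s" "s < 1" and z: "cmod z \<le> 1" and N: "N > 0"
  shows "cmod ((\<Sum>k<N. g (of_real s * unity_root N k) * ((\<Sum>j<N. (z * cnj (unity_root N k)) ^ j) / of_nat N))
            - g (of_real s * z)) \<le> 2 * s ^ N / (1 - s)"
proof -
  define c where "c = (\<lambda>n. (deriv ^^ n) g 0 / fact n)"
  have sums: "(\<lambda>n. c n * w ^ n) sums g w" if "cmod w < 1" for w
    using holomorphic_power_series[OF hol, of w] that by (simp add: c_def)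
  \<comment> \<open>\<open>g\<close> is only known on the open disc, so Cauchy's inequality is used
    at radius r < 1, and r tends to 1.\<close>
  have coeff: "cmod (c n) \<le> 1" for n
  proof -
    have le: "cmod (c n) * r ^ n \<le> 1" if r: "0 < r" "r < 1" for r
    proof -
      have "cmod ((deriv ^^ n) g 0) \<le> fact n * 1 / r ^ n"
        by (rule Cauchy_inequality)
           (use r in \<open>auto intro!: holomorphic_on_subset[OF hol] holomorphic_on_imp_continuous_on bdd\<close>)
      then show ?thesis using r by (simp add: c_def norm_divide field_simps)
    qed
    have "((\<lambda>r. cmod (c n) * r ^ n) \<longlongrightarrow> cmod (c n) * 1 ^ n) (at_left (1::real))"
      by (intro tendsto_intros)
    moreover have "\<forall>\<^sub>F r in at_left (1::real). cmod (c n) * r ^ n \<le> 1"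
      using eventually_at_left_real[of 0 1, simplified] by eventually_elim (auto intro: le)
    ultimately show ?thesis
      using tendsto_upperbound[of "\<lambda>r. cmod (c n) * r ^ n" _ "at_left (1::real)" 1] by simp
  qed
  have avg: "(\<Sum>k<N. (of_real s * unity_root N k) ^ n * ((\<Sum>j<N. (z * cnj (unity_root N k)) ^ j) / of_nat N))
      = of_real s ^ n * z ^ (n mod N)" for n
  proof -
    \<comment> \<open>On roots of unity conjugation is inversion. The form \<open>N - j\<close>
      keeps the exponents natural, so that the orthogonality relation
      \<open>sum_unity_root_power\<close> applies to the whole product.\<close>
    have uc: "unity_root N k ^ n * cnj (unity_root N k) ^ j = unity_root N k ^ (n + (N - j))"
      if "j < N" for k j
    proof -
      let ?u = "unity_root N k"
      have "?u ^ N = 1" using N by (rule unity_root_power_self)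
      then have "?u ^ (N - j) * ?u ^ j = 1" using that by (simp flip: power_add)
      moreover have "?u ^ j * cnj ?u ^ j = 1"
        by (simp flip: power_mult_distrib add: complex_norm_square[symmetric])
      ultimately have "cnj ?u ^ j = ?u ^ (N - j)"
        by (metis mult.assoc mult.left_neutral mult.right_neutral)
      then show ?thesis by (simp add: power_add)
    qed
    have dvd: "N dvd (n + (N - j)) \<longleftrightarrow> j = n mod N" if "j < N" for j
    proof -
      define r where "r = n mod N"
      have r: "r < N" using N by (simp add: r_def)
      have "(n + (N - j)) mod N = (r + (N - j)) mod N" by (simp add: r_def mod_add_left_eq)
      moreover consider "r < j" | "r = j" | "j < r" by linarith
      then have "(r + (N - j)) mod N = 0 \<longleftrightarrow> j = r"
      proof cases
        case 3
        then have e: "r + (N - j) = (r - j) + N" using that by simp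
        have "(r + (N - j)) mod N = r - j" unfolding e using r by simp
        then show ?thesis using 3 by simp
      qed (use that in auto)
      ultimately show ?thesis by (simp only: dvd_eq_mod_eq_0 r_def)
    qed
    have "(\<Sum>k<N. (of_real s * unity_root N k) ^ n * ((\<Sum>j<N. (z * cnj (unity_root N k)) ^ j) / of_nat N))
       = (\<Sum>k<N. \<Sum>j<N. of_real s ^ n * z ^ j / of_nat N * (unity_root N k ^ n * cnj (unity_root N k) ^ j))"
      by (simp add: sum_distrib_left sum_divide_distrib power_mult_distrib mult_ac)
    also have "\<dots> = (\<Sum>j<N. of_real s ^ n * z ^ j / of_nat N * (\<Sum>k<N. unity_root N k ^ (n + (N - j))))"
      by (subst sum.swap) (simp add: uc sum_distrib_left)
    also have "\<dots> = (\<Sum>j<N. if j = n mod N then of_real s ^ n * z ^ j else 0)"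
      using N by (intro sum.cong refl, subst sum_unity_root_power, simp, subst dvd) auto
    also have "\<dots> = of_real s ^ n * z ^ (n mod N)"
      using N by simp
    finally show ?thesis .
  qed
  have sz: "cmod (of_real s * z) < 1"
    using s z by (simp add: norm_mult) (metis mult_left_le mult.commute le_less_trans less_imp_le)
  have "(\<lambda>n. \<Sum>k<N. c n * (of_real s * unity_root N k) ^ n * ((\<Sum>j<N. (z * cnj (unity_root N k)) ^ j) / of_nat N))
     sums (\<Sum>k<N. g (of_real s * unity_root N k) * ((\<Sum>j<N. (z * cnj (unity_root N k)) ^ j) / of_nat N))"
    by (intro sums_sum sums_mult2 sums) (use s in \<open>simp add: norm_mult\<close>)
  from sums_diff[OF this sums[OF sz]]
  have "(\<lambda>n. c n * of_real s ^ n * (z ^ (n mod N) - z ^ n)) sums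
      ((\<Sum>k<N. g (of_real s * unity_root N k) * ((\<Sum>j<N. (z * cnj (unity_root N k)) ^ j) / of_nat N))
            - g (of_real s * z))" (is "?t sums ?D")
    unfolding mult.assoc[of "c _"] sum_distrib_left[symmetric] avg
    by (simp add: power_mult_distrib algebra_simps)
  moreover have "(\<lambda>n. ?t (n + N)) sums (?D - (\<Sum>i<N. ?t i))"
    by (rule sums_split_initial_segment[OF \<open>?t sums ?D\<close>])
  \<comment> \<open>Interpolation is exact below degree \<open>N\<close>, where
    \<open>n mod N = n\<close>. Only the tail of the power series contributes, and it is dominated
    by twice a geometric series.\<close>
  moreover have "(\<Sum>i<N. ?t i) = 0" by simp
  ultimately have D: "(\<lambda>n. ?t (n + N)) sums ?D" by simp
  have bound: "cmod (?t (n + N)) \<le> 2 * s ^ N * s ^ n" for n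
  proof -
    have "cmod (z ^ i) \<le> 1" for i using z by (simp add: norm_power power_le_one)
    then have "cmod (z ^ ((n + N) mod N) - z ^ (n + N)) \<le> 1 + 1"
      by (meson norm_triangle_ineq4 add_mono order_trans)
    then have "cmod (c (n + N)) * s ^ (n + N) * cmod (z ^ ((n + N) mod N) - z ^ (n + N)) \<le> 1 * s ^ (n + N) * (1 + 1)"
      using coeff[of "n + N"] s by (intro mult_mono) auto
    then show ?thesis using s by (simp add: norm_mult norm_power power_add mult_ac)
  qed
  have geo: "(\<lambda>n. 2 * s ^ N * s ^ n) sums (2 * s ^ N * (1 / (1 - s)))"
    using s by (intro sums_mult geometric_sums) auto
  have "cmod ?D \<le> 2 * s ^ N * (1 / (1 - s))"
    using sums_unique[OF D] norm_suminf_le[OF bound sums_summable[OF geo]] sums_unique[OF geo] by simp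
  then show ?thesis by simp
qed

definition separately_holomorphic :: "(complex^'n \<Rightarrow> complex) \<Rightarrow> bool" where
  "separately_holomorphic F \<longleftrightarrow>
     (\<forall>z\<in>polydisc. \<forall>i. (\<lambda>w. F (upd z i w)) holomorphic_on ball 0 1)"

text \<open>
  Interpolating one coordinate at a time: every node freezes that coordinate, so that holomorphy
  in the remaining coordinates is preserved.
\<close>
lemma polynomial_approximation_aux:
  fixes F :: "complex^'n \<Rightarrow> complex"
  assumes "finite I" "0 < s" "s < 1" "0 < \<delta>"
    and "separately_holomorphic F" "\<And>z. z \<in> polydisc \<Longrightarrow> cmod (F z) \<le> 1"
    and "c \<in> polydisc"
  shows "\<exists>p. polynomial_sev p \<and>
    (\<forall>z\<in>closed_polydisc. cmod (p z - F (\<chi> i. if i \<in> I then of_real s * z $ i else c $ i)) < \<delta>)"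
  using assms(1) assms(4-7)
proof (induction I arbitrary: \<delta> c rule: finite_induct)
  case empty
  show ?case
    by (rule exI[of _ "\<lambda>_. F c"]) (use empty in \<open>auto intro: polynomial_sev_const\<close>)
next
  case (insert i I)
  have "(\<lambda>N. 2 * s ^ N / (1 - s)) \<longlonglongrightarrow> 2 * 0 / (1 - s)"
    by (intro tendsto_intros LIMSEQ_realpow_zero) (use assms in auto)
  then have "\<forall>\<^sub>F N in sequentially. 2 * s ^ N / (1 - s) < \<delta> / 2"
    by (rule order_tendstoD(2)) (use insert.prems in auto)
  then obtain N where N: "N > 0" "2 * s ^ N / (1 - s) < \<delta> / 2"
    using eventually_happens[OF eventually_conj[OF _ eventually_gt_at_top[of 0]]] by auto
  let ?u = "unity_root N"
  \<comment> \<open>Half of \<open>\<delta>\<close> pays for the interpolation in coordinate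
    \<open>i\<close>. The other half is shared by the \<open>N\<close> nodes, whose weights
    \<open>?l k z\<close> have modulus at most 1, hence \<open>\<delta> / (2 * N)\<close> for each
    of them.\<close>
  have "\<forall>k. \<exists>p. polynomial_sev p \<and> (\<forall>z\<in>closed_polydisc. cmod (p z - F (\<chi> j. if j \<in> I then of_real s * z $ j
      else upd c i (of_real s * ?u k) $ j)) < \<delta> / (2 * N))"
    by (intro allI insert.IH)
       (use insert.prems N assms in \<open>auto simp: polydisc_def upd_nth norm_mult\<close>)
  then obtain p where p: "\<And>k. polynomial_sev (p k)"
    "\<And>k z. z \<in> closed_polydisc \<Longrightarrow> cmod (p k z - F (\<chi> j. if j \<in> I then of_real s * z $ j
      else upd c i (of_real s * ?u k) $ j)) < \<delta> / (2 * N)" by metis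
  let ?l = "\<lambda>k z. (\<Sum>j<N. (z $ i * cnj (?u k)) ^ j) / of_nat N"
  let ?P = "\<lambda>z. \<Sum>k<N. p k z * ?l k z"
  have "polynomial_sev ?P"
    unfolding divide_inverse by (intro polynomial_sev_intros p)
  moreover have "cmod (?P z - F (\<chi> j. if j \<in> insert i I then of_real s * z $ j else c $ j)) < \<delta>"
    if z: "z \<in> closed_polydisc" for z
  proof -
    define b where "b = (\<chi> j. if j \<in> I then of_real s * z $ j else c $ j)"
    have zle: "cmod (z $ j) \<le> 1" for j using z by (auto simp: closed_polydisc_def)
    have sz: "s * cmod (z $ j) < 1" for j
      using assms(2,3) zle[of j] by (meson mult_left_le less_imp_le le_less_trans)
    have b: "b \<in> polydisc"
      using insert.prems(4) sz assms(2) by (auto simp: b_def polydisc_def norm_mult)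
    have node: "(\<chi> j. if j \<in> I then of_real s * z $ j else upd c i w $ j) = upd b i w" for w
      using insert.hyps by (auto simp: vec_eq_iff b_def upd_nth)
    have goal: "(\<chi> j. if j \<in> insert i I then of_real s * z $ j else c $ j) = upd b i (of_real s * z $ i)"
      by (auto simp: vec_eq_iff b_def upd_nth)
    have hol: "(\<lambda>w. F (upd b i w)) holomorphic_on ball 0 1"
      using insert.prems(2) b by (simp add: separately_holomorphic_def)
    have upd_polydisc: "upd b i w \<in> polydisc" if "cmod w < 1" for w
      using that b by (auto simp: polydisc_def upd_nth)
    have "cmod ((\<Sum>k<N. F (upd b i (of_real s * ?u k)) * ?l k z) - F (upd b i (of_real s * z $ i)))
        \<le> 2 * s ^ N / (1 - s)"
      by (rule unity_root_interpolation[OF hol])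
         (use assms N zle upd_polydisc insert.prems(3) in auto)
    moreover have "cmod (?P z - (\<Sum>k<N. F (upd b i (of_real s * ?u k)) * ?l k z)) \<le> \<delta> / 2"
    proof -
      have l: "cmod (?l k z) \<le> 1" for k
      proof -
        have "cmod (\<Sum>j<N. (z $ i * cnj (?u k)) ^ j) \<le> (\<Sum>j<N. 1)"
          by (intro sum_norm_le) (simp add: norm_power norm_mult power_le_one zle)
        then show ?thesis using N by (simp add: norm_divide)
      qed
      have "?P z - (\<Sum>k<N. F (upd b i (of_real s * ?u k)) * ?l k z)
          = (\<Sum>k<N. (p k z - F (upd b i (of_real s * ?u k))) * ?l k z)"
        by (simp only: sum_subtractf left_diff_distrib)
      also have "cmod \<dots> \<le> (\<Sum>k<N. \<delta> / (2 * N))"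
      proof (rule sum_norm_le)
        fix k
        have "cmod (p k z - F (upd b i (of_real s * ?u k))) * cmod (?l k z) \<le> \<delta> / (2 * N) * 1"
          using p(2)[OF z, of k] l[of k] insert.prems(1) unfolding node by (intro mult_mono) auto
        then show "cmod ((p k z - F (upd b i (of_real s * ?u k))) * ?l k z) \<le> \<delta> / (2 * N)"
          by (simp only: norm_mult)
      qed
      also have "\<dots> = \<delta> / 2" using N by simp
      finally show ?thesis .
    qed
    ultimately show ?thesis unfolding goal
      using N(2) norm_triangle_ineq[of "?P z - (\<Sum>k<N. F (upd b i (of_real s * ?u k)) * ?l k z)"
         "(\<Sum>k<N. F (upd b i (of_real s * ?u k)) * ?l k z) - F (upd b i (of_real s * z $ i))"] by simp
  qed
  ultimately show ?case by blast
qed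

lemma polynomial_approximation:
  fixes F :: "complex^'n \<Rightarrow> complex"
  assumes "separately_holomorphic F" "\<And>z. z \<in> polydisc \<Longrightarrow> cmod (F z) \<le> 1"
    and "0 < s" "s < 1" "0 < \<delta>"
  obtains p where "polynomial_sev p"
    "\<And>z. z \<in> closed_polydisc \<Longrightarrow> cmod (p z - F (\<chi> i. of_real s * z $ i)) < \<delta>"
  using polynomial_approximation_aux[of UNIV s \<delta> F 0] assms
  by (auto simp: polydisc_def)

subsection \<open>Invariants of the reflection group\<close>

definition theta_polynomial :: "('n \<Rightarrow> nat) \<Rightarrow> nat \<Rightarrow> nat \<Rightarrow> (complex^'n \<Rightarrow> complex) \<Rightarrow> bool" where
  "theta_polynomial ix m t u \<longleftrightarrow> (\<exists>P. polynomial_sev P \<and> u = (\<lambda>z. P (theta ix m t z)))"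

lemma theta_polynomial_const: "theta_polynomial ix m t (\<lambda>_. c)"
  unfolding theta_polynomial_def by (rule exI[of _ "\<lambda>_. c"]) (auto intro: polynomial_sev_const)

lemma theta_polynomial_theta: "theta_polynomial ix m t (\<lambda>z. theta ix m t z $ i)"
  unfolding theta_polynomial_def by (rule exI[of _ "\<lambda>q. q $ i"]) (auto intro: polynomial_sev_coord)

lemma theta_polynomial_add:
  assumes "theta_polynomial ix m t u" "theta_polynomial ix m t v"
  shows "theta_polynomial ix m t (\<lambda>z. u z + v z)"
proof -
  obtain P Q where "polynomial_sev P" "u = (\<lambda>z. P (theta ix m t z))"
    "polynomial_sev Q" "v = (\<lambda>z. Q (theta ix m t z))"
    using assms unfolding theta_polynomial_def by blast
  then show ?thesis unfolding theta_polynomial_def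
    by (intro exI[of _ "\<lambda>q. P q + Q q"]) (auto intro: polynomial_sev_add)
qed

lemma theta_polynomial_mult:
  assumes "theta_polynomial ix m t u" "theta_polynomial ix m t v"
  shows "theta_polynomial ix m t (\<lambda>z. u z * v z)"
proof -
  obtain P Q where "polynomial_sev P" "u = (\<lambda>z. P (theta ix m t z))"
    "polynomial_sev Q" "v = (\<lambda>z. Q (theta ix m t z))"
    using assms unfolding theta_polynomial_def by blast
  then show ?thesis unfolding theta_polynomial_def
    by (intro exI[of _ "\<lambda>q. P q * Q q"]) (auto intro: polynomial_sev_mult)
qed

lemma theta_polynomial_sum:
  "(\<And>k. k \<in> K \<Longrightarrow> theta_polynomial ix m t (u k)) \<Longrightarrow> theta_polynomial ix m t (\<lambda>z. \<Sum>k\<in>K. u k z)"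
  by (induction K rule: infinite_finite_induct)
     (auto intro: theta_polynomial_const theta_polynomial_add)

lemma theta_polynomial_power: "theta_polynomial ix m t u \<Longrightarrow> theta_polynomial ix m t (\<lambda>z. u z ^ n)"
  by (induction n) (auto intro: theta_polynomial_const theta_polynomial_mult)

lemma theta_polynomial_cmult: "theta_polynomial ix m t u \<Longrightarrow> theta_polynomial ix m t (\<lambda>z. c * u z)"
  by (intro theta_polynomial_mult theta_polynomial_const)

lemma theta_polynomial_diff:
  "theta_polynomial ix m t u \<Longrightarrow> theta_polynomial ix m t v \<Longrightarrow> theta_polynomial ix m t (\<lambda>z. u z - v z)"
  using theta_polynomial_add[OF _ theta_polynomial_cmult[of ix m t v "-1"], of u] by simp

lemma theta_polynomial_cdivide: "theta_polynomial ix m t u \<Longrightarrow> theta_polynomial ix m t (\<lambda>z. u z / c)"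
  using theta_polynomial_cmult[of ix m t u "inverse c"] by (simp add: divide_inverse mult.commute)

lemma theta_index_top:
  fixes ix :: "'n::finite \<Rightarrow> nat"
  assumes "bij_betw ix UNIV {1..CARD('n)}"
  obtains i where "ix i = CARD('n)"
proof -
  have "CARD('n) \<in> ix ` UNIV" using assms by (simp add: bij_betw_def Suc_leI)
  then show ?thesis using that by auto
qed

text \<open>\<open>theta\<close> lists the elementary symmetric polynomials of the m-th powers in
  degrees 1 to d - 1. The one of degree d is the full product to the power m, which is the t-th
  power of the last coordinate of \<open>theta\<close>.\<close>

lemma theta_polynomial_elem_sym:
  fixes ix :: "'n::finite \<Rightarrow> nat"
  assumes ix: "bij_betw ix UNIV {1..CARD('n)}" and t: "t dvd m"
  shows "theta_polynomial ix m t (\<lambda>z. elem_sym j (\<chi> k. z $ k ^ m))"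
proof -
  consider "j = 0" | "1 \<le> j" "j < CARD('n)" | "j = CARD('n)" | "j > CARD('n)" by linarith
  then show ?thesis
  proof cases
    case 1
    have "{S :: 'n set. S \<subseteq> UNIV \<and> card S = 0} = {{}}" by auto
    then have "elem_sym j (\<chi> k. z $ k ^ m) = 1" for z :: "complex^'n" by (simp add: elem_sym_def 1)
    then show ?thesis by (simp add: theta_polynomial_const)
  next
    case 2
    then have "j \<in> ix ` UNIV" using ix by (simp add: bij_betw_def)
    then obtain i where "ix i = j" by auto
    then have "(\<lambda>z. elem_sym j (\<chi> k. z $ k ^ m)) = (\<lambda>z. theta ix m t z $ i)"
      using 2 by (simp add: theta_def)
    then show ?thesis by (simp only: theta_polynomial_theta)
  next
    case 3
    obtain i where i: "ix i = CARD('n)" using theta_index_top[OF ix] .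
    have "{S :: 'n set. S \<subseteq> UNIV \<and> card S = CARD('n)} = {UNIV}"
      by (auto dest: card_eq_UNIV_imp_eq_UNIV[OF finite])
    then have "elem_sym j (\<chi> k. z $ k ^ m) = (theta ix m t z $ i) ^ t" for z :: "complex^'n"
      using t by (simp add: elem_sym_def 3 theta_def i prod_power_distrib flip: power_mult)
    then show ?thesis by (simp add: theta_polynomial_power theta_polynomial_theta)
  next
    case 4
    then have e: "{S :: 'n set. S \<subseteq> UNIV \<and> card S = j} = {}"
      using card_mono[OF finite subset_UNIV] by (auto simp: not_le[symmetric])
    have "elem_sym j (\<chi> k. z $ k ^ m) = 0" for z :: "complex^'n" unfolding elem_sym_def e by simp
    then show ?thesis by (simp add: theta_polynomial_const)
  qed
qed

section \<open>Symmetric polynomials: power sums and symmetrized monomials\<close>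

text \<open>This family joins the power sums (\<open>j = 0\<close>) to multiples of the elementary
  symmetric polynomials (\<open>b = 0\<close>). Lowering \<open>b\<close> by one raises
  \<open>j\<close> by one, so Newton's identities become an induction on \<open>b\<close> for all
  \<open>j\<close> at once.\<close>

definition pointed_sym :: "nat \<Rightarrow> nat \<Rightarrow> complex^'n \<Rightarrow> complex" where
  "pointed_sym j b y = (\<Sum>S | card S = j. \<Sum>i\<in>-S. (\<Prod>k\<in>S. y $ k) * y $ i ^ b)"

lemma pointed_sym_0: "pointed_sym 0 b y = (\<Sum>i\<in>UNIV. y $ i ^ b)"
proof -
  have "{S :: 'a set. card S = 0} = {{}}" by auto
  then show ?thesis by (simp add: pointed_sym_def)
qed

text \<open>The single step of Newton's identities.\<close>
lemma sum_pointed_sets_Suc: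
  fixes h :: "'n::finite set \<Rightarrow> 'n \<Rightarrow> 'b::comm_monoid_add"
  shows "(\<Sum>S | card S = j. \<Sum>i\<in>-S. h (insert i S) i) = (\<Sum>S | card S = Suc j. \<Sum>i\<in>S. h S i)"
proof -
  have "(\<Sum>S | card S = j. \<Sum>i\<in>-S. h (insert i S) i)
      = (\<Sum>(S, i)\<in>(SIGMA S:{S. card S = j}. -S). h (insert i S) i)"
    by (intro sum.Sigma) auto
  also have "\<dots> = (\<Sum>(S, i)\<in>(SIGMA S:{S. card S = Suc j}. S). h S i)"
    by (rule sum.reindex_bij_witness[where i = "\<lambda>(S, i). (S - {i}, i)" and j = "\<lambda>(S, i). (insert i S, i)"])
       auto
  also have "\<dots> = (\<Sum>S | card S = Suc j. \<Sum>i\<in>S. h S i)"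
    by (intro sum.Sigma[symmetric]) auto
  finally show ?thesis .
qed

text \<open>Split the product of the elementary symmetric polynomial and the power sum by whether
  the index i of the power lies in the set S. If it does, moving the factor at i from S into the
  power raises the exponent to \<open>Suc b\<close>; if not, the term belongs to
  \<open>pointed_sym (Suc j) b y\<close>.\<close>

lemma pointed_sym_Suc:
  fixes y :: "complex^'n"
  shows "pointed_sym j (Suc b) y
    = elem_sym (Suc j) y * (\<Sum>i\<in>UNIV. y $ i ^ b) - pointed_sym (Suc j) b y"
proof -
  have "pointed_sym j (Suc b) y = (\<Sum>S | card S = j. \<Sum>i\<in>-S. (\<Prod>k\<in>insert i S. y $ k) * y $ i ^ b)"
    unfolding pointed_sym_def by (intro sum.cong refl) (auto simp: mult_ac)
  also have "\<dots> = (\<Sum>S | card S = Suc j. \<Sum>i\<in>S. (\<Prod>k\<in>S. y $ k) * y $ i ^ b)"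
    by (rule sum_pointed_sets_Suc)
  also have "\<dots> = (\<Sum>S | card S = Suc j. (\<Sum>i\<in>UNIV. (\<Prod>k\<in>S. y $ k) * y $ i ^ b)
      - (\<Sum>i\<in>-S. (\<Prod>k\<in>S. y $ k) * y $ i ^ b))"
  proof (intro sum.cong refl)
    fix S :: "'n set"
    show "(\<Sum>i\<in>S. (\<Prod>k\<in>S. y $ k) * y $ i ^ b) = (\<Sum>i\<in>UNIV. (\<Prod>k\<in>S. y $ k) * y $ i ^ b)
      - (\<Sum>i\<in>-S. (\<Prod>k\<in>S. y $ k) * y $ i ^ b)"
      using sum.subset_diff[of S UNIV "\<lambda>i. (\<Prod>k\<in>S. y $ k) * y $ i ^ b"]
      by (simp add: Compl_eq_Diff_UNIV)
  qed
  also have "\<dots> = elem_sym (Suc j) y * (\<Sum>i\<in>UNIV. y $ i ^ b) - pointed_sym (Suc j) b y"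
    by (simp add: sum_subtractf pointed_sym_def elem_sym_def sum_product)
  finally show ?thesis .
qed

lemma pointed_sym_zero:
  "pointed_sym j 0 (y :: complex^'n) = (of_nat CARD('n) - of_nat j) * elem_sym j y"
proof -
  have "pointed_sym j 0 y = (\<Sum>S | card S = j. (of_nat CARD('n) - of_nat j) * (\<Prod>k\<in>S. y $ k))"
    unfolding pointed_sym_def
    by (intro sum.cong refl) (auto simp: Compl_eq_Diff_UNIV card_Diff_subset of_nat_diff card_mono)
  then show ?thesis by (simp add: elem_sym_def sum_distrib_left)
qed

lemma theta_polynomial_pointed_sym:
  fixes ix :: "'n::finite \<Rightarrow> nat"
  assumes "bij_betw ix UNIV {1..CARD('n)}" "t dvd m"
  shows "theta_polynomial ix m t (\<lambda>z. pointed_sym j b (\<chi> k. z $ k ^ m))"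
proof (induction b arbitrary: j)
  case 0
  show ?case unfolding pointed_sym_zero
    by (intro theta_polynomial_cmult theta_polynomial_elem_sym assms)
next
  case (Suc b)
  show ?case unfolding pointed_sym_Suc pointed_sym_0[symmetric]
    by (intro theta_polynomial_diff theta_polynomial_mult theta_polynomial_elem_sym assms Suc)
qed

text \<open>Partial index sets \<open>I\<close> make an induction possible, and extensional
  functions count each injection once. For \<open>I = UNIV\<close> the injections are the
  permutations, and the sum is a monomial symmetrized over them.\<close>

definition injective_sum :: "'n set \<Rightarrow> ('n \<Rightarrow> nat) \<Rightarrow> complex^'n \<Rightarrow> complex" where
  "injective_sum I b y = (\<Sum>s\<in>{s \<in> I \<rightarrow>\<^sub>E UNIV. inj_on s I}. \<Prod>i\<in>I. y $ s i ^ b i)"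

text \<open>An injection on \<open>I\<close> extends to \<open>i\<close> by any value outside its
  image. The sum over all values gives the power sum; an excluded value \<open>s j\<close> would add
  the exponent of \<open>i\<close> to that of \<open>j\<close>. Iterating this expresses symmetrized
  monomials through power sums.\<close>

lemma injective_sum_insert:
  fixes y :: "complex^'n"
  assumes i: "i \<notin> I"
  shows "injective_sum (insert i I) b y = (\<Sum>k\<in>UNIV. y $ k ^ b i) * injective_sum I b y
     - (\<Sum>j\<in>I. injective_sum I (b(j := b j + b i)) y)"
proof -
  let ?A = "\<lambda>I. {s \<in> I \<rightarrow>\<^sub>E (UNIV :: 'n set). inj_on s I}"
  have fin: "finite (?A I)" by (simp add: finite_PiE)
  have "injective_sum (insert i I) b y
      = (\<Sum>(s, l)\<in>(SIGMA s:?A I. - s ` I). y $ l ^ b i * (\<Prod>k\<in>I. y $ s k ^ b k))"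
    unfolding injective_sum_def
  proof (rule sum.reindex_bij_witness[where i = "\<lambda>(s, l). s(i := l)" and j = "\<lambda>s. (restrict s I, s i)"])
    fix s assume s: "s \<in> ?A (insert i I)"
    show "(case (restrict s I, s i) of (s, l) \<Rightarrow> s(i := l)) = s"
      using s i by (auto simp: fun_eq_iff restrict_def PiE_def extensional_def)
    show "(restrict s I, s i) \<in> (SIGMA s:?A I. - s ` I)"
      using s i by (auto simp: inj_on_def)
    have "(\<Prod>k\<in>insert i I. y $ s k ^ b k) = y $ s i ^ b i * (\<Prod>k\<in>I. y $ restrict s I k ^ b k)"
      using i by simp
    then show "(case (restrict s I, s i) of (s, l) \<Rightarrow> y $ l ^ b i * (\<Prod>k\<in>I. y $ s k ^ b k))
        = (\<Prod>k\<in>insert i I. y $ s k ^ b k)" by simp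
  next
    fix p assume p: "p \<in> (SIGMA s:?A I. - s ` I)"
    obtain s l where sl: "p = (s, l)" by fastforce
    have s: "s \<in> I \<rightarrow>\<^sub>E UNIV" "inj_on s I" "l \<notin> s ` I" using p by (auto simp: sl)
    have "restrict (s(i := l)) I = s"
      using s(1) i by (auto simp: fun_eq_iff restrict_def PiE_def extensional_def)
    then show "(restrict (case p of (s, l) \<Rightarrow> s(i := l)) I, (case p of (s, l) \<Rightarrow> s(i := l)) i) = p"
      by (simp add: sl)
    have "inj_on (s(i := l)) (insert i I)"
      using s i by (auto simp: inj_on_def image_iff)
    then show "(case p of (s, l) \<Rightarrow> s(i := l)) \<in> ?A (insert i I)"
      using s(1) by (auto simp: sl PiE_def extensional_def)
  qed
  also have "\<dots> = (\<Sum>s\<in>?A I. \<Sum>l\<in>- s ` I. y $ l ^ b i * (\<Prod>k\<in>I. y $ s k ^ b k))"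
    by (intro sum.Sigma[symmetric] fin) auto
  also have "\<dots> = (\<Sum>s\<in>?A I. (\<Sum>k\<in>UNIV. y $ k ^ b i) * (\<Prod>k\<in>I. y $ s k ^ b k)
      - (\<Sum>j\<in>I. \<Prod>k\<in>I. y $ s k ^ (b(j := b j + b i)) k))"
  proof (intro sum.cong refl)
    fix s assume s: "s \<in> ?A I"
    have "(\<Sum>l\<in>- s ` I. y $ l ^ b i) = (\<Sum>k\<in>UNIV. y $ k ^ b i) - (\<Sum>l\<in>s ` I. y $ l ^ b i)"
      using sum.subset_diff[of "s ` I" UNIV "\<lambda>l. y $ l ^ b i"] by (simp add: Compl_eq_Diff_UNIV)
    also have "(\<Sum>l\<in>s ` I. y $ l ^ b i) = (\<Sum>j\<in>I. y $ s j ^ b i)"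
      using s by (simp add: sum.reindex)
    finally have *: "(\<Sum>l\<in>- s ` I. y $ l ^ b i) = (\<Sum>k\<in>UNIV. y $ k ^ b i) - (\<Sum>j\<in>I. y $ s j ^ b i)" .
    have **: "(\<Prod>k\<in>I. y $ s k ^ (b(j := b j + b i)) k) = y $ s j ^ b i * (\<Prod>k\<in>I. y $ s k ^ b k)"
      if "j \<in> I" for j
      using that by (simp add: prod.remove[of I j] power_add mult_ac)
    show "(\<Sum>l\<in>- s ` I. y $ l ^ b i * (\<Prod>k\<in>I. y $ s k ^ b k)) =
        (\<Sum>k\<in>UNIV. y $ k ^ b i) * (\<Prod>k\<in>I. y $ s k ^ b k)
      - (\<Sum>j\<in>I. \<Prod>k\<in>I. y $ s k ^ (b(j := b j + b i)) k)"
    proof -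
      have "(\<Sum>j\<in>I. \<Prod>k\<in>I. y $ s k ^ (b(j := b j + b i)) k)
          = (\<Sum>j\<in>I. y $ s j ^ b i) * (\<Prod>k\<in>I. y $ s k ^ b k)"
        unfolding sum_distrib_right by (intro sum.cong refl **)
      then show ?thesis
        unfolding sum_distrib_right[symmetric] * by (simp only: left_diff_distrib)
    qed
  qed
  also have "\<dots> = (\<Sum>k\<in>UNIV. y $ k ^ b i) * injective_sum I b y
     - (\<Sum>j\<in>I. injective_sum I (b(j := b j + b i)) y)"
  proof -
    have "(\<Sum>s\<in>?A I. \<Sum>j\<in>I. \<Prod>k\<in>I. y $ s k ^ (b(j := b j + b i)) k)
        = (\<Sum>j\<in>I. injective_sum I (b(j := b j + b i)) y)"
      unfolding injective_sum_def by (rule sum.swap)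
    then show ?thesis
      by (simp only: sum_subtractf sum_distrib_left[symmetric] injective_sum_def)
  qed
  finally show ?thesis .
qed

lemma theta_polynomial_injective_sum:
  fixes ix :: "'n::finite \<Rightarrow> nat"
  assumes "bij_betw ix UNIV {1..CARD('n)}" "t dvd m" "finite I"
  shows "theta_polynomial ix m t (\<lambda>z. injective_sum I b (\<chi> k. z $ k ^ m))"
  using assms(3)
proof (induction I arbitrary: b rule: finite_induct)
  case empty
  show ?case by (simp add: injective_sum_def theta_polynomial_const)
next
  case (insert i I)
  show ?case unfolding injective_sum_insert[OF insert.hyps(2)] pointed_sym_0[symmetric]
    by (intro theta_polynomial_diff theta_polynomial_mult theta_polynomial_sum
        theta_polynomial_pointed_sym assms insert.IH)
qed

section \<open>The reflection group and averages over it\<close>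

definition permute_vec :: "('n \<Rightarrow> 'n) \<Rightarrow> complex^'n \<Rightarrow> complex^'n" where
  "permute_vec \<sigma> z = (\<chi> i. z $ \<sigma> i)"

definition scale_vec :: "complex^'n \<Rightarrow> complex^'n \<Rightarrow> complex^'n" where
  "scale_vec w z = (\<chi> i. w $ i * z $ i)"

text \<open>These are the diagonal elements of G(m,t,d). If the entries are the powers of exp(2 pi i
  / m) with exponents \<nu>_k, the condition on the product says that m divides (m / t) times the
  sum of the \<nu>_k, that is, t divides this sum.\<close>

definition diagonal_group :: "nat \<Rightarrow> nat \<Rightarrow> (complex^'n) set" where
  "diagonal_group m t = {w. (\<forall>i. w $ i ^ m = 1) \<and> (\<Prod>i\<in>UNIV. w $ i) ^ (m div t) = 1}"

lemma theta_scale_vec: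
  fixes w :: "complex^'n"
  assumes "w \<in> diagonal_group m t"
  shows "theta ix m t (scale_vec w z) = theta ix m t z"
proof -
  have w: "w $ i ^ m = 1" "(\<Prod>i\<in>UNIV. w $ i) ^ (m div t) = 1" for i
    using assms by (auto simp: diagonal_group_def)
  then show ?thesis
    by (simp add: vec_eq_iff theta_def scale_vec_def power_mult_distrib prod.distrib)
qed

lemma theta_permute_vec:
  fixes z :: "complex^'n"
  assumes "bij \<sigma>"
  shows "theta ix m t (permute_vec \<sigma> z) = theta ix m t z"
proof -
  have "(\<Prod>k\<in>UNIV. z $ \<sigma> k) = (\<Prod>k\<in>UNIV. z $ k)"
    by (rule prod.reindex_bij_betw[OF assms])
  moreover have "elem_sym j (\<chi> k. z $ \<sigma> k ^ m) = elem_sym j (\<chi> k. z $ k ^ m)" for j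
  proof -
    have "elem_sym j (\<chi> k. z $ \<sigma> k ^ m) = (\<Sum>S | S \<subseteq> UNIV \<and> card S = j. \<Prod>k\<in>\<sigma> ` S. z $ k ^ m)"
      unfolding elem_sym_def
      by (intro sum.cong refl)
         (simp add: prod.reindex[OF inj_on_subset[OF bij_is_inj[OF assms] subset_UNIV]])
    also have "\<dots> = elem_sym j (\<chi> k. z $ k ^ m)"
      unfolding elem_sym_def using assms
      by (intro sum.reindex_bij_witness[where i = "\<lambda>S. inv \<sigma> ` S" and j = "\<lambda>S. \<sigma> ` S"])
         (auto simp: card_image[OF inj_on_subset[OF bij_is_inj[OF assms] subset_UNIV]]
            card_image[OF inj_on_subset[OF bij_is_inj[OF bij_imp_bij_inv[OF assms]] subset_UNIV]]
            image_image bij_is_surj surj_f_inv_f bij_is_inj)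
    finally show ?thesis .
  qed
  ultimately show ?thesis by (simp add: vec_eq_iff theta_def permute_vec_def)
qed

lemma finite_diagonal_group:
  assumes "m > 0"
  shows "finite (diagonal_group m t :: (complex^'n) set)"
proof -
  have "finite {z :: complex. z ^ m = 1}" by (rule finite_roots_unity) (use assms in simp)
  then have "finite (UNIV \<rightarrow>\<^sub>E {z :: complex. z ^ m = 1} :: ('n \<Rightarrow> complex) set)"
    by (intro finite_PiE) auto
  moreover have "(diagonal_group m t :: (complex^'n) set) \<subseteq> vec_lambda ` (UNIV \<rightarrow>\<^sub>E {z. z ^ m = 1})"
  proof
    fix w :: "complex^'n" assume "w \<in> diagonal_group m t"
    then have "vec_nth w \<in> UNIV \<rightarrow>\<^sub>E {z. z ^ m = 1}" by (auto simp: diagonal_group_def)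
    then show "w \<in> vec_lambda ` (UNIV \<rightarrow>\<^sub>E {z. z ^ m = 1})" by (metis imageI vec_lambda_eta)
  qed
  ultimately show ?thesis using finite_surj by blast
qed

text \<open>
  With \<open>\<alpha> = unity_root m 1\<close>, testing with \<open>\<alpha>\<close> and \<open>\<alpha>\<inverse>\<close> at two places shows that the exponents
  are congruent modulo \<open>m\<close>, and testing with \<open>\<alpha> ^ t\<close> at one place that they are multiples of \<open>m / t\<close>.
\<close>
lemma invariant_monomial_exponents:
  fixes a :: "'n::finite \<Rightarrow> nat"
  assumes mt: "m > 0" "t > 0" "t dvd m"
    and inv: "\<And>w :: complex^'n. w \<in> diagonal_group m t \<Longrightarrow> (\<Prod>i\<in>UNIV. w $ i ^ a i) = 1"
  obtains k b where "\<And>i. a i = (m div t) * k + m * b i"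
proof -
  let ?\<alpha> = "unity_root m"
  have root: "?\<alpha> n ^ m = 1" for n using unity_root_power_self[OF mt(1)] .
  have root_iff: "?\<alpha> n = 1 \<longleftrightarrow> m dvd n" for n
  proof
    assume "?\<alpha> n = 1"
    then have "exp (2 * of_real pi * \<i> * of_nat n / of_nat m) = 1"
      by (simp add: unity_root_def cis_conv_exp algebra_simps)
    then show "m dvd n" using mt complex_root_unity_eq_1[of m n] by simp
  next
    assume "m dvd n"
    then show "?\<alpha> n = 1" using unity_root_power_self[OF mt(1)]
      by (metis dvdE mult.commute mult.left_neutral unity_root_power mult.right_neutral power_mult power_one)
  qed
  have dvd: "(m div t) dvd a i" for i
  proof -
    define w :: "complex^'n" where "w = (\<chi> k. if k = i then ?\<alpha> t else 1)"
    have "(\<Prod>k\<in>UNIV. w $ k) = ?\<alpha> t" by (simp add: w_def)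
    then have "w \<in> diagonal_group m t"
      using root root_iff[of m] mt by (auto simp: diagonal_group_def w_def unity_root_power)
    from inv[OF this] have "(\<Prod>k\<in>UNIV. if k = i then ?\<alpha> t ^ a i else 1) = 1"
      by (simp add: w_def if_distrib if_distribR cong: if_cong prod.cong)
    then have "m dvd t * a i" by (simp add: unity_root_power root_iff)
    then show ?thesis using mt by (metis dvd_mult_div_cancel nat_mult_dvd_cancel1)
  qed
  have cong: "a i mod m = a j mod m" for i j
  proof (cases "i = j")
    case False
    define w :: "complex^'n" where
      "w = (\<chi> k. if k = i then ?\<alpha> 1 else if k = j then ?\<alpha> (m - 1) else 1)"
    have two: "(\<Prod>k\<in>UNIV. if k = i then x else if k = j then x' else 1) = x * x'" for x x' :: complex
    proof -
      have "(\<Prod>k\<in>UNIV. if k = i then x else if k = j then x' else 1)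
          = (\<Prod>k\<in>UNIV. (if k = i then x else 1) * (if k = j then x' else 1))"
        using False by (intro prod.cong) auto
      also have "\<dots> = x * x'" by (simp only: prod.distrib) simp
      finally show ?thesis .
    qed
    have mult: "?\<alpha> p * ?\<alpha> q = ?\<alpha> (p + q)" for p q
      by (simp add: unity_root_def cis_mult ring_distribs add_divide_distrib)
    have w: "w \<in> diagonal_group m t"
      using root root_iff[of m] mt by (auto simp: diagonal_group_def w_def two mult)
    have "w $ k ^ a k = (if k = i then ?\<alpha> 1 ^ a i else if k = j then ?\<alpha> (m - 1) ^ a j else 1)" for k
      by (simp add: w_def)
    then have "(\<Prod>k\<in>UNIV. if k = i then ?\<alpha> 1 ^ a i else if k = j then ?\<alpha> (m - 1) ^ a j else 1) = 1"
      using inv[OF w] by (simp only:)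
    then have "m dvd a i + (m - 1) * a j"
      by (simp add: two unity_root_power mult root_iff)
    then have "(a i + (m - 1) * a j + a j) mod m = a j mod m"
      using mod_add_left_eq[of "a i + (m - 1) * a j" m "a j"] by (simp add: dvd_eq_mod_eq_0)
    moreover have "a i + (m - 1) * a j + a j = a i + m * a j"
      using mt(1) by (cases m) auto
    ultimately show ?thesis by (metis mod_mult_self2)
  qed simp
  \<comment> \<open>Splitting off the smallest exponent keeps all the \<open>b i\<close> natural:
    the other exponents exceed it by multiples of \<open>m\<close>.\<close>
  define a0 where "a0 = Min (range a)"
  have "a0 \<in> range a" unfolding a0_def by (rule Min_in) auto
  then obtain i0 where i0: "a i0 = a0" by auto
  have le: "a0 \<le> a i" for i by (simp add: a0_def)
  have "\<exists>b. a i = a0 + m * b" for i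
  proof -
    have "m dvd a i - a0" using mod_eq_dvd_iff_nat[OF le] cong[of i i0] i0 by blast
    then obtain q where "a i - a0 = m * q" ..
    then show ?thesis using le[of i] by (intro exI[of _ q]) simp
  qed
  then obtain b where b: "\<And>i. a i = a0 + m * b i" by metis
  obtain k where "a0 = (m div t) * k" using dvd[of i0] i0 by (auto elim: dvdE)
  then show ?thesis using that b by metis
qed

text \<open>The monomial is multiplicative, and permutations preserve the diagonal group. So the
  average is the symmetrized monomial times the sum \<open>C\<close> of the character that sends w
  to the product of the \<open>w $ i ^ a i\<close>. If the character is nontrivial, \<open>C\<close>
  vanishes. If it is trivial, the exponents have the form \<open>(m div t) * k + m * b i\<close>,
  and what remains is a power of the last coordinate of \<open>theta\<close> times a symmetrized
  monomial in the m-th powers.\<close>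

lemma theta_polynomial_average_monomial:
  fixes ix :: "'n::finite \<Rightarrow> nat" and a :: "'n \<Rightarrow> nat"
  assumes ix: "bij_betw ix UNIV {1..CARD('n)}" and mt: "m > 0" "t > 0" "t dvd m"
  shows "theta_polynomial ix m t (\<lambda>z. \<Sum>\<sigma> | bij \<sigma>. \<Sum>w\<in>diagonal_group m t.
           \<Prod>i\<in>UNIV. permute_vec \<sigma> (scale_vec w z) $ i ^ a i)"
    (is "theta_polynomial _ _ _ ?u")
proof -
  let ?H = "diagonal_group m t :: (complex^'n) set"
  have perm: "?u z = (\<Sum>\<sigma> | bij \<sigma>. (\<Sum>w\<in>?H. \<Prod>i\<in>UNIV. permute_vec \<sigma> w $ i ^ a i)
      * (\<Prod>i\<in>UNIV. permute_vec \<sigma> z $ i ^ a i))" for z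
    by (simp add: permute_vec_def scale_vec_def power_mult_distrib prod.distrib sum_distrib_right)
  have perm_sum: "(\<Sum>w\<in>?H. \<Prod>i\<in>UNIV. permute_vec \<sigma> w $ i ^ a i) = (\<Sum>w\<in>?H. \<Prod>i\<in>UNIV. w $ i ^ a i)"
    if \<sigma>: "bij \<sigma>" for \<sigma>
  proof (rule sum.reindex_bij_witness[where i = "permute_vec (inv \<sigma>)" and j = "permute_vec \<sigma>"])
    fix w assume w: "w \<in> ?H"
    show "permute_vec (inv \<sigma>) (permute_vec \<sigma> w) = w" "permute_vec \<sigma> (permute_vec (inv \<sigma>) w) = w"
      using \<sigma> by (simp_all add: permute_vec_def vec_eq_iff bij_is_surj surj_f_inv_f bij_is_inj)
    show "permute_vec \<sigma> w \<in> ?H" "permute_vec (inv \<sigma>) w \<in> ?H"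
      using w prod.reindex_bij_betw[OF \<sigma>, of "vec_nth w"]
        prod.reindex_bij_betw[OF bij_imp_bij_inv[OF \<sigma>], of "vec_nth w"]
      by (simp_all add: diagonal_group_def permute_vec_def)
  qed simp
  define C where "C = (\<Sum>w\<in>?H. \<Prod>i\<in>UNIV. w $ i ^ a i)"
  have u: "?u z = C * (\<Sum>\<sigma> | bij \<sigma>. \<Prod>i\<in>UNIV. permute_vec \<sigma> z $ i ^ a i)" for z
    unfolding perm sum_distrib_left by (intro sum.cong) (auto simp: perm_sum C_def)
  show ?thesis
  proof (cases "\<forall>v\<in>?H. (\<Prod>i\<in>UNIV. v $ i ^ a i) = 1")
    case False
    then obtain v where v: "v \<in> ?H" "(\<Prod>i\<in>UNIV. v $ i ^ a i) \<noteq> 1" by blast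
    have v0: "v $ i \<noteq> 0" for i
    proof
      assume "v $ i = 0"
      moreover have "v $ i ^ m = 1" using v(1) by (simp add: diagonal_group_def)
      ultimately show False using mt(1) by (simp add: power_0_left)
    qed
    have cancel: "v $ i * (inverse (v $ i) * x) = x" "inverse (v $ i) * (v $ i * x) = x" for i x
      using v0[of i] by simp_all
    \<comment> \<open>Translating the group by \<open>v\<close> multiplies \<open>C\<close> by the
      value of the character at \<open>v\<close>. As this value is not 1, \<open>C\<close> is
      zero.\<close>
    have "C = (\<Sum>w\<in>?H. \<Prod>i\<in>UNIV. scale_vec v w $ i ^ a i)"
      unfolding C_def
    proof (rule sum.reindex_bij_witness[where j = "scale_vec (\<chi> i. inverse (v $ i))" and i = "scale_vec v"])
      fix w assume w: "w \<in> ?H"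
      show "scale_vec v w \<in> ?H" "scale_vec (\<chi> i. inverse (v $ i)) w \<in> ?H"
        using w v(1)
        by (auto simp: diagonal_group_def scale_vec_def power_mult_distrib prod.distrib power_inverse
            prod_inversef[unfolded o_def])
    qed (auto simp: scale_vec_def vec_eq_iff cancel)
    also have "\<dots> = (\<Prod>i\<in>UNIV. v $ i ^ a i) * C"
      by (simp add: C_def scale_vec_def power_mult_distrib prod.distrib sum_distrib_left)
    finally have "C = 0" using v(2) by simp
    then show ?thesis by (simp add: u theta_polynomial_const)
  next
    case True
    then obtain k b where a: "\<And>i. a i = (m div t) * k + m * b i"
      using invariant_monomial_exponents[OF mt, of a] by blast
    obtain i0 where i0: "ix i0 = CARD('n)" using theta_index_top[OF ix] .
    have "inj \<sigma> \<longleftrightarrow> bij \<sigma>" for \<sigma> :: "'n \<Rightarrow> 'n"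
      using endo_inj_surj[of UNIV \<sigma>] by (auto simp: bij_def)
    then have "{s \<in> UNIV \<rightarrow>\<^sub>E (UNIV :: 'n set). inj_on s (UNIV :: 'n set)} = {\<sigma>. bij \<sigma>}"
      by auto
    then have inj: "injective_sum UNIV b y = (\<Sum>\<sigma> | bij \<sigma>. \<Prod>i\<in>UNIV. y $ \<sigma> i ^ b i)" for y
      by (simp add: injective_sum_def)
    have "(\<Prod>i\<in>UNIV. permute_vec \<sigma> z $ i ^ a i)
        = (theta ix m t z $ i0) ^ k * (\<Prod>i\<in>UNIV. (\<chi> k. z $ k ^ m) $ \<sigma> i ^ b i)" if "bij \<sigma>" for \<sigma> z
      using prod.reindex_bij_betw[OF that, of "vec_nth z"]
      by (simp add: a permute_vec_def theta_def i0 power_add power_mult prod.distrib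
          flip: prod_power_distrib)
    then have "?u z = C * (theta ix m t z $ i0 ^ k * injective_sum UNIV b (\<chi> k. z $ k ^ m))" for z
      unfolding u inj sum_distrib_left by simp
    then show ?thesis
      by (simp only:) (intro theta_polynomial_cmult theta_polynomial_mult theta_polynomial_power
          theta_polynomial_theta theta_polynomial_injective_sum ix mt finite)
  qed
qed

lemma theta_polynomial_average:
  fixes ix :: "'n::finite \<Rightarrow> nat"
  assumes ix: "bij_betw ix UNIV {1..CARD('n)}" and mt: "m > 0" "t > 0" "t dvd m"
    and p: "polynomial_sev p"
  shows "theta_polynomial ix m t (\<lambda>z. \<Sum>\<sigma> | bij \<sigma>. \<Sum>w\<in>diagonal_group m t.
           p (permute_vec \<sigma> (scale_vec w z)))"
proof -
  obtain A c where A: "p = (\<lambda>z. \<Sum>a\<in>A. c a * (\<Prod>i\<in>UNIV. z $ i ^ a i))"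
    using p unfolding polynomial_sev_def by auto
  have "(\<Sum>\<sigma> | bij \<sigma>. \<Sum>w\<in>diagonal_group m t. p (permute_vec \<sigma> (scale_vec w z)))
     = (\<Sum>a\<in>A. c a * (\<Sum>\<sigma> | bij \<sigma>. \<Sum>w\<in>diagonal_group m t.
           \<Prod>i\<in>UNIV. permute_vec \<sigma> (scale_vec w z) $ i ^ a i))" for z
    unfolding A sum_distrib_left
    by (subst (2) sum.swap, subst sum.swap, intro sum.cong refl sum.swap)
  then show ?thesis
    by (simp only:) (intro theta_polynomial_sum theta_polynomial_cmult theta_polynomial_average_monomial ix mt)
qed

subsection \<open>Rational inner functions\<close>

text \<open>Conjugation inverts unimodular entries. Hence the full product times the conjugate of
  the product over S is the product over the complement of S, and complementation exchanges j-sets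
  with (d - j)-sets.\<close>

lemma elem_sym_cnj:
  fixes y :: "complex^'n"
  assumes y: "\<And>k. cmod (y $ k) = 1" and j: "j \<le> CARD('n)"
  shows "(\<Prod>k\<in>UNIV. y $ k) * cnj (elem_sym j y) = elem_sym (CARD('n) - j) y"
proof -
  have yc: "y $ k * cnj (y $ k) = 1" for k
    using y[of k] by (simp add: complex_norm_square[symmetric])
  have "(\<Prod>k\<in>UNIV. y $ k) * cnj (\<Prod>k\<in>S. y $ k) = (\<Prod>k\<in>-S. y $ k)" for S
  proof -
    have "(\<Prod>k\<in>UNIV. y $ k) = (\<Prod>k\<in>-S. y $ k) * (\<Prod>k\<in>S. y $ k)"
      using prod.subset_diff[of S UNIV "\<lambda>k. y $ k"] by (simp add: Compl_eq_Diff_UNIV)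
    moreover have "(\<Prod>k\<in>S. y $ k) * cnj (\<Prod>k\<in>S. y $ k) = 1"
      by (simp add: yc flip: prod.distrib)
    ultimately show ?thesis by (simp add: mult.assoc)
  qed
  then have "(\<Prod>k\<in>UNIV. y $ k) * cnj (elem_sym j y) = (\<Sum>S | S \<subseteq> UNIV \<and> card S = j. \<Prod>k\<in>-S. y $ k)"
    by (simp only: elem_sym_def cnj_sum sum_distrib_left)
  also have "\<dots> = elem_sym (CARD('n) - j) y"
    unfolding elem_sym_def
    by (rule sum.reindex_bij_witness[where i = "\<lambda>S. -S" and j = "\<lambda>S. -S"])
       (use j in \<open>auto simp: Compl_eq_Diff_UNIV card_Diff_subset card_mono\<close>)
  finally show ?thesis .
qed

lemma norm_theta_top:
  fixes z :: "complex^'n"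
  assumes "ix i = CARD('n)" "z \<in> torus"
  shows "cmod (theta ix m t z $ i) = 1"
  using assms by (simp add: theta_def torus_def norm_power flip: prod_norm)

lemma theta_reflected_polynomial:
  fixes ix :: "'n::finite \<Rightarrow> nat"
  assumes ix: "bij_betw ix UNIV {1..CARD('n)}" and t: "t dvd m" and d: "ix d = CARD('n)"
    and P: "polynomial_sev P"
  shows "\<exists>K Q. polynomial_sev Q \<and>
    (\<forall>z\<in>torus. Q (theta ix m t z) = (theta ix m t z $ d) ^ K * cnj (P (theta ix m t z)))"
  using P
proof (induction rule: polynomial_sev_induct)
  case (const c)
  show ?case
    by (rule exI[of _ 0], rule exI[of _ "\<lambda>_. cnj c"]) (auto intro: polynomial_sev_const)
next
  case (coord i)
  show ?case
  proof (cases "ix i = CARD('n)")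
    case True
    then have "theta ix m t z $ i = theta ix m t z $ d" for z using d by (simp add: theta_def)
    moreover have "theta ix m t z $ d * cnj (theta ix m t z $ d) = 1" if "z \<in> torus" for z
      using norm_theta_top[of ix d, OF d that] by (simp add: complex_norm_square[symmetric])
    ultimately show ?thesis
      by (intro exI[of _ 1] exI[of _ "\<lambda>_. 1"]) (auto intro: polynomial_sev_const)
  next
    case False
    have "ix i \<in> {1..CARD('n)}" using ix by (auto simp: bij_betw_def)
    then have j: "1 \<le> ix i" "ix i < CARD('n)" using False by auto
    then have "CARD('n) - ix i \<in> ix ` UNIV" using ix by (auto simp: bij_betw_def)
    then obtain i' where i': "ix i' = CARD('n) - ix i" by auto
    have "theta ix m t z $ i' = (theta ix m t z $ d) ^ t * cnj (theta ix m t z $ i)"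
      if z: "z \<in> torus" for z
    proof -
      have "(theta ix m t z $ d) ^ t = (\<Prod>k\<in>UNIV. (\<chi> k. z $ k ^ m) $ k)"
        using t by (simp add: theta_def d prod_power_distrib flip: power_mult)
      then show ?thesis
        using elem_sym_cnj[of "\<chi> k. z $ k ^ m" "ix i"] z i' j
        by (simp add: theta_def torus_def norm_power)
    qed
    then show ?thesis
      by (intro exI[of _ t] exI[of _ "\<lambda>q. q $ i'"]) (auto intro: polynomial_sev_coord)
  qed
next
  case (add P1 P2)
  then obtain K1 Q1 K2 Q2 where "polynomial_sev Q1" "polynomial_sev Q2"
    "\<forall>z\<in>torus. Q1 (theta ix m t z) = (theta ix m t z $ d) ^ K1 * cnj (P1 (theta ix m t z))"
    "\<forall>z\<in>torus. Q2 (theta ix m t z) = (theta ix m t z $ d) ^ K2 * cnj (P2 (theta ix m t z))" by blast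
  \<comment> \<open>The two summands may need different powers of the last coordinate. Multiplying
    each by the power that belongs to the other gives the common exponent
    \<open>K1 + K2\<close>.\<close>
  then show ?case
    by (intro exI[of _ "K1 + K2"] exI[of _ "\<lambda>q. (q $ d) ^ K2 * Q1 q + (q $ d) ^ K1 * Q2 q"])
       (auto intro!: polynomial_sev_intros simp: power_add algebra_simps)
next
  case (mult P1 P2)
  then obtain K1 Q1 K2 Q2 where "polynomial_sev Q1" "polynomial_sev Q2"
    "\<forall>z\<in>torus. Q1 (theta ix m t z) = (theta ix m t z $ d) ^ K1 * cnj (P1 (theta ix m t z))"
    "\<forall>z\<in>torus. Q2 (theta ix m t z) = (theta ix m t z $ d) ^ K2 * cnj (P2 (theta ix m t z))" by blast
  then show ?case
    by (intro exI[of _ "K1 + K2"] exI[of _ "\<lambda>q. Q1 q * Q2 q"])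
       (auto intro!: polynomial_sev_intros simp: power_add algebra_simps)
qed

lemma polynomial_sev_theta: "polynomial_sev (\<lambda>z. theta ix m t z $ i)"
  by (cases "ix i = CARD('a)")
     (auto simp: theta_def elem_sym_def intro!: polynomial_sev_intros)

lemma closure_theta_domain_subset:
  "closure (theta_domain ix m t) \<subseteq> theta ix m t ` closed_polydisc"
  by (intro closure_minimal image_mono polydisc_subset_closed compact_imp_closed
      compact_continuous_image continuous_on_theta compact_closed_polydisc)

lemma scaled_in_polydisc:
  assumes "z \<in> closed_polydisc" "cmod w < 1"
  shows "(\<chi> i. w * z $ i) \<in> polydisc"
proof -
  have "cmod w * cmod (z $ i) < 1" for i
    using assms mult_left_le[of "cmod (z $ i)" "cmod w"] by (force simp: closed_polydisc_def)
  then show ?thesis by (simp add: polydisc_def norm_mult)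
qed

lemma boundary_fun_continuous:
  assumes h: "continuous_on (theta ix m t ` closed_polydisc) h" and t: "t dvd m" and z: "z \<in> torus"
  shows "boundary_fun ix m t h (theta ix m t z) = h (theta ix m t z)"
proof -
  have hc: "continuous_on closed_polydisc (\<lambda>z. h (theta ix m t z))"
    by (rule continuous_on_compose2[OF h continuous_on_theta]) auto
  have "((\<lambda>r. \<chi> i. complex_of_real r * z $ i) \<longlongrightarrow> (\<chi> i. complex_of_real 1 * z $ i)) (at_left 1)"
    by (intro tendsto_intros tendsto_vec_lambda)
  then have lim: "((\<lambda>r. \<chi> i. complex_of_real r * z $ i) \<longlongrightarrow> z) (at_left 1)" by simp
  have zc: "z \<in> closed_polydisc" using z torus_subset_closed by blast
  have "\<forall>\<^sub>F r in at_left (1::real). (\<chi> i. complex_of_real r * z $ i) \<in> closed_polydisc"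
    using eventually_at_left_real[of 0 1, simplified]
  proof eventually_elim
    case (elim r)
    then show ?case using scaled_in_polydisc[OF zc, of "of_real r"] polydisc_subset_closed by auto
  qed
  from continuous_on_tendsto_compose[OF hc lim zc this]
  have "((\<lambda>r. h (dilation ix m t r (theta ix m t z))) \<longlongrightarrow> h (theta ix m t z)) (at_left 1)"
    by (simp add: dilation_theta[OF t])
  then show ?thesis unfolding boundary_fun_def by (intro tendsto_Lim) auto
qed

lemma space_theta_measure: "space (theta_measure ix m t) = theta_boundary ix m t"
  by (simp add: theta_measure_def space_restrict_space)

text \<open>As a function of l on the closed disc, the quotient is holomorphic with value
  \<open>a\<close> at l = 0, so its mean over the circle is \<open>a\<close>. For the mean over
  \<open>N\<close> nodes, the geometric series of 1 / (1 + l b) is cut after \<open>N - 1\<close>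
  terms: the exponents 1 to \<open>N - 1\<close> of l then average to zero, and the remainder
  carries the factor \<open>\<rho> ^ (N - 1)\<close>.\<close>

lemma unity_root_average_Fisher:
  fixes a b M :: complex
  assumes b: "cmod b \<le> \<rho>" and a: "cmod a \<le> \<rho>" and \<rho>: "\<rho> < 1" and M: "cmod M = 1" and N: "N > 0"
  shows "cmod ((\<Sum>k<N. (1 / of_nat N) * ((a + unity_root N k * M) / (1 + unity_root N k * b))) - a)
    \<le> 2 * \<rho> ^ (N - 1) / (1 - \<rho>)"
proof -
  let ?l = "unity_root N"
  have \<rho>0: "\<rho> \<ge> 0" using a norm_ge_zero order_trans by blast
  have lb: "1 - \<rho> \<le> cmod (1 + ?l k * b)" for k
    using norm_triangle_ineq2[of 1 "- ?l k * b"] b by (simp add: norm_mult)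
  have nz: "1 + ?l k * b \<noteq> 0" for k using lb[of k] \<rho> by auto
  have split: "(a + ?l k * M) / (1 + ?l k * b) = a + (M - a * b) * ((\<Sum>i<N-1. (- b) ^ i * ?l k ^ (i + 1))
      + ?l k * (- ?l k * b) ^ (N - 1) / (1 + ?l k * b))" for k
  proof -
    have "(\<Sum>i<N-1. (- ?l k * b) ^ i) * (1 + ?l k * b) = 1 - (- ?l k * b) ^ (N - 1)"
      using one_diff_power_eq[of "- ?l k * b" "N - 1"] by (simp add: mult.commute)
    then have "1 / (1 + ?l k * b) = (\<Sum>i<N-1. (- ?l k * b) ^ i) + (- ?l k * b) ^ (N - 1) / (1 + ?l k * b)"
      using nz[of k] by (simp add: field_simps del: mult_minus_left)
    moreover have "?l k * (\<Sum>i<N-1. (- ?l k * b) ^ i) = (\<Sum>i<N-1. (- b) ^ i * ?l k ^ (i + 1))"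
    proof -
      have "- ?l k * b = (- b) * ?l k" by simp
      then show ?thesis unfolding sum_distrib_left
        by (simp only: power_mult_distrib power_add power_one_right mult_ac)
    qed
    ultimately have "?l k * (1 / (1 + ?l k * b)) = (\<Sum>i<N-1. (- b) ^ i * ?l k ^ (i + 1))
      + ?l k * (- ?l k * b) ^ (N - 1) / (1 + ?l k * b)"
      by (simp only: ring_distribs times_divide_eq_right)
    moreover have "(a + ?l k * M) / (1 + ?l k * b) = a + (M - a * b) * (?l k * (1 / (1 + ?l k * b)))"
      using nz[of k] by (simp add: field_simps)
    ultimately show ?thesis by simp
  qed
  have zero: "(\<Sum>k<N. \<Sum>i<N-1. (- b) ^ i * ?l k ^ (i + 1)) = 0"
  proof -
    have "(\<Sum>k<N. ?l k ^ (i + 1)) = 0" if "i < N - 1" for i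
      using sum_unity_root_power[OF N, of "i + 1"] that nat_dvd_not_less[of "i + 1" N] by simp
    then show ?thesis by (subst sum.swap) (simp flip: sum_distrib_left)
  qed
  have "(\<Sum>k<N. (1 / of_nat N) * ((a + ?l k * M) / (1 + ?l k * b))) - a
    = (M - a * b) / of_nat N * (\<Sum>k<N. ?l k * (- ?l k * b) ^ (N - 1) / (1 + ?l k * b))"
    unfolding split sum_distrib_left[symmetric] sum.distrib zero using N
    by (simp add: add_divide_distrib)
  also have "cmod \<dots> \<le> 2 / N * (\<Sum>k<N. \<rho> ^ (N - 1) / (1 - \<rho>))"
    unfolding norm_mult norm_divide norm_of_nat
  proof (intro mult_mono divide_right_mono sum_norm_le)
    have "cmod (a * b) \<le> 1 * 1" unfolding norm_mult using a b \<rho> by (intro mult_mono) auto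
    then show "cmod (M - a * b) \<le> 2" using norm_triangle_ineq4[of M "a * b"] M by simp
    fix k
    show "cmod (?l k * (- ?l k * b) ^ (N - 1) / (1 + ?l k * b)) \<le> \<rho> ^ (N - 1) / (1 - \<rho>)"
      unfolding norm_divide norm_mult norm_power using lb[of k] b \<rho> \<rho>0
      by (intro frac_le) (auto intro!: power_mono)
  qed (use \<rho> \<rho>0 in \<open>auto intro!: divide_nonneg_nonneg\<close>)
  also have "\<dots> = 2 * \<rho> ^ (N - 1) / (1 - \<rho>)" using N by simp
  finally show ?thesis .
qed

text \<open>\<open>Q\<close> is tied to the conjugate of \<open>P\<close> only on the boundary. The
  maximum principle, applied to the polynomial \<open>Q (theta ix m t z)\<close>, carries the bound
  \<open>\<rho>\<close> to the closed polydisc. So no denominator vanishes there, and the quotients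
  are continuous on a compact set that contains the closure of the domain.\<close>

lemma convex_combination_approximation:
  fixes ix :: "'n::finite \<Rightarrow> nat"
  assumes ix: "bij_betw ix UNIV {1..CARD('n)}" and t: "t dvd m"
    and P: "polynomial_sev P" and \<rho>: "\<rho> < 1" and le: "\<And>z. z \<in> torus \<Longrightarrow> cmod (P (theta ix m t z)) \<le> \<rho>"
    and \<delta>: "0 < \<delta>"
  obtains h where "convex_combination_of (rational_inner ix m t \<inter> disc_algebra (theta_domain ix m t)) h"
    "continuous_on (theta ix m t ` closed_polydisc) h"
    "\<And>z. z \<in> torus \<Longrightarrow> cmod (h (theta ix m t z) - P (theta ix m t z)) < \<delta>"
proof -
  let ?th = "theta ix m t"
  obtain d where d: "ix d = CARD('n)" using theta_index_top[OF ix] .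
  obtain K Q where Q: "polynomial_sev Q"
    "\<And>z. z \<in> torus \<Longrightarrow> Q (?th z) = (?th z $ d) ^ K * cnj (P (?th z))"
    using theta_reflected_polynomial[OF ix t d P] by blast
  have Qt: "cmod (Q (?th z)) \<le> \<rho>" if "z \<in> torus" for z
    using le[OF that] by (simp add: Q(2)[OF that] norm_mult norm_power norm_theta_top[of ix d, OF d that])
  have Qc: "cmod (Q (?th z)) \<le> \<rho>" if "z \<in> closed_polydisc" for z
    by (rule polynomial_sev_max_torus[OF polynomial_sev_compose[OF Q(1) polynomial_sev_theta] Qt that])
  have den: "1 + l * Q (?th z) \<noteq> 0" if "cmod l = 1" "z \<in> closed_polydisc" for l z
  proof
    assume "1 + l * Q (?th z) = 0"
    then have "cmod (l * Q (?th z)) = cmod (- 1)" by (metis add_eq_0_iff)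
    then show False using Qc[OF that(2)] that(1) \<rho> by (simp add: norm_mult)
  qed
  define num where "num = (\<lambda>l q. P q + l * (q $ d) ^ K)"
  define den' where "den' = (\<lambda>l q. 1 + l * Q q)"
  define \<phi> where "\<phi> = (\<lambda>l q. num l q / den' l q)"
  have poly: "polynomial_sev (num l)" "polynomial_sev (den' l)" for l
    unfolding num_def den'_def by (intro polynomial_sev_intros P Q)+
  have \<phi>_cont: "continuous_on (?th ` closed_polydisc) (\<phi> l)" if "cmod l = 1" for l
    unfolding \<phi>_def
    by (intro continuous_on_divide continuous_on_polynomial_sev poly) (auto simp: den'_def den[OF that])
  have \<phi>_norm: "cmod (\<phi> l (?th z)) = 1" if l: "cmod l = 1" and z: "z \<in> torus" for l z
  proof -
    let ?M = "(?th z $ d) ^ K" and ?p = "P (?th z)"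
    have M: "cmod ?M = 1" by (simp add: norm_power norm_theta_top[of ix d, OF d z])
    have unit: "x * cnj x = 1" if "cmod x = 1" for x
      using that by (simp add: complex_norm_square[symmetric])
    have expand: "(l * x) * cnj (y + l * x) = l * (x * cnj y) + (l * cnj l) * (x * cnj x)" for x y
      by (simp add: algebra_simps)
    \<comment> \<open>As \<open>l\<close> and \<open>?M\<close> are unimodular, the denominator is a
      unimodular factor times the conjugate of the numerator.\<close>
    have "1 + l * (?M * cnj ?p) = (l * ?M) * cnj (?p + l * ?M)"
      unfolding expand unit[OF l] unit[OF M] by (simp only: mult_1 add.commute)
    then have "cmod (1 + l * (?M * cnj ?p)) = cmod (?p + l * ?M)"
      using l M by (simp only: norm_mult complex_mod_cnj)
    moreover have "1 + l * (?M * cnj ?p) \<noteq> 0"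
      using den[OF l] z torus_subset_closed Q(2)[OF z] by force
    ultimately show ?thesis
      unfolding \<phi>_def num_def den'_def norm_divide Q(2)[OF z] by (metis divide_self norm_eq_zero)
  qed
  have \<phi>_mem: "\<phi> l \<in> rational_inner ix m t \<inter> disc_algebra (theta_domain ix m t)" if l: "cmod l = 1" for l
  proof -
    have den_dom: "den' l q \<noteq> 0" if "q \<in> theta_domain ix m t" for q
      using that den[OF l] polydisc_subset_closed by (auto simp: den'_def)
    have hol: "holomorphic_sev (\<phi> l) (theta_domain ix m t)"
      unfolding \<phi>_def by (rule holomorphic_sev_quotient[OF poly den_dom])
    have "bounded (\<phi> l ` ?th ` closed_polydisc)"
      by (intro compact_imp_bounded compact_continuous_image \<phi>_cont[OF l] continuous_on_theta compact_closed_polydisc)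
    then have "bounded (\<phi> l ` theta_domain ix m t)"
      by (rule bounded_subset) (intro image_mono polydisc_subset_closed)
    moreover have "cmod (boundary_fun ix m t (\<phi> l) q) = 1" if "q \<in> theta_boundary ix m t" for q
      using that \<phi>_norm[OF l] by (auto simp: boundary_fun_continuous[OF \<phi>_cont[OF l] t])
    ultimately have "inner_fun ix m t (\<phi> l)"
      using hol by (auto simp: inner_fun_def Hinf_def space_theta_measure intro!: AE_I2)
    moreover have "rational_poles_off (\<phi> l) (theta_domain ix m t)"
      unfolding rational_poles_off_def \<phi>_def using poly den_dom by blast
    moreover have "\<phi> l \<in> disc_algebra (theta_domain ix m t)"
      using hol continuous_on_subset[OF \<phi>_cont[OF l] closure_theta_domain_subset]
      by (simp add: disc_algebra_def)
    ultimately show ?thesis by (simp add: rational_inner_def)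
  qed
  have \<rho>0: "\<rho> \<ge> 0"
  proof -
    have "(\<chi> i. 1) \<in> (torus :: (complex^'n) set)" by (simp add: torus_def)
    then show ?thesis using le norm_ge_zero order_trans by blast
  qed
  \<comment> \<open>The average is taken over \<open>Suc N\<close> roots of unity: it is never
    empty, and its error has the exponent \<open>Suc N - 1 = N\<close>.\<close>
  have "(\<lambda>N. 2 * \<rho> ^ N / (1 - \<rho>)) \<longlonglongrightarrow> 2 * 0 / (1 - \<rho>)"
    by (intro tendsto_intros LIMSEQ_realpow_zero) (use \<rho> \<rho>0 in auto)
  then have "\<forall>\<^sub>F N in sequentially. 2 * \<rho> ^ N / (1 - \<rho>) < \<delta>"
    by (rule order_tendstoD(2)) (use \<delta> in auto)
  then obtain N where N: "2 * \<rho> ^ N / (1 - \<rho>) < \<delta>"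
    by (auto simp: eventually_sequentially)
  define h where "h = (\<lambda>q. \<Sum>k<Suc N. complex_of_real (1 / real (Suc N)) * \<phi> (unity_root (Suc N) k) q)"
  show thesis
  proof (rule that)
    show "convex_combination_of (rational_inner ix m t \<inter> disc_algebra (theta_domain ix m t)) h"
      unfolding convex_combination_of_def h_def
      by (intro exI[of _ "Suc N"] exI[of _ "\<lambda>_. 1 / real (Suc N)"] exI[of _ "\<lambda>k. \<phi> (unity_root (Suc N) k)"])
         (use \<phi>_mem in auto)
    show "continuous_on (?th ` closed_polydisc) h"
      unfolding h_def by (intro continuous_intros \<phi>_cont) auto
    fix z :: "complex^'n" assume z: "z \<in> torus"
    have "cmod (h (?th z) - P (?th z)) \<le> 2 * \<rho> ^ (Suc N - 1) / (1 - \<rho>)"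
      using unity_root_average_Fisher[OF Qt[OF z] le[OF z] \<rho>, of "(?th z $ d) ^ K" "Suc N"]
        norm_theta_top[of ix d, OF d z]
      by (simp add: h_def \<phi>_def num_def den'_def norm_power)
    then show "cmod (h (?th z) - P (?th z)) < \<delta>" using N by simp
  qed
qed

subsection \<open>Almost everywhere differentiability of Lipschitz functions\<close>

text \<open>The lower bound makes \<open>F\<close> an increasing bijection of the line. The image
  \<open>M\<close> of Lebesgue measure under its inverse \<open>G\<close> gives mass F b - F a to
  [a, b]. A null set A has preimage F(A) under \<open>G\<close>, which is null because
  \<open>F\<close> is Lipschitz; so \<open>M\<close> is absolutely continuous, and its Radon-Nikodym
  density is the required function.\<close>

lemma bilipschitz_mono_density:
  fixes F :: "real \<Rightarrow> real"
  assumes c: "c > 0" and lower: "\<And>x y. x \<le> y \<Longrightarrow> c * (y - x) \<le> F y - F x"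
    and upper: "\<And>x y. x \<le> y \<Longrightarrow> F y - F x \<le> L * (y - x)"
  obtains f where "\<And>a b. a \<le> b \<Longrightarrow> (f has_integral (F b - F a)) {a..b}"
proof -
  have "0 < c * (y - x)" if "x < y" for x y using c that by simp
  then have less: "F x < F y" if "x < y" for x y
    using lower[of x y] that by force
  have less_iff: "F x < F y \<longleftrightarrow> x < y" for x y
    using less by (metis less_irrefl linorder_cases order_less_trans)
  then have le_iff: "F x \<le> F y \<longleftrightarrow> x \<le> y" for x y
    by (metis linorder_not_less)
  have lip: "\<bar>F y - F x\<bar> \<le> L * \<bar>y - x\<bar>" for x y
    using upper[of x y] upper[of y x] le_iff[of x y] le_iff[of y x] by (cases "x \<le> y") auto
  have L: "L \<ge> 0" using lip[of 0 1] by simp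
  have "L-lipschitz_on UNIV F"
    using lip L by (intro lipschitz_onI) (auto simp: dist_real_def)
  then have cont: "continuous_on UNIV F" by (rule lipschitz_on_continuous_on)
  have inj: "inj F" using less_iff by (intro injI) (metis less_irrefl linorder_cases)
  have "\<exists>x. F x = y" for y
  proof -
    define a where "a = - \<bar>y - F 0\<bar> / c"
    define b where "b = \<bar>y - F 0\<bar> / c"
    have "F a \<le> y" "y \<le> F b" "a \<le> b"
      using lower[of a 0] lower[of 0 b] c by (auto simp: a_def b_def)
    then show ?thesis using IVT'[of F a y b] continuous_on_subset[OF cont] by auto
  qed
  then have surj: "surj F" by (metis surjI)
  define G where "G = inv F"
  have GF: "G (F x) = x" for x by (simp add: G_def inj)
  have FG: "F (G x) = x" for x by (simp add: G_def surj surj_f_inv_f)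
  have "mono G" by (intro monoI) (metis FG le_iff)
  then have G [measurable]: "G \<in> borel_measurable borel" by (rule borel_measurable_mono)
  define M where "M = distr lborel borel G"
  have M_Icc: "emeasure M {a..b} = ennreal (F b - F a)" if "a \<le> b" for a b
  proof -
    have "G -` {a..b} = {F a..F b}"
      using le_iff FG by (auto simp: vimage_def) (metis FG le_iff)+
    then show ?thesis using that le_iff
      by (simp add: M_def emeasure_distr)
  qed
  have ac: "absolutely_continuous lborel M"
    unfolding absolutely_continuous_def
  proof
    fix A :: "real set" assume A: "A \<in> null_sets lborel"
    then have A': "A \<in> sets borel" by auto
    have "negligible A" using A by (simp add: negligible_iff_null_sets null_sets_completionI)
    then have "negligible (F ` A)"
      by (rule negligible_locally_Lipschitz_image[rotated])
         (use lip in \<open>auto intro!: exI[of _ UNIV]\<close>)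
    moreover have "G -` A = F ` A" by (auto simp: GF image_iff) (metis FG)
    moreover have "G -` A \<in> sets borel" using measurable_sets[OF G A'] by simp
    ultimately have "emeasure lborel (G -` A) = 0"
      by (simp add: negligible_iff_null_sets null_sets_completion_iff null_setsD1)
    then show "A \<in> null_sets M"
      using A' by (auto simp: M_def null_sets_def emeasure_distr)
  qed
  obtain h where h [measurable]: "h \<in> borel_measurable borel" and hM: "density lborel h = M"
    using sigma_finite_measure.Radon_Nikodym[OF sigma_finite_lborel ac] by (auto simp: M_def)
  have hint: "(\<integral>\<^sup>+x. h x * indicator {a..b} x \<partial>lborel) = ennreal (F b - F a)" if "a \<le> b" for a b
    using M_Icc[OF that] by (simp add: emeasure_density flip: hM)
  define f where "f = (\<lambda>x. enn2real (h x))"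
  have [measurable]: "f \<in> borel_measurable borel" by (simp add: f_def)
  have "(f has_integral (F b - F a)) {a..b}" if ab: "a \<le> b" for a b
  proof -
    have "AE x in lborel. h x * indicator {a..b} x \<noteq> \<infinity>"
      by (rule nn_integral_PInf_AE) (use hint[OF ab] in auto)
    then have "AE x in lborel. ennreal (f x * indicator {a..b} x) = h x * indicator {a..b} x"
      by eventually_elim (auto simp: f_def indicator_def less_top split: if_splits)
    then have "(\<integral>\<^sup>+x. ennreal (f x * indicator {a..b} x) \<partial>lborel) = ennreal (F b - F a)"
      using hint[OF ab] by (simp cong: nn_integral_cong_AE)
    then have "((\<lambda>x. f x * indicator {a..b} x) has_integral (F b - F a)) UNIV"
      using ab le_iff by (intro nn_integral_has_integral) (auto simp: f_def)
    moreover have "(\<lambda>x. f x * indicator {a..b} x) = (\<lambda>x. if x \<in> {a..b} then f x else 0)"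
      by (auto simp: indicator_def)
    ultimately show ?thesis using has_integral_restrict_UNIV[of "{a..b}" f] by simp
  qed
  then show thesis by (rule that)
qed

text \<open>\<open>integrable_ccontinuous_explicit\<close> averages over intervals that start at the
  point, so it yields only the derivative from the right. Applied to the reflected function x
  \<mapsto> f (- x), it yields the derivative from the left.\<close>

lemma indefinite_integral_AE_differentiable:
  fixes F :: "real \<Rightarrow> real"
  assumes f: "\<And>a b. a \<le> b \<Longrightarrow> (f has_integral (F b - F a)) {a..b}"
  shows "\<exists>N. negligible N \<and> (\<forall>x. x \<notin> N \<longrightarrow> (F has_real_derivative f x) (at x))"
proof -
  have "f integrable_on cbox a b" for a b
    using f[of a b] by (cases "a \<le> b") (auto simp: integrable_on_def)
  from integrable_ccontinuous_explicit[OF this] obtain N1 where N1: "negligible N1"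
    "\<And>x e. x \<notin> N1 \<Longrightarrow> 0 < e \<Longrightarrow> \<exists>d>0. \<forall>h. 0 < h \<and> h < d \<longrightarrow>
       norm (integral (cbox x (x + h *\<^sub>R One)) f /\<^sub>R h ^ DIM(real) - f x) < e" by metis
  have f_reflect: "((\<lambda>x. f (- x)) has_integral (F (- a) - F (- b))) {a..b}" if "a \<le> b" for a b
    using f[of "-b" "-a"] that has_integral_reflect_real[of f "F (-a) - F (-b)" "-a" "-b"] by simp
  have "(\<lambda>x. f (- x)) integrable_on cbox a b" for a b
    using f_reflect[of a b] by (cases "a \<le> b") (auto simp: integrable_on_def)
  from integrable_ccontinuous_explicit[OF this] obtain N2 where N2: "negligible N2"
    "\<And>x e. x \<notin> N2 \<Longrightarrow> 0 < e \<Longrightarrow> \<exists>d>0. \<forall>h. 0 < h \<and> h < d \<longrightarrow>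
       norm (integral (cbox x (x + h *\<^sub>R One)) (\<lambda>x. f (- x)) /\<^sub>R h ^ DIM(real) - f (- x)) < e" by metis
  have "negligible (uminus ` N2)"
    by (rule negligible_locally_Lipschitz_image[OF _ N2(1)])
       (auto intro!: exI[of _ UNIV] exI[of _ "1::real"] simp: abs_minus_commute)
  moreover have "(F has_real_derivative f x) (at x)" if x: "x \<notin> N1 \<union> uminus ` N2" for x
    unfolding DERIV_def
  proof (rule LIM_I)
    fix e :: real assume e: "0 < e"
    have "x \<notin> N1" "- x \<notin> N2" using x by (auto simp: image_iff)
    obtain d1 where d1: "d1 > 0" "\<And>h. 0 < h \<Longrightarrow> h < d1 \<Longrightarrow>
       norm (integral (cbox x (x + h *\<^sub>R One)) f /\<^sub>R h ^ DIM(real) - f x) < e"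
      using N1(2)[OF \<open>x \<notin> N1\<close> e] by blast
    obtain d2 where d2: "d2 > 0" "\<And>h. 0 < h \<Longrightarrow> h < d2 \<Longrightarrow>
       norm (integral (cbox (-x) (-x + h *\<^sub>R One)) (\<lambda>x. f (- x)) /\<^sub>R h ^ DIM(real) - f x) < e"
      using N2(2)[OF \<open>- x \<notin> N2\<close> e] unfolding minus_minus by blast
    have 1: "\<bar>(F (x + h) - F x) / h - f x\<bar> < e" if "0 < h" "h < d1" for h
      using d1(2)[OF that] integral_unique[OF f[of x "x + h"]] that
      by (simp add: divide_inverse mult.commute)
    have 2: "\<bar>(F x - F (x - h)) / h - f x\<bar> < e" if "0 < h" "h < d2" for h
      using d2(2)[OF that] integral_unique[OF f_reflect[of "-x" "-x + h"]] that
      by (simp add: divide_inverse mult.commute)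
    show "\<exists>s>0. \<forall>h. h \<noteq> 0 \<and> norm (h - 0) < s \<longrightarrow> norm ((F (x + h) - F x) / h - f x) < e"
    proof (intro exI[of _ "min d1 d2"] conjI allI impI)
      fix h :: real assume h: "h \<noteq> 0 \<and> norm (h - 0) < min d1 d2"
      show "norm ((F (x + h) - F x) / h - f x) < e"
      proof (cases "h > 0")
        case True then show ?thesis using 1[of h] h by simp
      next
        case False
        have "(F (x + h) - F x) / h = (F x - F (x - (- h))) / (- h)"
          by (simp add: minus_divide_left add.commute)
        then show ?thesis using 2[of "-h"] h False by simp
      qed
    qed (use d1 d2 in auto)
  qed
  ultimately show ?thesis using N1(1) negligible_Un by blast
qed

lemma lipschitz_AE_differentiable_real:
  fixes \<phi> :: "real \<Rightarrow> real"
  assumes "L-lipschitz_on UNIV \<phi>"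
  shows "\<exists>N. negligible N \<and> (\<forall>x. x \<notin> N \<longrightarrow> (\<exists>D. (\<phi> has_real_derivative D) (at x)))"
proof -
  have L: "L \<ge> 0" using lipschitz_on_nonneg[OF assms] .
  have lip: "\<bar>\<phi> y - \<phi> x\<bar> \<le> L * \<bar>y - x\<bar>" for x y
    using lipschitz_onD[OF assms, of y x] by (simp add: dist_real_def)
  \<comment> \<open>Adding a linear function of slope L + 1 turns a Lipschitz function into one with
    difference quotients between 1 and 2 L + 1, and does not affect differentiability.\<close>
  define F where "F = (\<lambda>x. \<phi> x + (L + 1) * x)"
  have "1 * (y - x) \<le> F y - F x \<and> F y - F x \<le> (2 * L + 1) * (y - x)" if "x \<le> y" for x y
  proof -
    have "\<phi> y - \<phi> x \<le> L * (y - x)" "- (\<phi> y - \<phi> x) \<le> L * (y - x)"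
      using lip[of y x] that by (auto simp: abs_le_iff)
    then show ?thesis using that by (simp add: F_def algebra_simps)
  qed
  then obtain f where "\<And>a b. a \<le> b \<Longrightarrow> (f has_integral (F b - F a)) {a..b}"
    using bilipschitz_mono_density[of 1 F "2 * L + 1"] by (metis zero_less_one)
  from indefinite_integral_AE_differentiable[OF this]
  obtain N where N: "negligible N" "\<And>x. x \<notin> N \<Longrightarrow> (F has_real_derivative f x) (at x)" by blast
  have "(\<phi> has_real_derivative (f x - (L + 1))) (at x)" if "x \<notin> N" for x
  proof -
    have "((\<lambda>x. F x - (L + 1) * x) has_real_derivative (f x - (L + 1))) (at x)"
      by (rule derivative_eq_intros N(2)[OF that] refl | simp)+
    then show ?thesis by (simp add: F_def)
  qed
  then show ?thesis using N(1) by blast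
qed

lemma lipschitz_AE_differentiable:
  fixes \<phi> :: "real \<Rightarrow> complex"
  assumes "L-lipschitz_on UNIV \<phi>"
  shows "\<exists>N. negligible N \<and> (\<forall>x. x \<notin> N \<longrightarrow> (\<exists>D. (\<phi> has_vector_derivative D) (at x)))"
proof -
  have lip: "cmod (\<phi> y - \<phi> x) \<le> L * \<bar>y - x\<bar>" for x y
    using lipschitz_onD[OF assms, of y x] by (simp add: dist_norm)
  have Re: "\<bar>Re (\<phi> y) - Re (\<phi> x)\<bar> \<le> L * \<bar>y - x\<bar>" and Im: "\<bar>Im (\<phi> y) - Im (\<phi> x)\<bar> \<le> L * \<bar>y - x\<bar>" for x y
    using lip[of y x] abs_Re_le_cmod[of "\<phi> y - \<phi> x"] abs_Im_le_cmod[of "\<phi> y - \<phi> x"] by auto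
  have "L-lipschitz_on UNIV (\<lambda>x. Re (\<phi> x))" "L-lipschitz_on UNIV (\<lambda>x. Im (\<phi> x))"
    using Re Im lipschitz_on_nonneg[OF assms] by (auto intro!: lipschitz_onI simp: dist_real_def)
  then obtain N1 N2 where N: "negligible N1" "negligible N2"
     and N1: "\<And>x. x \<notin> N1 \<Longrightarrow> \<exists>D. ((\<lambda>x. Re (\<phi> x)) has_real_derivative D) (at x)"
     and N2: "\<And>x. x \<notin> N2 \<Longrightarrow> \<exists>D. ((\<lambda>x. Im (\<phi> x)) has_real_derivative D) (at x)"
    using lipschitz_AE_differentiable_real by metis
  have "\<exists>D. (\<phi> has_vector_derivative D) (at x)" if x: "x \<notin> N1 \<union> N2" for x
  proof -
    obtain a b where "((\<lambda>x. Re (\<phi> x)) has_real_derivative a) (at x)"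
      "((\<lambda>x. Im (\<phi> x)) has_real_derivative b) (at x)" using x N1 N2 by blast
    then have "((\<lambda>x. Complex (Re (\<phi> x)) (Im (\<phi> x))) has_vector_derivative Complex a b) (at x)"
      by (simp add: has_vector_derivative_complex_iff has_real_derivative_iff_has_vector_derivative)
    then show ?thesis by auto
  qed
  then show ?thesis using N negligible_Un by blast
qed

subsection \<open>Fatou's theorem\<close>

text \<open>On the unit circle the kernel is the real part of (u + r) / (u - r). Since du = 2 pi i u
  dx, this quotient comes from the form (2 / (u - r) - 1 / u) du, whose integral is 2 (2 pi i) - 2
  pi i by Cauchy's formula.\<close>

lemma Poisson_kernel_integral:
  assumes r: "0 < r" "r < 1"
  shows "((\<lambda>x. (1 - r\<^sup>2) / (cmod (circlepath 0 1 x - of_real r))\<^sup>2) has_integral 1) {0..1}"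
proof -
  let ?u = "circlepath 0 1"
  have u: "cmod (?u x) = 1" for x by (simp add: circlepath norm_mult)
  have "((\<lambda>u. 1 / (u - w)) has_contour_integral (2 * of_real pi * \<i> * 1)) ?u" if "cmod w < 1" for w
    using Cauchy_integral_circlepath_simple[of "\<lambda>_. 1" 0 1 w] that by simp
  from has_contour_integral_diff[OF has_contour_integral_lmul[OF this[of "of_real r"], of 2] this[of 0]] r
  have "((\<lambda>u. 2 * (1 / (u - of_real r)) - 1 / (u - 0)) has_contour_integral 2 * of_real pi * \<i>) ?u"
    by (simp add: mult_ac)
  then have "((\<lambda>x. (2 * (1 / (?u x - of_real r)) - 1 / (?u x - 0)) * vector_derivative ?u (at x within {0..1}))
      has_integral 2 * of_real pi * \<i>) {0..1}"
    unfolding has_contour_integral_def .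
  then have "((\<lambda>x. (2 * of_real pi * \<i>) * ((?u x + of_real r) / (?u x - of_real r)))
      has_integral 2 * of_real pi * \<i>) {0..1}"
  proof (rule has_integral_eq[rotated])
    fix x :: real assume x: "x \<in> {0..1}"
    have "?u x - of_real r \<noteq> 0" "?u x \<noteq> 0" using u[of x] r by auto
    moreover have "vector_derivative ?u (at x within {0..1}) = 2 * of_real pi * \<i> * ?u x"
      using x vector_derivative_circlepath01[of x 0 1] by (simp only: atLeastAtMost_iff) (simp add: circlepath)
    ultimately show "(2 * (1 / (?u x - of_real r)) - 1 / (?u x - 0)) * vector_derivative ?u (at x within {0..1})
        = (2 * of_real pi * \<i>) * ((?u x + of_real r) / (?u x - of_real r))"
      by (simp add: field_simps)
  qed
  from has_integral_mult_right[OF this, of "1 / (2 * of_real pi * \<i>)"]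
  have "((\<lambda>x. (?u x + of_real r) / (?u x - of_real r)) has_integral 1) {0..1}"
    by simp
  then have "((\<lambda>x. Re ((?u x + of_real r) / (?u x - of_real r))) has_integral 1) {0..1}"
    using has_integral_linear[OF _ bounded_linear_Re] by (force simp: o_def)
  moreover have "Re ((?u x + of_real r) / (?u x - of_real r)) = (1 - r\<^sup>2) / (cmod (?u x - of_real r))\<^sup>2" for x
  proof -
    have "(Re (?u x))\<^sup>2 + (Im (?u x))\<^sup>2 = 1" using u[of x] by (simp flip: cmod_power2)
    then show ?thesis unfolding Re_divide cmod_power2
      by (intro arg_cong2[where f = "(/)"]) (simp_all add: algebra_simps power2_eq_square)
  qed
  ultimately show ?thesis by simp
qed

text \<open>
  The local form of Fatou's theorem for a derivative. In Cauchy's formula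
  for \<open>R'(r)\<close>, where \<open>R u = G u - G 1 - a (u - 1)\<close>, one may subtract the term \<open>R u / (1 - r u)\<^sup>2\<close>,
  which is holomorphic in the disc; what remains is \<open>R u / (u - 1)\<close>, which is small near \<open>1\<close>,
  times a kernel bounded by a multiple of the Poisson kernel.
\<close>
lemma deriv_radial_limit_of_tangential_derivative:
  assumes cont: "continuous_on (cball 0 1) G" and hol: "G holomorphic_on ball 0 1"
    and tan: "\<And>e. e > 0 \<Longrightarrow> \<exists>\<delta>>0. \<forall>u. cmod u = 1 \<and> cmod (u - 1) < \<delta> \<longrightarrow>
                 cmod (G u - G 1 - a * (u - 1)) \<le> e * cmod (u - 1)"
  shows "((\<lambda>r. deriv G (complex_of_real r)) \<longlongrightarrow> a) (at_left 1)"
proof -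
  define R where "R = (\<lambda>u. G u - G 1 - a * (u - 1))"
  have Rcont: "continuous_on (cball 0 1) R" and Rhol: "R holomorphic_on ball 0 1"
    unfolding R_def using cont hol by (auto intro!: continuous_intros holomorphic_intros)
  have "bounded (R ` cball 0 1)"
    by (intro compact_imp_bounded compact_continuous_image Rcont) auto
  then obtain C where C: "C > 0" "\<And>u. cmod u \<le> 1 \<Longrightarrow> cmod (R u) \<le> C"
    unfolding bounded_pos by auto
  let ?u = "circlepath 0 1"
  have u: "cmod (?u x) = 1" for x by (simp add: circlepath norm_mult)
  have bound: "cmod (deriv G (of_real r) - a) \<le> 8 * e + 32 * C * (1 - r\<^sup>2) / \<delta> ^ 4"
    if r: "0 < r" "r < 1" and e: "e > 0" and \<delta>: "\<delta> > 0"
      "\<And>u. cmod u = 1 \<Longrightarrow> cmod (u - 1) < \<delta> \<Longrightarrow> cmod (R u) \<le> e * cmod (u - 1)" for r e \<delta>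
  proof -
    define K where "K = (\<lambda>u. R u / (u - of_real r)\<^sup>2 - R u / (1 - of_real r * u)\<^sup>2)"
    have nz: "1 - of_real r * u \<noteq> 0" if "cmod u \<le> 1" for u
    proof
      assume "1 - of_real r * u = 0"
      then have "1 = r * cmod u" using r
        by (metis abs_of_pos norm_mult norm_of_real norm_one eq_iff_diff_eq_0)
      also have "\<dots> \<le> r" using that r by (simp add: mult_left_le)
      finally show False using r by simp
    qed
    have rb: "of_real r \<in> ball (0::complex) 1" using r by simp
    note D = Cauchy_derivative_integral_circlepath[OF Rcont Rhol rb]
    have "deriv G (of_real r) - a = deriv R (of_real r)"
    proof -
      have "G field_differentiable at (of_real r)"
        using hol rb by (metis holomorphic_on_imp_differentiable_at open_ball)
      then have "(R has_field_derivative (deriv G (of_real r) - a)) (at (of_real r))"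
        unfolding R_def by (auto intro!: derivative_eq_intros simp: field_differentiable_derivI)
      then show ?thesis by (simp add: DERIV_imp_deriv)
    qed
    also have "\<dots> = 1 / (2 * of_real pi * \<i>) * contour_integral ?u (\<lambda>u. R u / (u - of_real r)\<^sup>2)"
      by (rule DERIV_imp_deriv[OF D(2)])
    finally have 1: "deriv G (of_real r) - a = 1 / (2 * of_real pi * \<i>) * contour_integral ?u (\<lambda>u. R u / (u - of_real r)\<^sup>2)" .
    \<comment> \<open>The subtracted term integrates to zero. As \<open>R\<close> is only continuous
      on the circle, this is read off Cauchy's formula at the centre 0 for u R(u) / (1 - r u)^2,
      whose value there is 0.\<close>
    have "((\<lambda>u. (u * R u / (1 - of_real r * u)\<^sup>2) / (u - 0)) has_contour_integral
        2 * of_real pi * \<i> * (0 * R 0 / (1 - of_real r * 0)\<^sup>2)) ?u"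
      by (rule Cauchy_integral_circlepath)
         (use nz in \<open>auto intro!: continuous_intros holomorphic_intros Rcont Rhol\<close>)
    moreover have "2 * of_real pi * \<i> * (0 * R 0 / (1 - of_real r * 0)\<^sup>2) = 0" by simp
    ultimately have "((\<lambda>u. (u * R u / (1 - of_real r * u)\<^sup>2) / (u - 0)) has_contour_integral 0) ?u"
      by (simp only:)
    then have "((\<lambda>u. R u / (1 - of_real r * u)\<^sup>2) has_contour_integral 0) ?u"
      by (rule has_contour_integral_eq) (auto simp: path_image_circlepath)
    from has_contour_integral_diff[OF has_contour_integral_integral[OF D(1)] this]
    have "(K has_contour_integral contour_integral ?u (\<lambda>u. R u / (u - of_real r)\<^sup>2)) ?u"
      by (simp add: K_def)
    then have K: "((\<lambda>x. K (?u x) * vector_derivative ?u (at x within {0..1})) has_integral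
       contour_integral ?u (\<lambda>u. R u / (u - of_real r)\<^sup>2)) {0..1}"
      by (simp add: has_contour_integral_def)
    have Kbound: "cmod (K u) \<le> 8 * e * ((1 - r\<^sup>2) / (cmod (u - of_real r))\<^sup>2) + 32 * C * (1 - r\<^sup>2) / \<delta> ^ 4"
      if u: "cmod u = 1" for u
    proof -
      define y where "y = cmod (u - of_real r)"
      define x where "x = cmod (u - 1)"
      have r1: "0 < 1 - r\<^sup>2" using r by (simp add: power_less_one_iff abs_square_less_1)
      have y1: "1 - r \<le> y" using norm_triangle_ineq2[of u "of_real r"] u r by (simp add: y_def)
      have y0: "y > 0" using y1 r by simp
      have "x \<le> y + cmod (of_real (r - 1))"
        unfolding x_def y_def using norm_triangle_ineq[of "u - of_real r" "of_real (r - 1)"] by simp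
      then have xy: "x \<le> 2 * y" using y1 r unfolding norm_of_real by linarith
      have "1 - of_real r * u = u * cnj (u - of_real r)"
        using u complex_norm_square[of u] by (simp add: algebra_simps)
      then have y2: "cmod (1 - of_real r * u) = y"
        by (simp add: norm_mult u y_def del: complex_cnj_diff)
      have nz1: "u - of_real r \<noteq> 0" using y0 by (auto simp: y_def)
      have nz2: "1 - of_real r * u \<noteq> 0" using nz[of u] u by simp
      \<comment> \<open>This uses (1 - r u)^2 - (u - r)^2 = (1 - r^2)(1 - u^2). The first factor is
        the numerator of the Poisson kernel, the second supplies a further factor \<open>x\<close>,
        and the two denominators have equal modulus on the circle.\<close>
      have "K u = R u * ((1 - (of_real r)\<^sup>2) * (1 - u\<^sup>2)) / ((u - of_real r)\<^sup>2 * (1 - of_real r * u)\<^sup>2)"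
        unfolding K_def diff_frac_eq[OF power_not_zero[OF nz1] power_not_zero[OF nz2]]
        by (rule arg_cong2[where f = "(/)"]) (auto simp: algebra_simps power2_eq_square)
      moreover have "cmod (1 - (of_real r)\<^sup>2) = 1 - r\<^sup>2"
        using r1 by (metis abs_of_pos norm_of_real of_real_1 of_real_diff of_real_power)
      ultimately have Ku: "cmod (K u) = cmod (R u) * ((1 - r\<^sup>2) * cmod (1 - u\<^sup>2)) / y ^ 4"
        by (simp add: norm_mult norm_divide norm_power y2 flip: y_def)
      have "1 - u\<^sup>2 = (1 - u) * (1 + u)" by (simp add: algebra_simps power2_eq_square)
      then have "cmod (1 - u\<^sup>2) = x * cmod (1 + u)" by (simp add: norm_mult x_def norm_minus_commute)
      also have "\<dots> \<le> x * 2" using norm_triangle_ineq[of 1 u] u by (intro mult_left_mono) (auto simp: x_def)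
      finally have u2: "cmod (1 - u\<^sup>2) \<le> 2 * x" by simp
      have x0: "x \<ge> 0" by (simp add: x_def)
      show ?thesis
      \<comment> \<open>Near 1, the bounds \<open>e * x\<close> for \<open>R\<close> and
        \<open>2 * x\<close> for 1 - u^2, together with \<open>x \<le> 2 * y\<close>, leave 8 e
        times the Poisson kernel. Away from 1, y is at least \<delta> / 2, and 2 C / (\<delta> /
        2)^4 = 32 C / \<delta>^4.\<close>
      proof (cases "x < \<delta>")
        case True
        have "cmod (R u) \<le> e * x" using \<delta>(2)[OF u] True by (simp add: x_def)
        then have "cmod (K u) \<le> (e * x) * ((1 - r\<^sup>2) * (2 * x)) / y ^ 4"
          unfolding Ku using u2 r1 y0 x0 e by (intro divide_right_mono mult_mono) auto
        also have "\<dots> = 2 * e * (1 - r\<^sup>2) * x\<^sup>2 / y ^ 4" by (simp add: power2_eq_square)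
        also have "\<dots> \<le> 2 * e * (1 - r\<^sup>2) * (2 * y)\<^sup>2 / y ^ 4"
          using xy x0 e r1 y0 by (intro divide_right_mono mult_left_mono power_mono) auto
        also have "\<dots> = 8 * e * ((1 - r\<^sup>2) / y\<^sup>2)"
          using y0 by (simp add: field_simps power2_eq_square power4_eq_xxxx)
        finally show ?thesis using C(1) r1 \<delta>(1) by (simp add: y_def add_increasing2)
      next
        case False
        have "cmod (1 - u\<^sup>2) \<le> 2" using norm_triangle_ineq4[of 1 "u\<^sup>2"] u by (simp add: norm_power)
        then have "cmod (K u) \<le> C * ((1 - r\<^sup>2) * 2) / y ^ 4"
          unfolding Ku using C(2)[of u] C(1) u r1 y0 by (intro divide_right_mono mult_mono) auto
        also have "\<dots> \<le> C * ((1 - r\<^sup>2) * 2) / (\<delta> / 2) ^ 4"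
          using False xy \<delta>(1) C(1) r1 by (intro divide_left_mono power_mono mult_nonneg_nonneg) auto
        also have "\<dots> = 32 * C * (1 - r\<^sup>2) / \<delta> ^ 4" by (simp add: field_simps)
        finally show ?thesis using e r1 by (simp add: add_increasing)
      qed
    qed
    define c where "c = 32 * C * (1 - r\<^sup>2) / \<delta> ^ 4"
    have "((\<lambda>x. 2 * pi * (8 * e * ((1 - r\<^sup>2) / (cmod (?u x - of_real r))\<^sup>2) + c)) has_integral
        2 * pi * (8 * e * 1 + c)) {0..1}"
      using has_integral_const_real[of c 0 1]
      by (intro has_integral_mult_right has_integral_add Poisson_kernel_integral r) simp
    from K this have "cmod (contour_integral ?u (\<lambda>u. R u / (u - of_real r)\<^sup>2)) \<le> (2 * pi * (8 * e * 1 + c)) \<bullet> 1"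
    proof (rule has_integral_norm_bound_integral_component)
      fix x :: real assume x: "x \<in> {0..1}"
      have "cmod (vector_derivative ?u (at x within {0..1})) = 2 * pi"
        using x by (simp add: vector_derivative_circlepath01 norm_mult)
      then show "cmod (K (?u x) * vector_derivative ?u (at x within {0..1}))
          \<le> (2 * pi * (8 * e * ((1 - r\<^sup>2) / (cmod (?u x - of_real r))\<^sup>2) + c)) \<bullet> 1"
        using Kbound[OF u, of x] by (simp add: norm_mult c_def)
    qed
    then show ?thesis by (simp add: 1 norm_mult norm_divide c_def field_simps)
  qed
  show ?thesis
  proof (rule tendstoI)
    fix e :: real assume e: "e > 0"
    \<comment> \<open>With \<open>e / 16\<close> the Poisson term is e / 2; the other term vanishes
      with 1 - r^2.\<close>
    obtain \<delta> where \<delta>: "\<delta> > 0" "\<And>u. cmod u = 1 \<Longrightarrow> cmod (u - 1) < \<delta> \<Longrightarrow> cmod (R u) \<le> e / 16 * cmod (u - 1)"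
      using tan[of "e / 16"] e by (auto simp: R_def)
    have "((\<lambda>r. 8 * (e / 16) + 32 * C * (1 - r\<^sup>2) / \<delta> ^ 4) \<longlongrightarrow> 8 * (e / 16) + 32 * C * (1 - 1\<^sup>2) / \<delta> ^ 4) (at_left (1::real))"
      by (intro tendsto_intros) (use \<delta> in auto)
    then have "\<forall>\<^sub>F r in at_left (1::real). 8 * (e / 16) + 32 * C * (1 - r\<^sup>2) / \<delta> ^ 4 < e"
      by (rule order_tendstoD(2)) (use e in auto)
    moreover have "\<forall>\<^sub>F r in at_left (1::real). 0 < r \<and> r < 1"
      using eventually_at_left_real[of 0 1] by simp
    ultimately show "\<forall>\<^sub>F r in at_left 1. dist (deriv G (of_real r)) a < e"
    proof eventually_elim
      case (elim r)
      then show ?case using bound[of r "e / 16" \<delta>] \<delta> e by (simp add: dist_norm)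
    qed
  qed
qed

text \<open>A primitive of \<open>g\<close> is B-Lipschitz on the disc and extends to the closed
  disc. Along the circle it is then a Lipschitz function of the angle, hence differentiable outside
  a null set. At each angle of differentiability, a rotation to the point 1 reduces the claim to
  \<open>deriv_radial_limit_of_tangential_derivative\<close>.\<close>

lemma Fatou_radial_limits:
  assumes hol: "g holomorphic_on ball 0 1" and bdd: "\<And>z. cmod z < 1 \<Longrightarrow> cmod (g z) \<le> B"
  shows "\<exists>N. negligible N \<and> (\<forall>s. s \<notin> N \<longrightarrow> (\<exists>l. ((\<lambda>r. g (of_real r * cis s)) \<longlongrightarrow> l) (at_left 1)))"
proof -
  obtain G0 where G0: "\<And>x. x \<in> ball 0 1 \<Longrightarrow> (G0 has_field_derivative g x) (at x within ball 0 1)"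
    using holomorphic_convex_primitive'[OF convex_ball open_ball hol] by blast
  have B: "B \<ge> 0" using order_trans[OF norm_ge_zero bdd[of 0]] by simp
  have "B-lipschitz_on (ball 0 1) G0"
  proof (rule lipschitz_onI)
    fix x y assume xy: "x \<in> ball (0::complex) 1" "y \<in> ball (0::complex) 1"
    show "dist (G0 x) (G0 y) \<le> B * dist x y"
      unfolding dist_norm
      by (rule field_differentiable_bound[OF convex_ball G0 _ xy]) (auto intro: bdd)
  qed (rule B)
  then obtain G where Glip: "B-lipschitz_on (closure (ball 0 1)) G" and GG0: "\<And>x. x \<in> ball 0 1 \<Longrightarrow> G x = G0 x"
    using lipschitz_extend_closure by blast
  then have Glip: "B-lipschitz_on (cball 0 1) G" by simp
  have Gderiv: "(G has_field_derivative g x) (at x)" if "cmod x < 1" for x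
  proof -
    have "(G0 has_field_derivative g x) (at x)"
      using G0[of x] that at_within_open[of x "ball 0 1"] by simp
    moreover have "x \<in> ball 0 1" "\<And>y. y \<in> ball 0 1 \<Longrightarrow> G0 y = G y" using that GG0 by auto
    ultimately show ?thesis
      by (meson has_field_derivative_transform_within_open open_ball)
  qed
  define \<phi> where "\<phi> = (\<lambda>s. G (cis s))"
  have "B-lipschitz_on UNIV \<phi>"
  proof (rule lipschitz_onI)
    fix s t :: real
    have "norm (cis s - cis t) \<le> 1 * norm (s - t)"
      by (rule differentiable_bound[OF convex_UNIV, of cis "\<lambda>x h. h *\<^sub>R (\<i> * cis x)"])
         (auto intro!: onorm_le derivative_eq_intros simp: norm_mult)
    then have "dist (cis s) (cis t) \<le> dist s t" by (simp add: dist_norm)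
    then show "dist (\<phi> s) (\<phi> t) \<le> B * dist s t"
      using lipschitz_onD[OF Glip, of "cis s" "cis t"] B unfolding \<phi>_def
      by (auto intro: order_trans mult_left_mono)
  qed (rule B)
  from lipschitz_AE_differentiable[OF this] obtain N where N: "negligible N"
    "\<And>s. s \<notin> N \<Longrightarrow> \<exists>D. (\<phi> has_vector_derivative D) (at s)" by blast
  have "\<exists>l. ((\<lambda>r. g (of_real r * cis s)) \<longlongrightarrow> l) (at_left 1)" if "s \<notin> N" for s
  proof -
    obtain D where D: "(\<phi> has_vector_derivative D) (at s)" using N(2) \<open>s \<notin> N\<close> by blast
    define H where "H = (\<lambda>w. G (cis s * w))"
    \<comment> \<open>\<open>cis\<close> has velocity i at angle 0, so a complex derivative a of
      \<open>H\<close> at 1 along the circle must satisfy a i = D.\<close>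
    define a where "a = - \<i> * D"
    have Hderiv: "(H has_field_derivative (cis s * g (cis s * w))) (at w)" if "cmod w < 1" for w
    proof -
      have "cmod (cis s * w) < 1" using that by (simp add: norm_mult)
      then have "((\<lambda>w. G (cis s * w)) has_field_derivative g (cis s * w) * cis s) (at w)"
        by (intro DERIV_chain2[where f = G and g = "\<lambda>w. cis s * w"] Gderiv)
           (auto intro!: derivative_eq_intros)
      then show ?thesis by (simp add: H_def mult.commute)
    qed
    have "((\<lambda>r. deriv H (complex_of_real r)) \<longlongrightarrow> a) (at_left 1)"
    proof (rule deriv_radial_limit_of_tangential_derivative)
      show "continuous_on (cball 0 1) H" unfolding H_def
        by (rule continuous_on_compose2[OF lipschitz_on_continuous_on[OF Glip]])
           (auto intro!: continuous_intros simp: norm_mult)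
      show "H holomorphic_on ball 0 1"
        unfolding holomorphic_on_open[OF open_ball] by (intro ballI exI, rule Hderiv) simp
      fix e :: real assume e: "e > 0"
      define \<psi> where "\<psi> = (\<lambda>h. H (cis h) - H 1 - a * (cis h - 1))"
      have "((\<lambda>h. \<phi> (s + h)) has_vector_derivative D) (at 0)"
      proof -
        have "((\<lambda>h. s + h) has_vector_derivative 1) (at 0)"
          by (auto intro!: derivative_eq_intros)
        then show ?thesis
          using vector_diff_chain_at[of "\<lambda>h. s + h" 1 0 \<phi> D] D by (simp add: o_def)
      qed
      moreover have "\<phi> (s + h) = H (cis h)" for h by (simp add: \<phi>_def H_def cis_mult)
      moreover have "(cis has_vector_derivative \<i>) (at 0)"
        unfolding has_vector_derivative_def by (auto intro!: derivative_eq_intros)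
      ultimately have \<psi>': "(\<psi> has_vector_derivative (D - 0 - a * (\<i> - 0))) (at 0)"
        unfolding \<psi>_def by (intro has_vector_derivative_diff has_vector_derivative_const has_vector_derivative_mult_right) auto
      have \<psi>: "(\<psi> has_derivative (\<lambda>h. 0)) (at (Im (Ln 1)))"
      proof -
        have "D - 0 - a * (\<i> - 0) = 0" by (simp add: a_def complex_eq_iff)
        then show ?thesis
          using \<psi>' by (simp add: has_vector_derivative_def)
      qed
      \<comment> \<open>Near 1 the angle of a point u of the circle is \<open>Im (Ln u)\<close>.
        Composing with it turns the vanishing derivative in the angle into the required bound in
        terms of |u - 1|.\<close>
      have "(Ln has_field_derivative 1) (at 1)"
        using has_field_derivative_Ln[of 1] by simp
      then have "((\<lambda>u. Im (Ln u)) has_derivative (\<lambda>v. Im (1 * v))) (at 1)"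
        unfolding has_field_derivative_def by (rule has_derivative_Im)
      from has_derivative_compose[OF this \<psi>]
      have "((\<lambda>u. \<psi> (Im (Ln u))) has_derivative (\<lambda>_. 0)) (at 1)" by simp
      then obtain d where d: "d > 0" "\<And>u. cmod (u - 1) < d \<Longrightarrow> cmod (\<psi> (Im (Ln u)) - \<psi> (Im (Ln 1)) - 0) \<le> e * cmod (u - 1)"
        using e unfolding has_derivative_at_alt by metis
      have "cmod (H u - H 1 - a * (u - 1)) \<le> e * cmod (u - 1)" if u: "cmod u = 1" "cmod (u - 1) < d" for u
      proof -
        have "u \<noteq> 0" using u by auto
        then have "cis (Im (Ln u)) = u"
          using u(1) by (simp add: cis_conv_exp) (metis Re_Ln complex_eq exp_Ln ln_one mult.commute of_real_0 add_0)
        then show ?thesis using d(2)[OF u(2)] by (simp add: \<psi>_def)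
      qed
      then show "\<exists>\<delta>>0. \<forall>u. cmod u = 1 \<and> cmod (u - 1) < \<delta> \<longrightarrow> cmod (H u - H 1 - a * (u - 1)) \<le> e * cmod (u - 1)"
        using d(1) by blast
    qed
    then have "((\<lambda>r. deriv H (complex_of_real r) / cis s) \<longlongrightarrow> a / cis s) (at_left 1)"
      by (intro tendsto_intros) auto
    moreover have "\<forall>\<^sub>F r in at_left 1. deriv H (complex_of_real r) / cis s = g (of_real r * cis s)"
      using eventually_at_left_real[of 0 1, simplified]
    proof eventually_elim
      case (elim r)
      then have "deriv H (of_real r) = cis s * g (cis s * of_real r)"
        by (intro DERIV_imp_deriv Hderiv) auto
      then show ?case by (simp add: mult.commute)
    qed
    ultimately have "((\<lambda>r. g (of_real r * cis s)) \<longlongrightarrow> a / cis s) (at_left 1)"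
      by (rule Lim_transform_eventually)
    then show ?thesis ..
  qed
  then show ?thesis using N(1) by blast
qed

subsection \<open>Radial limits on the torus\<close>

text \<open>This Cauchy criterion quantifies over countable sets only, which makes the set of points
  with a radial limit measurable. The offset in \<open>k + 2\<close> keeps the radii above 1/2,
  inside the interval of continuity.\<close>

lemma ex_radial_limit_iff:
  fixes u :: "real \<Rightarrow> complex"
  assumes cont: "continuous_on {0<..<1} u"
  shows "(\<exists>l. (u \<longlongrightarrow> l) (at_left 1)) \<longleftrightarrow>
    (\<forall>n. \<exists>k. \<forall>r\<in>\<rat>\<inter>{0<..<1}. \<forall>r'\<in>\<rat>\<inter>{0<..<1}. 1 - 1 / real (k + 2) < r \<longrightarrow> 1 - 1 / real (k + 2) < r' \<longrightarrow>
       cmod (u r - u r') \<le> 1 / real (Suc n))" (is "?L \<longleftrightarrow> ?R")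
proof
  assume ?L
  then obtain l where l: "(u \<longlongrightarrow> l) (at_left 1)" by blast
  show ?R
  proof
    fix n
    have "\<forall>\<^sub>F r in at_left 1. dist (u r) l < 1 / real (Suc n) / 2"
      using l by (rule tendstoD) simp
    then obtain b where b: "b < 1" "\<And>r. b < r \<Longrightarrow> r < 1 \<Longrightarrow> dist (u r) l < 1 / real (Suc n) / 2"
      unfolding eventually_at_left[OF zero_less_one] by blast
    obtain k where k: "1 / real (Suc k) < 1 - b" using b(1) nat_approx_posE[of "1 - b"] by auto
    have "1 / real (k + 2) < 1 / real (Suc k)" by (intro divide_strict_left_mono) auto
    then have kb: "b < 1 - 1 / real (k + 2)" using k by simp
    show "\<exists>k. \<forall>r\<in>\<rat>\<inter>{0<..<1}. \<forall>r'\<in>\<rat>\<inter>{0<..<1}. 1 - 1 / real (k + 2) < r \<longrightarrow> 1 - 1 / real (k + 2) < r' \<longrightarrow>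
       cmod (u r - u r') \<le> 1 / real (Suc n)"
    proof (intro exI[of _ k] ballI impI)
      fix r r' assume r: "r \<in> \<rat>\<inter>{0<..<1}" "r' \<in> \<rat>\<inter>{0<..<1}" "1 - 1 / real (k + 2) < r" "1 - 1 / real (k + 2) < r'"
      have "dist (u r) l < 1 / real (Suc n) / 2" "dist (u r') l < 1 / real (Suc n) / 2"
      proof -
        have "b < r" "b < r'" using r kb by linarith+
        then show "dist (u r) l < 1 / real (Suc n) / 2" "dist (u r') l < 1 / real (Suc n) / 2"
          using b(2)[of r] b(2)[of r'] r(1,2) by (simp_all only: Int_iff greaterThanLessThan_iff)
      qed
      then have "dist (u r) (u r') < 1 / real (Suc n)" by (rule dist_triangle_half_l)
      then show "cmod (u r - u r') \<le> 1 / real (Suc n)" by (simp add: dist_norm)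
    qed
  qed
next
  assume R: ?R
  have real: "\<exists>k. \<forall>r r'. 1 - 1 / real (k + 2) < r \<longrightarrow> r < 1 \<longrightarrow> 1 - 1 / real (k + 2) < r' \<longrightarrow> r' < 1 \<longrightarrow>
       cmod (u r - u r') \<le> 1 / real (Suc n)" for n
  proof -
    obtain k where k: "\<And>r r'. r \<in> \<rat>\<inter>{0<..<1} \<Longrightarrow> r' \<in> \<rat>\<inter>{0<..<1} \<Longrightarrow> 1 - 1 / real (k + 2) < r \<Longrightarrow>
       1 - 1 / real (k + 2) < r' \<Longrightarrow> cmod (u r - u r') \<le> 1 / real (Suc n)"
      using R by meson
    define a where "a = 1 - 1 / real (k + 2)"
    have a: "0 < a" by (simp add: a_def)
    define c where "c = 1 / real (Suc n)"
    \<comment> \<open>By continuity, a bound at the rationals of an interval holds throughout: a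
      violation at r would persist on a right neighbourhood of r. It is applied to the two radii in
      turn.\<close>
    have dense: "cmod (v r) \<le> c" if v: "continuous_on {a<..<1} v" "\<And>q. q \<in> \<rat> \<Longrightarrow> a < q \<Longrightarrow> q < 1 \<Longrightarrow> cmod (v q) \<le> c"
      and r: "a < r" "r < 1" for v :: "real \<Rightarrow> complex" and r
    proof (rule ccontr)
      assume "\<not> cmod (v r) \<le> c"
      have "continuous (at r) v"
        using v(1) r by (simp add: continuous_on_eq_continuous_at)
      then have "((\<lambda>x. cmod (v x)) \<longlongrightarrow> cmod (v r)) (at r)"
        by (intro tendsto_norm) (simp add: continuous_at)
      then have "\<forall>\<^sub>F x in at r. c < cmod (v x)"
        by (rule order_tendstoD(1)) (use \<open>\<not> cmod (v r) \<le> c\<close> in simp)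
      then have "\<forall>\<^sub>F x in at_right r. c < cmod (v x)"
        by (simp add: eventually_at_split)
      then obtain b where b: "b > r" "\<And>x. r < x \<Longrightarrow> x < b \<Longrightarrow> c < cmod (v x)"
        using r(2) unfolding eventually_at_right[OF r(2)] by blast
      obtain q where "q \<in> \<rat>" "r < q" "q < min b 1"
        using Rats_dense_in_real[of r "min b 1"] b(1) r(2) by auto
      then show False using b(2)[of q] v(2)[of q] r(1) by auto
    qed
    have ca: "continuous_on {a<..<1} u" using a by (intro continuous_on_subset[OF cont]) auto
    have ka: "cmod (u q - u q') \<le> c" if "q \<in> \<rat>" "a < q" "q < 1" "q' \<in> \<rat>" "a < q'" "q' < 1" for q q'
    proof -
      have "q \<in> \<rat>\<inter>{0<..<1}" "q' \<in> \<rat>\<inter>{0<..<1}" using that a by auto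
      then show ?thesis using k[of q q'] that by (simp only: a_def c_def)
    qed
    have 1: "cmod (u r - u q) \<le> c" if "a < r" "r < 1" "q \<in> \<rat>" "a < q" "q < 1" for r q
      by (rule dense[of "\<lambda>r. u r - u q"])
         (use that ka in \<open>auto intro!: continuous_intros ca\<close>)
    have "cmod (u r - u r') \<le> c" if "a < r" "r < 1" "a < r'" "r' < 1" for r r'
      by (rule dense[of "\<lambda>x. u r - u x" r'])
         (use that 1[of r] in \<open>auto intro!: continuous_intros ca\<close>)
    then show ?thesis unfolding a_def c_def by blast
  qed
  \<comment> \<open>With \<open>i + 3\<close> in place of \<open>k + 2\<close>, the inequality
    \<open>1 - 1 / real (k + 2) < x i\<close> is strict even for \<open>i = k\<close>.\<close>
  define x where "x = (\<lambda>i. 1 - 1 / real (i + 3))"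
  have x: "0 < x i" "x i < 1" for i by (auto simp: x_def)
  have x_gt: "1 - 1 / real (k + 2) < x i" if "k \<le> i" for i k
  proof -
    have "1 / real (i + 3) < 1 / real (k + 2)"
      by (rule divide_strict_left_mono) (use that in auto)
    then show ?thesis by (simp only: x_def)
  qed
  have "Cauchy (\<lambda>i. u (x i))"
    unfolding Cauchy_altdef2
  proof (intro allI impI)
    fix e :: real assume "e > 0"
    then obtain n where n: "1 / real (Suc n) < e" using nat_approx_posE by blast
    obtain k where k: "\<forall>r r'. 1 - 1 / real (k + 2) < r \<longrightarrow> r < 1 \<longrightarrow> 1 - 1 / real (k + 2) < r' \<longrightarrow> r' < 1 \<longrightarrow>
       cmod (u r - u r') \<le> 1 / real (Suc n)" using real by blast
    have "dist (u (x i)) (u (x k)) < e" if "i \<ge> k" for i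
      using k[rule_format, of "x i" "x k"] x x_gt[OF that] x_gt[of k k] n by (simp add: dist_norm)
    then show "\<exists>N. \<forall>n\<ge>N. dist (u (x n)) (u (x N)) < e" by blast
  qed
  then obtain l where l: "(\<lambda>i. u (x i)) \<longlonglongrightarrow> l" by (meson Cauchy_convergent_iff convergent_def)
  have "(u \<longlongrightarrow> l) (at_left 1)"
  proof (rule tendstoI)
    fix e :: real assume "e > 0"
    then obtain n where n: "1 / real (Suc n) < e / 2" using nat_approx_posE[of "e / 2"] by auto
    obtain k where k: "\<forall>r r'. 1 - 1 / real (k + 2) < r \<longrightarrow> r < 1 \<longrightarrow> 1 - 1 / real (k + 2) < r' \<longrightarrow> r' < 1 \<longrightarrow>
       cmod (u r - u r') \<le> 1 / real (Suc n)" using real by blast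
    have "\<forall>\<^sub>F i in sequentially. dist (u (x i)) l < e / 2"
      using l \<open>e > 0\<close> by (intro tendstoD) auto
    then obtain i0 where "\<And>i. i \<ge> i0 \<Longrightarrow> dist (u (x i)) l < e / 2"
      unfolding eventually_sequentially by blast
    then obtain i where i: "i \<ge> k" "dist (u (x i)) l < e / 2"
      using max.cobounded1[of k i0] max.cobounded2[of i0 k] by blast
    have "\<forall>\<^sub>F r in at_left 1. r \<in> {1 - 1 / real (k + 2)<..<1}"
      by (rule eventually_at_left_real) simp
    then show "\<forall>\<^sub>F r in at_left 1. dist (u r) l < e"
    proof eventually_elim
      case (elim r)
      then have "dist (u r) (u (x i)) < e / 2"
        using k[rule_format, of r "x i"] x x_gt[OF i(1)] n by (simp add: dist_norm)
      then show ?case using i(2) dist_triangle[of "u r" l "u (x i)"] by simp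
    qed
  qed
  then show ?L by blast
qed

lemma sets_Collect_ball_countable:
  assumes "countable I" "\<And>i. i \<in> I \<Longrightarrow> {x\<in>space M. P i x} \<in> sets M"
  shows "{x\<in>space M. \<forall>i\<in>I. P i x} \<in> sets M"
proof -
  have "{x\<in>space M. \<forall>i\<in>I. P i x} = space M - (\<Union>i\<in>I. space M - {x\<in>space M. P i x})" by auto
  moreover have "(\<Union>i\<in>I. space M - {x\<in>space M. P i x}) \<in> sets M"
    using assms by (intro sets.countable_UN') (auto intro!: sets.compl_sets)
  ultimately show ?thesis by (simp only: sets.compl_sets)
qed

lemma sets_ex_radial_limit:
  fixes u :: "real \<Rightarrow> 'a \<Rightarrow> complex"
  assumes meas: "\<And>r. 0 < r \<Longrightarrow> r < 1 \<Longrightarrow> u r \<in> borel_measurable M"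
    and cont: "\<And>x. x \<in> space M \<Longrightarrow> continuous_on {0<..<1} (\<lambda>r. u r x)"
  shows "{x\<in>space M. \<exists>l. ((\<lambda>r. u r x) \<longlongrightarrow> l) (at_left 1)} \<in> sets M"
proof -
  have Q: "countable (\<rat>\<inter>{0<..<1::real})" using countable_rat by blast
  have "{x\<in>space M. \<exists>l. ((\<lambda>r. u r x) \<longlongrightarrow> l) (at_left 1)} =
    {x\<in>space M. \<forall>n. \<exists>k. \<forall>r\<in>\<rat>\<inter>{0<..<1}. \<forall>r'\<in>\<rat>\<inter>{0<..<1}. 1 - 1 / real (k + 2) < r \<longrightarrow> 1 - 1 / real (k + 2) < r' \<longrightarrow>
       cmod (u r x - u r' x) \<le> 1 / real (Suc n)}"
    by (intro Collect_cong conj_cong refl ex_radial_limit_iff cont)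
  also have "\<dots> \<in> sets M"
  proof (intro sets.sets_Collect sets_Collect_ball_countable[OF Q] borel_measurable_le)
    fix r r' :: real assume "r \<in> \<rat>\<inter>{0<..<1}" "r' \<in> \<rat>\<inter>{0<..<1}"
    then have [measurable]: "u r \<in> borel_measurable M" "u r' \<in> borel_measurable M"
      by (auto intro: meas)
    show "(\<lambda>x. cmod (u r x - u r' x)) \<in> borel_measurable M" by measurable
  qed auto
  finally show ?thesis .
qed

lemma borel_measurable_radial_Lim:
  fixes u :: "real \<Rightarrow> 'a \<Rightarrow> complex"
  assumes meas: "\<And>r. 0 < r \<Longrightarrow> r < 1 \<Longrightarrow> u r \<in> borel_measurable M"
    and cont: "\<And>x. x \<in> space M \<Longrightarrow> continuous_on {0<..<1} (\<lambda>r. u r x)"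
  shows "(\<lambda>x. Lim (at_left 1) (\<lambda>r. u r x)) \<in> borel_measurable M"
proof -
  define E where "E = {x\<in>space M. \<exists>l. ((\<lambda>r. u r x) \<longlongrightarrow> l) (at_left 1)}"
  have E: "E \<in> sets M" unfolding E_def by (rule sets_ex_radial_limit[OF meas cont])
  define x where "x = (\<lambda>n. 1 - 1 / real (n + 2))"
  have x: "0 < x n" "x n < 1" for n by (auto simp: x_def)
  have "x \<longlonglongrightarrow> 1 - 0"
    unfolding x_def by (intro tendsto_diff tendsto_const LIMSEQ_ignore_initial_segment lim_1_over_n)
  then have x_lim: "filterlim x (at_left 1) sequentially"
    using x less_imp_neq[OF x(2)] by (auto simp: filterlim_at intro!: always_eventually)
  \<comment> \<open>Where no limit exists, the definition of \<open>Lim\<close> collapses to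
    \<open>THE l. False\<close>. With this constant outside \<open>E\<close>, the measurable
    functions \<open>g n\<close> converge to \<open>Lim\<close> at every point.\<close>
  define g where "g = (\<lambda>n y. if y \<in> E then u (x n) y else (THE l. False))"
  have "(\<lambda>y. Lim (at_left 1) (\<lambda>r. u r y)) \<in> borel_measurable M"
  proof (rule borel_measurable_LIMSEQ_metric)
    show "g n \<in> borel_measurable M" for n
      unfolding g_def using E x by (intro measurable_If_set meas measurable_const) auto
    fix y assume y: "y \<in> space M"
    show "(\<lambda>n. g n y) \<longlonglongrightarrow> Lim (at_left 1) (\<lambda>r. u r y)"
    proof (cases "y \<in> E")
      case True
      then obtain l where l: "((\<lambda>r. u r y) \<longlongrightarrow> l) (at_left 1)" by (auto simp: E_def)
      then have "Lim (at_left 1) (\<lambda>r. u r y) = l" by (intro tendsto_Lim) auto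
      then show ?thesis using True filterlim_compose[OF l x_lim] by (simp add: g_def)
    next
      case False
      then have "\<not> ((\<lambda>r. u r y) \<longlongrightarrow> l) (at_left 1)" for l using y by (auto simp: E_def)
      then have "Lim (at_left 1) (\<lambda>r. u r y) = (THE l. False)" unfolding t2_space_class.Lim_def by simp
      then show ?thesis using False by (simp add: g_def)
    qed
  qed
  then show ?thesis .
qed

lemma rotation_measurable:
  "(\<lambda>p. \<chi> i. cis (fst p) * (snd p :: complex^'n) $ i)
     \<in> uniform_measure lborel {0..1} \<Otimes>\<^sub>M torus_haar \<rightarrow>\<^sub>M torus_haar"
proof -
  have id: "(\<lambda>z. z) \<in> torus_haar \<rightarrow>\<^sub>M (borel :: (complex^'n) measure)"
    by (simp add: measurable_cong_sets[OF sets_torus_haar refl] measurable_restrict_space1)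
  have pair: "(\<lambda>p. (fst p, snd p)) \<in> uniform_measure lborel {0..1} \<Otimes>\<^sub>M torus_haar \<rightarrow>\<^sub>M (borel :: (real \<times> (complex^'n)) measure)"
    unfolding borel_prod[symmetric]
    by (intro measurable_Pair measurable_compose[OF measurable_snd id] measurable_compose[OF measurable_fst])
       (simp_all add: measurable_ident_sets)
  have cont: "continuous_on UNIV (\<lambda>p. \<chi> i. cis (fst p) * (snd p :: complex^'n) $ i)"
    by (intro continuous_intros)
  have "(\<lambda>p. \<chi> i. cis (fst p) * (snd p :: complex^'n) $ i)
     \<in> uniform_measure lborel {0..1} \<Otimes>\<^sub>M torus_haar \<rightarrow>\<^sub>M borel"
    using measurable_compose[OF pair borel_measurable_continuous_onI[OF cont]] by simp
  then have "(\<lambda>p. \<chi> i. cis (fst p) * (snd p :: complex^'n) $ i)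
     \<in> uniform_measure lborel {0..1} \<Otimes>\<^sub>M torus_haar \<rightarrow>\<^sub>M restrict_space borel torus"
    by (rule measurable_restrict_space2[rotated])
       (auto simp: space_pair_measure space_torus_haar torus_def norm_mult)
  then show ?thesis by (simp add: measurable_cong_sets[OF refl sets_torus_haar])
qed

text \<open>By rotation invariance the measure of \<open>B\<close> equals its average over rotated
  copies of \<open>B\<close>. Fubini then integrates first over the angle, where the integral
  vanishes on every orbit. The uniform measure on [0, 1] serves as a probability measure on angles
  that is absolutely continuous with respect to Lebesgue measure.\<close>

lemma torus_haar_null_if_orbits_null:
  fixes B :: "(complex^'n) set"
  assumes B: "B \<in> sets torus_haar"
    and null: "\<And>z. z \<in> torus \<Longrightarrow> negligible {s. (\<chi> i. cis s * z $ i) \<in> B}"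
  shows "B \<in> null_sets torus_haar"
proof -
  define U where "U = uniform_measure lborel {0..1::real}"
  let ?T = "torus_haar :: (complex^'n) measure"
  let ?R = "\<lambda>s (z :: complex^'n). \<chi> i. cis s * z $ i"
  interpret U: prob_space U
    unfolding U_def by (rule prob_space_uniform_measure) auto
  interpret T: prob_space ?T by (rule prob_space_torus_haar)
  interpret UT: pair_sigma_finite U ?T ..
  have R: "(\<lambda>p. ?R (fst p) (snd p)) \<in> U \<Otimes>\<^sub>M ?T \<rightarrow>\<^sub>M ?T"
    unfolding U_def by (rule rotation_measurable)
  have sp: "space U = UNIV" by (simp add: U_def)
  have Rs: "?R s \<in> ?T \<rightarrow>\<^sub>M ?T" for s
    using measurable_Pair2[OF R, of s] sp by simp
  have Rz: "(\<lambda>s. ?R s z) \<in> U \<rightarrow>\<^sub>M ?T" if "z \<in> torus" for z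
    using measurable_Pair1[OF R, of z] that by (simp add: space_torus_haar)
  have "emeasure ?T B = (\<integral>\<^sup>+s. emeasure ?T B \<partial>U)"
    by (simp add: U.emeasure_space_1)
  also have "\<dots> = (\<integral>\<^sup>+s. (\<integral>\<^sup>+z. indicator B (?R s z) \<partial>?T) \<partial>U)"
  proof (intro nn_integral_cong)
    fix s
    have c: "(\<chi> i. cis s) \<in> (torus :: (complex^'n) set)" by (simp add: torus_def)
    have "emeasure ?T B = emeasure (distr ?T ?T (?R s)) B"
      using torus_haar_invariant[OF c] by simp
    also have "\<dots> = (\<integral>\<^sup>+z. indicator B z \<partial>distr ?T ?T (?R s))"
      using B by simp
    also have "\<dots> = (\<integral>\<^sup>+z. indicator B (?R s z) \<partial>?T)"
      using B by (intro nn_integral_distr Rs) simp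
    finally show "emeasure ?T B = (\<integral>\<^sup>+z. indicator B (?R s z) \<partial>?T)" .
  qed
  also have "\<dots> = (\<integral>\<^sup>+z. (\<integral>\<^sup>+s. indicator B (?R s z) \<partial>U) \<partial>?T)"
  proof (rule UT.Fubini'[symmetric])
    show "(\<lambda>(s, z). indicator B (?R s z) :: ennreal) \<in> borel_measurable (U \<Otimes>\<^sub>M ?T)"
      using measurable_compose[OF R borel_measurable_indicator[OF B]] by (simp add: split_beta')
  qed
  also have "\<dots> = (\<integral>\<^sup>+z. 0 \<partial>?T)"
  proof (intro nn_integral_cong)
    fix z assume "z \<in> space ?T"
    then have z: "z \<in> torus" by (simp add: space_torus_haar)
    let ?S = "{s. ?R s z \<in> B}"
    have "?S \<in> sets U" using measurable_sets[OF Rz[OF z] B] sp by (simp add: vimage_def)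
    then have S: "?S \<in> sets borel" by (simp add: U_def)
    then have "?S \<in> null_sets lborel"
      using null[OF z] by (simp add: negligible_iff_null_sets null_sets_completion_iff)
    then have "AE s in lborel. s \<notin> ?S" by (rule AE_not_in)
    then have "AE s in U. s \<notin> ?S"
      unfolding U_def by (intro AE_uniform_measureI) auto
    then have "(\<integral>\<^sup>+s. indicator B (?R s z) \<partial>U) = (\<integral>\<^sup>+s. 0 \<partial>U)"
      by (intro nn_integral_cong_AE) (auto elim!: eventually_mono)
    then show "(\<integral>\<^sup>+s. indicator B (?R s z) \<partial>U) = 0" by simp
  qed
  finally show ?thesis using B by (simp add: null_sets_def)
qed

lemma torus_radial_limits_AE:
  fixes F :: "complex^'n \<Rightarrow> complex"
  assumes cont: "continuous_on polydisc F"
    and hol: "\<And>z. z \<in> torus \<Longrightarrow> (\<lambda>w. F (\<chi> i. w * z $ i)) holomorphic_on ball 0 1"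
    and bdd: "\<And>z. z \<in> polydisc \<Longrightarrow> cmod (F z) \<le> C"
  shows "AE z in torus_haar. \<exists>l. ((\<lambda>r. F (\<chi> i. of_real r * z $ i)) \<longlongrightarrow> l) (at_left 1)"
proof -
  let ?T = "torus_haar :: (complex^'n) measure"
  have in_polydisc: "(\<chi> i. w * z $ i) \<in> polydisc" if "z \<in> torus" "cmod w < 1" for z :: "complex^'n" and w
    using that by (auto simp: torus_def polydisc_def norm_mult)
  define E where "E = {z\<in>space ?T. \<exists>l. ((\<lambda>r. F (\<chi> i. of_real r * z $ i)) \<longlongrightarrow> l) (at_left 1)}"
  have E: "E \<in> sets ?T" unfolding E_def
  proof (rule sets_ex_radial_limit)
    fix r :: real assume r: "0 < r" "r < 1"
    have "continuous_on torus (\<lambda>z. F (\<chi> i. of_real r * z $ i))"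
      by (rule continuous_on_compose2[OF cont])
         (use r in \<open>auto intro!: continuous_intros in_polydisc\<close>)
    then show "(\<lambda>z. F (\<chi> i. of_real r * z $ i)) \<in> borel_measurable ?T"
      unfolding measurable_cong_sets[OF sets_torus_haar refl]
      by (rule borel_measurable_continuous_on_restrict)
  next
    fix z assume z: "z \<in> space ?T"
    show "continuous_on {0<..<1} (\<lambda>r. F (\<chi> i. of_real r * z $ i))"
      by (rule continuous_on_compose2[OF cont])
         (use z in \<open>auto intro!: continuous_intros in_polydisc simp: space_torus_haar\<close>)
  qed
  have "space ?T - E \<in> null_sets ?T"
  proof (rule torus_haar_null_if_orbits_null)
    show "space ?T - E \<in> sets ?T" using E by blast
    fix z :: "complex^'n" assume z: "z \<in> torus"
    have "cmod (F (\<chi> i. w * z $ i)) \<le> C" if "cmod w < 1" for w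
      by (intro bdd in_polydisc z that)
    from Fatou_radial_limits[OF hol[OF z] this] obtain N where N: "negligible N"
      "\<And>s. s \<notin> N \<Longrightarrow> \<exists>l. ((\<lambda>r. F (\<chi> i. of_real r * cis s * z $ i)) \<longlongrightarrow> l) (at_left 1)"
      by auto
    have "{s. (\<chi> i. cis s * z $ i) \<in> space ?T - E} \<subseteq> N"
      using N(2) by (auto simp: E_def mult.assoc)
    then show "negligible {s. (\<chi> i. cis s * z $ i) \<in> space ?T - E}"
      using N(1) negligible_subset by blast
  qed
  then have "AE z in ?T. z \<notin> space ?T - E" by (rule AE_not_in)
  then show ?thesis using AE_space by eventually_elim (auto simp: E_def)
qed

subsection \<open>The approximation theorem\<close>

lemma norm_average_diff_le:
  fixes g :: "'a \<Rightarrow> complex"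
  assumes "finite A" "A \<noteq> {}" "\<And>a. a \<in> A \<Longrightarrow> cmod (g a - c) < \<delta>"
  shows "cmod ((\<Sum>a\<in>A. g a) / of_nat (card A) - c) < \<delta>"
proof -
  have cA: "card A > 0" using assms by (simp add: card_gt_0_iff)
  have "(\<Sum>a\<in>A. g a) / of_nat (card A) - c = (\<Sum>a\<in>A. g a - c) / of_nat (card A)"
    using cA by (simp add: sum_subtractf field_simps)
  moreover have "cmod (\<Sum>a\<in>A. g a - c) < of_nat (card A) * \<delta>"
  proof -
    have "cmod (\<Sum>a\<in>A. g a - c) \<le> (\<Sum>a\<in>A. cmod (g a - c))" by (rule norm_sum)
    also have "\<dots> < (\<Sum>a\<in>A. \<delta>)" by (rule sum_strict_mono) (use assms in auto)
    finally show ?thesis by simp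
  qed
  ultimately show ?thesis using cA by (simp add: norm_divide field_simps)
qed

text \<open>The approximating polynomial \<open>p\<close> in z need not be invariant, but its target
  is: \<open>theta\<close> is invariant, and the group action commutes with dilation and preserves
  the closed polydisc. So every transform of \<open>p\<close> has error below
  \<open>\<delta>\<close>, and so has their average.\<close>

lemma theta_polynomial_approximation:
  fixes ix :: "'n::finite \<Rightarrow> nat"
  assumes ix: "bij_betw ix UNIV {1..CARD('n)}" and mt: "m > 0" "t > 0" "t dvd m"
    and hol: "separately_holomorphic (\<lambda>z. f (theta ix m t z))"
    and bdd: "\<And>q. q \<in> theta_domain ix m t \<Longrightarrow> cmod (f q) \<le> 1"
    and s: "0 < s" "s < 1" and \<delta>: "0 < \<delta>"
  obtains P where "polynomial_sev P"
    "\<And>z. z \<in> closed_polydisc \<Longrightarrow> cmod (P (theta ix m t z) - f (theta ix m t (\<chi> i. of_real s * z $ i))) < \<delta>"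
proof -
  let ?th = "theta ix m t"
  let ?H = "diagonal_group m t :: (complex^'n) set"
  let ?G = "{\<sigma> :: 'n \<Rightarrow> 'n. bij \<sigma>} \<times> ?H"
  obtain p where p: "polynomial_sev p"
    "\<And>z. z \<in> closed_polydisc \<Longrightarrow> cmod (p z - f (?th (\<chi> i. of_real s * z $ i))) < \<delta>"
    using polynomial_approximation[OF hol _ s \<delta>] bdd by blast
  have finH: "finite ?H" by (rule finite_diagonal_group[OF mt(1)])
  have fin: "finite ?G" using finH by (simp add: finite_cartesian_product)
  have "(\<chi> i. 1) \<in> ?H" by (simp add: diagonal_group_def)
  then have ne: "?G \<noteq> {}" using bij_id by blast
  obtain P where P: "polynomial_sev P"
    "(\<lambda>z. (\<Sum>\<sigma> | bij \<sigma>. \<Sum>w\<in>?H. p (permute_vec \<sigma> (scale_vec w z))) / of_nat (card ?G)) = (\<lambda>z. P (?th z))"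
    using theta_polynomial_cdivide[OF theta_polynomial_average[OF ix mt p(1)]]
    unfolding theta_polynomial_def by blast
  show thesis
  proof (rule that[OF P(1)])
    fix z :: "complex^'n" assume z: "z \<in> closed_polydisc"
    let ?c = "f (?th (\<chi> i. of_real s * z $ i))"
    have "cmod ((\<Sum>(\<sigma>, w)\<in>?G. p (permute_vec \<sigma> (scale_vec w z))) / of_nat (card ?G) - ?c) < \<delta>"
    proof (rule norm_average_diff_le[OF fin ne], clarify)
      fix \<sigma> :: "'n \<Rightarrow> 'n" and w assume \<sigma>: "bij \<sigma>" and w: "w \<in> ?H"
      let ?g = "permute_vec \<sigma> (scale_vec w z)"
      have "cmod (w $ i) = 1" for i
        using power_eq_imp_eq_norm[of "w $ i" m 1] w mt(1) by (simp add: diagonal_group_def)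
      then have "?g \<in> closed_polydisc"
        using z by (auto simp: closed_polydisc_def permute_vec_def scale_vec_def norm_mult)
      from p(2)[OF this] have "cmod (p ?g - f (?th (\<chi> i. of_real s * ?g $ i))) < \<delta>" .
      also have "(\<chi> i. of_real s * ?g $ i) = permute_vec \<sigma> (scale_vec w (\<chi> i. of_real s * z $ i))"
        by (simp add: permute_vec_def scale_vec_def vec_eq_iff)
      also have "?th \<dots> = ?th (\<chi> i. of_real s * z $ i)"
        by (simp add: theta_permute_vec[OF \<sigma>] theta_scale_vec[OF w])
      finally show "cmod (p ?g - ?c) < \<delta>" .
    qed
    then show "cmod (P (?th z) - ?c) < \<delta>"
      unfolding fun_cong[OF P(2), symmetric] by (simp add: sum.cartesian_product)
  qed
qed

lemma dilate_approximation:
  fixes ix :: "'n::finite \<Rightarrow> nat"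
  assumes ix: "bij_betw ix UNIV {1..CARD('n)}" and mt: "m > 0" "t > 0" "t dvd m"
    and f: "holomorphic_sev f (theta_domain ix m t)"
    and bdd: "\<And>q. q \<in> theta_domain ix m t \<Longrightarrow> cmod (f q) \<le> 1"
    and s: "0 < s" "s < 1" and \<delta>: "0 < \<delta>"
  obtains h where "convex_combination_of (rational_inner ix m t \<inter> disc_algebra (theta_domain ix m t)) h"
    "continuous_on (theta ix m t ` closed_polydisc) h"
    "\<And>z. z \<in> torus \<Longrightarrow> cmod (h (theta ix m t z) - f (theta ix m t (\<chi> i. of_real s * z $ i))) < 4 * \<delta>"
proof -
  let ?th = "theta ix m t"
  have "separately_holomorphic (\<lambda>z. f (?th z))"
    unfolding separately_holomorphic_def
  proof (intro ballI allI)
    fix z :: "complex^'n" and i assume z: "z \<in> polydisc"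
    show "(\<lambda>w. f (?th (upd z i w))) holomorphic_on ball 0 1"
      unfolding holomorphic_on_def
    proof
      fix w :: complex assume w: "w \<in> ball 0 1"
      have "upd z i w \<in> polydisc" using z w by (auto simp: polydisc_def upd_nth)
      moreover have "(\<lambda>w. ?th (upd z i w) $ k) field_differentiable (at w)" for k
        using holomorphic_on_upd_polynomial[OF polynomial_sev_theta[of ix m t k], of z i UNIV]
        by (simp add: holomorphic_on_def)
      ultimately have "(\<lambda>w. f (?th (upd z i w))) field_differentiable at w"
        by (intro holomorphic_sev_slice[OF f, where \<gamma> = "\<lambda>w. ?th (upd z i w)"] imageI)
      then show "(\<lambda>w. f (?th (upd z i w))) field_differentiable at w within ball 0 1"
        by (rule field_differentiable_at_within)
    qed
  qed
  then obtain P0 where P0: "polynomial_sev P0"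
    "\<And>z. z \<in> closed_polydisc \<Longrightarrow> cmod (P0 (?th z) - f (?th (\<chi> i. of_real s * z $ i))) < \<delta>"
    using theta_polynomial_approximation[where f = f, OF ix mt _ bdd s \<delta>] by blast
  \<comment> \<open>\<open>P0\<close> may exceed 1 in modulus by \<open>\<delta>\<close>. Division
    by \<open>1 + 2 * \<delta>\<close> brings the bound strictly below 1 and moves \<open>P0\<close>
    by at most \<open>2 * \<delta>\<close>; with \<open>\<delta>\<close> each for \<open>P0\<close>
    and \<open>h\<close>, the total error is \<open>4 * \<delta>\<close>.\<close>
  define P where "P = (\<lambda>q. of_real (1 / (1 + 2 * \<delta>)) * P0 q)"
  have P: "polynomial_sev P" unfolding P_def by (intro polynomial_sev_intros P0)
  have P0_le: "cmod (P0 (?th z)) \<le> 1 + \<delta>" if z: "z \<in> torus" for z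
  proof -
    have zc: "z \<in> closed_polydisc" using z torus_subset_closed by blast
    have "(\<chi> i. of_real s * z $ i) \<in> polydisc" using scaled_in_polydisc[OF zc] s by simp
    then have "cmod (f (?th (\<chi> i. of_real s * z $ i))) \<le> 1" by (intro bdd) blast
    then show ?thesis
      using P0(2)[OF zc] norm_triangle_sub[of "P0 (?th z)" "f (?th (\<chi> i. of_real s * z $ i))"] by simp
  qed
  have \<delta>2: "1 + 2 * \<delta> > 0" using \<delta> by simp
  have "cmod (P (?th z)) \<le> (1 + \<delta>) / (1 + 2 * \<delta>)" if "z \<in> torus" for z
    using P0_le[OF that] \<delta>2 unfolding P_def norm_mult norm_of_real
    by (simp add: divide_right_mono)
  moreover have "(1 + \<delta>) / (1 + 2 * \<delta>) < 1" using \<delta> by simp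
  ultimately obtain h where h: "convex_combination_of (rational_inner ix m t \<inter> disc_algebra (theta_domain ix m t)) h"
    "continuous_on (?th ` closed_polydisc) h"
    "\<And>z. z \<in> torus \<Longrightarrow> cmod (h (?th z) - P (?th z)) < \<delta>"
    using convex_combination_approximation[OF ix mt(3) P _ _ \<delta>] by blast
  have "cmod (h (?th z) - f (?th (\<chi> i. of_real s * z $ i))) < 4 * \<delta>" if z: "z \<in> torus" for z
  proof -
    have "P (?th z) - P0 (?th z) = of_real (- (2 * \<delta>) / (1 + 2 * \<delta>)) * P0 (?th z)"
    proof -
      have "1 / (1 + 2 * \<delta>) - 1 = - (2 * \<delta>) / (1 + 2 * \<delta>)" using \<delta>2 by (simp add: field_simps)
      then have "of_real (- (2 * \<delta>) / (1 + 2 * \<delta>)) = complex_of_real (1 / (1 + 2 * \<delta>)) - 1"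
        by (metis of_real_1 of_real_diff)
      then show ?thesis by (simp only: P_def left_diff_distrib mult_1)
    qed
    then have "cmod (P (?th z) - P0 (?th z)) = 2 * \<delta> / (1 + 2 * \<delta>) * cmod (P0 (?th z))"
      using \<delta> by (simp only: norm_mult norm_of_real) simp
    also have "\<dots> \<le> 2 * \<delta> / (1 + 2 * \<delta>) * (1 + 2 * \<delta>)"
      using P0_le[OF z] \<delta> by (intro mult_left_mono) auto
    also have "\<dots> = 2 * \<delta>" using \<delta>2 by simp
    finally have "cmod (P (?th z) - P0 (?th z)) \<le> 2 * \<delta>" .
    moreover have "cmod (P0 (?th z) - f (?th (\<chi> i. of_real s * z $ i))) < \<delta>"
      using z torus_subset_closed by (intro P0) blast
    moreover note h(3)[OF z]
    moreover have "h (?th z) - f (?th (\<chi> i. of_real s * z $ i)) = (h (?th z) - P (?th z))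
        + (P (?th z) - P0 (?th z)) + (P0 (?th z) - f (?th (\<chi> i. of_real s * z $ i)))" by simp
    ultimately show ?thesis
      using norm_triangle_ineq[of "(h (?th z) - P (?th z)) + (P (?th z) - P0 (?th z))" "P0 (?th z) - f (?th (\<chi> i. of_real s * z $ i))"]
        norm_triangle_ineq[of "h (?th z) - P (?th z)" "P (?th z) - P0 (?th z)"] by simp
  qed
  then show thesis using that h by blast
qed

section \<open>Measurability and almost everywhere existence of boundary functions\<close>

lemma holomorphic_sev_imp_continuous_on: "holomorphic_sev f U \<Longrightarrow> continuous_on U f"
  unfolding holomorphic_sev_def
  by (intro continuous_at_imp_continuous_on ballI) (meson has_derivative_continuous)

lemma measurable_theta:
  "theta ix m t \<in> torus_haar \<rightarrow>\<^sub>M restrict_space borel (theta_boundary ix m t)"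
  unfolding measurable_cong_sets[OF sets_torus_haar refl]
  by (intro measurable_restrict_space3 borel_measurable_continuous_onI continuous_on_theta) auto

lemma boundary_fun_measurable:
  fixes ix :: "'n::finite \<Rightarrow> nat"
  assumes t: "t dvd m" and f: "continuous_on (theta_domain ix m t) f"
  shows "boundary_fun ix m t f \<in> borel_measurable (theta_measure ix m t)"
proof -
  have dom: "dilation ix m t r q \<in> theta_domain ix m t"
    if q: "q \<in> theta_boundary ix m t" and r: "0 < r" "r < 1" for r q
  proof -
    obtain z where z: "z \<in> torus" "q = theta ix m t z" using q by blast
    have "(\<chi> i. of_real r * z $ i) \<in> polydisc"
      using z r torus_subset_closed by (intro scaled_in_polydisc) auto
    then show ?thesis by (simp add: z dilation_theta[OF t])
  qed
  have nth: "dilation ix m t r q $ i = of_real (r ^ (if ix i = CARD('n) then CARD('n) * m div t else ix i * m)) * q $ i"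
    for r q i by (simp add: dilation_def)
  have "continuous_on S (\<lambda>p. \<chi> i. dilation ix m t (fst p) (snd p) $ i)" for S
    unfolding nth by (intro continuous_intros)
  then have dc: "continuous_on S (\<lambda>p. dilation ix m t (fst p) (snd p))" for S by simp
  have "(\<lambda>q. Lim (at_left 1) (\<lambda>r. f (dilation ix m t r q))) \<in> borel_measurable (theta_measure ix m t)"
  proof (rule borel_measurable_radial_Lim)
    fix r :: real assume r: "0 < r" "r < 1"
    have "continuous_on (theta_boundary ix m t) (\<lambda>q. dilation ix m t r q)"
    proof -
      have "continuous_on (theta_boundary ix m t) (\<lambda>q. (r, q))" by (intro continuous_intros)
      from continuous_on_compose2[OF dc[of UNIV] this] show ?thesis by simp
    qed
    then have "continuous_on (theta_boundary ix m t) (\<lambda>q. f (dilation ix m t r q))"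
      by (rule continuous_on_compose2[OF f]) (use dom r in auto)
    then show "(\<lambda>q. f (dilation ix m t r q)) \<in> borel_measurable (theta_measure ix m t)"
      unfolding theta_measure_def measurable_distr_eq1
      by (rule borel_measurable_continuous_on_restrict)
  next
    fix q assume q: "q \<in> space (theta_measure ix m t)"
    have "continuous_on {0<..<1} (\<lambda>r. dilation ix m t r q)"
    proof -
      have "continuous_on {0<..<1} (\<lambda>r :: real. (r, q))" by (intro continuous_intros)
      from continuous_on_compose2[OF dc[of UNIV] this] show ?thesis by simp
    qed
    then show "continuous_on {0<..<1} (\<lambda>r. f (dilation ix m t r q))"
      by (rule continuous_on_compose2[OF f]) (use dom q in \<open>auto simp: space_theta_measure\<close>)
  qed
  then show ?thesis by (simp add: boundary_fun_def[abs_def])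
qed

text \<open>The weights of the dilation are chosen so that in the variable z it becomes
  multiplication by r. The boundary function at \<open>theta ix m t z\<close> is thus the plain
  radial limit of the pulled back function at z.\<close>

lemma boundary_fun_AE_limit:
  fixes ix :: "'n::finite \<Rightarrow> nat"
  assumes t: "t dvd m" and f: "holomorphic_sev f (theta_domain ix m t)"
    and bdd: "\<And>q. q \<in> theta_domain ix m t \<Longrightarrow> cmod (f q) \<le> C"
  shows "AE z in torus_haar. ((\<lambda>r. f (theta ix m t (\<chi> i. of_real r * z $ i))) \<longlongrightarrow>
    boundary_fun ix m t f (theta ix m t z)) (at_left 1)"
proof -
  let ?th = "theta ix m t"
  have "AE z in torus_haar. \<exists>l. ((\<lambda>r. f (?th (\<chi> i. of_real r * z $ i))) \<longlongrightarrow> l) (at_left 1)"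
  proof (rule torus_radial_limits_AE)
    show "continuous_on polydisc (\<lambda>z. f (?th z))"
      by (rule continuous_on_compose2[OF holomorphic_sev_imp_continuous_on[OF f] continuous_on_theta]) auto
    show "cmod (f (?th z)) \<le> C" if "z \<in> polydisc" for z using bdd that by blast
    fix z :: "complex^'n" assume z: "z \<in> torus"
    show "(\<lambda>w. f (?th (\<chi> i. w * z $ i))) holomorphic_on ball 0 1"
      unfolding holomorphic_on_def
    proof
      fix w :: complex assume w: "w \<in> ball 0 1"
      have "(\<chi> i. w * z $ i) \<in> polydisc"
        using z w torus_subset_closed by (intro scaled_in_polydisc) auto
      moreover have "(\<lambda>w. ?th (\<chi> i. w * z $ i) $ k) field_differentiable (at w)" for k
      proof -
        have "(\<lambda>w. p (\<chi> i. w * z $ i)) holomorphic_on UNIV" if "polynomial_sev p" for p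
          using that by (induction rule: polynomial_sev_induct) (auto intro!: holomorphic_intros)
        from this[OF polynomial_sev_theta[of ix m t k]] show ?thesis
          by (simp add: holomorphic_on_def)
      qed
      ultimately have "(\<lambda>w. f (?th (\<chi> i. w * z $ i))) field_differentiable at w"
        by (intro holomorphic_sev_slice[OF f, where \<gamma> = "\<lambda>w. ?th (\<chi> i. w * z $ i)"] imageI)
      then show "(\<lambda>w. f (?th (\<chi> i. w * z $ i))) field_differentiable at w within ball 0 1"
        by (rule field_differentiable_at_within)
    qed
  qed
  then show ?thesis
  proof eventually_elim
    case (elim z)
    then obtain l where l: "((\<lambda>r. f (?th (\<chi> i. of_real r * z $ i))) \<longlongrightarrow> l) (at_left 1)" by blast
    have "boundary_fun ix m t f (?th z) = l"
      unfolding boundary_fun_def dilation_theta[OF t] by (rule tendsto_Lim[OF _ l]) simp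
    then show ?case using l by simp
  qed
qed

theorem theoremC:
  fixes ix :: "'n::finite \<Rightarrow> nat" and m t :: nat
    and f :: "complex^'n \<Rightarrow> complex" and \<epsilon> :: real
  assumes "CARD('n) > 1"
    and "bij_betw ix UNIV {1..CARD('n)}"
    and "m > 0" and "t > 0" and "t dvd m"
    and "f \<in> Hinf (theta_domain ix m t)"
    and "Hinf_norm (theta_domain ix m t) f \<le> 1"
    and "\<epsilon> > 0"
  shows "\<exists>h. convex_combination_of (rational_inner ix m t \<inter> disc_algebra (theta_domain ix m t)) h \<and>
    (\<lambda>q. boundary_fun ix m t f q - boundary_fun ix m t h q) \<in> L2_space (theta_measure ix m t) \<and>
    L2_norm (theta_measure ix m t)
      (\<lambda>q. boundary_fun ix m t f q - boundary_fun ix m t h q) < \<epsilon>"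
proof -
  let ?th = "theta ix m t" and ?T = "torus_haar :: (complex^'n) measure"
  let ?b = "boundary_fun ix m t"
  interpret T: prob_space ?T by (rule prob_space_torus_haar)
  note ix = \<open>bij_betw ix UNIV {1..CARD('n)}\<close> and mt = \<open>m > 0\<close> \<open>t > 0\<close> \<open>t dvd m\<close> and t = \<open>t dvd m\<close>
  have f: "holomorphic_sev f (theta_domain ix m t)" and fb: "bounded (f ` theta_domain ix m t)"
    using assms(6) by (auto simp: Hinf_def)
  have fc: "continuous_on (theta_domain ix m t) f" by (rule holomorphic_sev_imp_continuous_on[OF f])
  have bdd: "cmod (f q) \<le> 1" if "q \<in> theta_domain ix m t" for q
  proof -
    obtain C where "\<And>q. q \<in> theta_domain ix m t \<Longrightarrow> cmod (f q) \<le> C"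
      using fb unfolding bounded_iff by blast
    then have "cmod (f q) \<le> Hinf_norm (theta_domain ix m t) f"
      unfolding Hinf_norm_def using that by (intro cSUP_upper bdd_aboveI2[where M = C])
    then show ?thesis using assms(7) by simp
  qed
  define F where "F = (\<lambda>r z. f (?th (\<chi> i. complex_of_real r * z $ i)))"
  define B where "B = (\<lambda>z. ?b f (?th z))"
  have lim: "AE z in ?T. ((\<lambda>r. F r z) \<longlongrightarrow> B z) (at_left 1)"
    unfolding F_def B_def by (rule boundary_fun_AE_limit[OF t f bdd])
  have scaled: "(\<chi> i. complex_of_real r * z $ i) \<in> polydisc" if "z \<in> torus" "0 < r" "r < 1" for r and z :: "complex^'n"
    using that torus_subset_closed by (intro scaled_in_polydisc) auto
  have F_le: "cmod (F r z) \<le> 1" if "z \<in> torus" "0 < r" "r < 1" for r z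
    unfolding F_def by (intro bdd imageI scaled that)
  have F_meas: "F r \<in> borel_measurable ?T" if r: "0 < r" "r < 1" for r
  proof -
    have "continuous_on torus (\<lambda>z. ?th (\<chi> i. complex_of_real r * z $ i))"
      by (rule continuous_on_compose2[OF continuous_on_theta[of UNIV]]) (auto intro!: continuous_intros)
    then have "continuous_on torus (F r)"
      unfolding F_def by (rule continuous_on_compose2[OF fc]) (use scaled r in blast)
    then show ?thesis
      unfolding measurable_cong_sets[OF sets_torus_haar refl]
      by (rule borel_measurable_continuous_on_restrict)
  qed
  have bf_meas: "?b f \<in> borel_measurable (theta_measure ix m t)"
    by (rule boundary_fun_measurable[OF t fc])
  have B_meas: "B \<in> borel_measurable ?T"
    unfolding B_def using bf_meas measurable_theta
    by (auto simp: theta_measure_def measurable_distr_eq1 intro: measurable_compose)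
  have B_le: "AE z in ?T. cmod (B z) \<le> 1"
    using lim AE_space
  proof eventually_elim
    case (elim z)
    have "\<forall>\<^sub>F r in at_left 1. cmod (F r z) \<le> 1"
      using eventually_at_left_real[of 0 1, simplified]
      by eventually_elim (use F_le elim in \<open>auto simp: space_torus_haar\<close>)
    then show ?case using tendsto_upperbound[OF tendsto_norm[OF elim(1)]] by simp
  qed
  define x where "x = (\<lambda>n. 1 - 1 / real (n + 2))"
  have x: "0 < x n" "x n < 1" for n by (auto simp: x_def)
  have "x \<longlonglongrightarrow> 1 - 0"
    unfolding x_def by (intro tendsto_diff tendsto_const LIMSEQ_ignore_initial_segment lim_1_over_n)
  then have x_lim: "filterlim x (at_left 1) sequentially"
    using x less_imp_neq[OF x(2)] by (auto simp: filterlim_at intro!: always_eventually)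
  have FB_le: "AE z in ?T. norm ((cmod (F (x n) z - B z))\<^sup>2) \<le> 4" for n
    using B_le AE_space
  proof eventually_elim
    case (elim z)
    have "cmod (F (x n) z - B z) \<le> 2"
      using elim F_le[OF _ x, of z n] norm_triangle_ineq4[of "F (x n) z" "B z"] by (simp add: space_torus_haar)
    then have "(cmod (F (x n) z - B z))\<^sup>2 \<le> 2\<^sup>2" by (intro power_mono) auto
    then show ?case by simp
  qed
  have "(\<lambda>n. LINT z|?T. (cmod (F (x n) z - B z))\<^sup>2) \<longlonglongrightarrow> (LINT z|?T. 0)"
  proof (rule integral_dominated_convergence[where w = "\<lambda>_. 4"])
    show "(\<lambda>z. (cmod (F (x n) z - B z))\<^sup>2) \<in> borel_measurable ?T" for n
      using F_meas[OF x] B_meas by measurable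
    show "AE z in ?T. (\<lambda>n. (cmod (F (x n) z - B z))\<^sup>2) \<longlonglongrightarrow> 0"
      using lim
    proof eventually_elim
      case (elim z)
      have "(\<lambda>n. F (x n) z) \<longlonglongrightarrow> B z" by (rule filterlim_compose[OF elim x_lim])
      then have "(\<lambda>n. (cmod (F (x n) z - B z))\<^sup>2) \<longlonglongrightarrow> (cmod (B z - B z))\<^sup>2"
        by (intro tendsto_intros)
      then show ?case by simp
    qed
    show "AE z in ?T. norm ((cmod (F (x n) z - B z))\<^sup>2) \<le> 4" for n
      by (rule FB_le)
  qed auto
  then have "\<forall>\<^sub>F n in sequentially. (LINT z|?T. (cmod (F (x n) z - B z))\<^sup>2) < \<epsilon>\<^sup>2 / 4"
    by (intro order_tendstoD(2)) (use assms(8) in auto)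
  then obtain n where n: "(LINT z|?T. (cmod (F (x n) z - B z))\<^sup>2) < \<epsilon>\<^sup>2 / 4"
    by (auto simp: eventually_sequentially)
  \<comment> \<open>The uniform error is then \<open>4 * \<delta> = \<epsilon> / 4\<close>. By (a +
    b)^2 \<le> 2 a^2 + 2 b^2, the squared distance is below 2 (\<epsilon>^2 / 4) + 2 (\<epsilon> /
    4)^2 = 5 \<epsilon>^2 / 8.\<close>
  define \<delta> where "\<delta> = \<epsilon> / 16"
  have \<delta>: "\<delta> > 0" using assms(8) by (simp add: \<delta>_def)
  obtain h where h: "convex_combination_of (rational_inner ix m t \<inter> disc_algebra (theta_domain ix m t)) h"
    "continuous_on (?th ` closed_polydisc) h"
    "\<And>z. z \<in> torus \<Longrightarrow> cmod (h (?th z) - F (x n) z) < 4 * \<delta>"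
    unfolding F_def using dilate_approximation[OF ix mt f bdd x \<delta>] by blast
  have bh: "?b h (?th z) = h (?th z)" if "z \<in> torus" for z
    by (rule boundary_fun_continuous[OF h(2) t that])
  have bh_meas: "?b h \<in> borel_measurable (theta_measure ix m t)"
    by (intro boundary_fun_measurable t continuous_on_subset[OF h(2)] image_mono polydisc_subset_closed)
  let ?D = "\<lambda>q. ?b f q - ?b h q"
  have D_meas: "?D \<in> borel_measurable (theta_measure ix m t)" using bf_meas bh_meas by measurable
  then have D_meas': "(\<lambda>q. (cmod (?D q))\<^sup>2) \<in> borel_measurable (restrict_space borel (theta_boundary ix m t))"
    by (simp add: theta_measure_def measurable_distr_eq1)
  have DT_meas: "(\<lambda>z. (cmod (?D (?th z)))\<^sup>2) \<in> borel_measurable ?T"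
    by (rule measurable_compose[OF measurable_theta D_meas'])
  have D_le: "(cmod (?D (?th z)))\<^sup>2 \<le> 2 * (cmod (F (x n) z - B z))\<^sup>2 + 32 * \<delta>\<^sup>2" if z: "z \<in> torus" for z
  proof -
    have "cmod (?D (?th z)) \<le> cmod (F (x n) z - B z) + 4 * \<delta>"
      using h(3)[OF z] norm_triangle_ineq[of "B z - F (x n) z" "F (x n) z - h (?th z)"]
      by (simp add: bh[OF z] B_def norm_minus_commute)
    then have "(cmod (?D (?th z)))\<^sup>2 \<le> (cmod (F (x n) z - B z) + 4 * \<delta>)\<^sup>2"
      by (intro power_mono) auto
    also have "\<dots> \<le> 2 * (cmod (F (x n) z - B z))\<^sup>2 + 2 * (4 * \<delta>)\<^sup>2"
      using sum_squares_bound[of "cmod (F (x n) z - B z)" "4 * \<delta>"] by (simp add: power2_sum)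
    finally show ?thesis by (simp add: power_mult_distrib)
  qed
  have E_int: "integrable ?T (\<lambda>z. (cmod (F (x n) z - B z))\<^sup>2)"
  proof (rule T.integrable_const_bound[where B = 4])
    show "AE z in ?T. norm ((cmod (F (x n) z - B z))\<^sup>2) \<le> 4"
      by (rule FB_le)
    show "(\<lambda>z. (cmod (F (x n) z - B z))\<^sup>2) \<in> borel_measurable ?T"
      using F_meas[OF x] B_meas by measurable
  qed
  have bound_int: "integrable ?T (\<lambda>z. 2 * (cmod (F (x n) z - B z))\<^sup>2 + 32 * \<delta>\<^sup>2)"
    using E_int by simp
  have DT_int: "integrable ?T (\<lambda>z. (cmod (?D (?th z)))\<^sup>2)"
    by (rule Bochner_Integration.integrable_bound[OF bound_int DT_meas])
       (intro AE_I2, use D_le in \<open>force simp: space_torus_haar\<close>)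
  have "(LINT q|theta_measure ix m t. (cmod (?D q))\<^sup>2) = (LINT z|?T. (cmod (?D (?th z)))\<^sup>2)"
    unfolding theta_measure_def by (rule integral_distr[OF measurable_theta D_meas'])
  also have "\<dots> \<le> (LINT z|?T. 2 * (cmod (F (x n) z - B z))\<^sup>2 + 32 * \<delta>\<^sup>2)"
    by (intro integral_mono DT_int bound_int) (simp add: space_torus_haar D_le)
  also have "\<dots> = 2 * (LINT z|?T. (cmod (F (x n) z - B z))\<^sup>2) + 32 * \<delta>\<^sup>2"
    using E_int T.prob_space by simp
  also have "\<dots> < \<epsilon>\<^sup>2"
  proof -
    have "32 * \<delta>\<^sup>2 = \<epsilon>\<^sup>2 / 8" by (simp add: \<delta>_def power_divide)
    moreover have "\<epsilon>\<^sup>2 > 0" using assms(8) by simp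
    ultimately show ?thesis using n by linarith
  qed
  finally have "L2_norm (theta_measure ix m t) ?D < sqrt (\<epsilon>\<^sup>2)"
    unfolding L2_norm_def by (rule real_sqrt_less_mono)
  then have "L2_norm (theta_measure ix m t) ?D < \<epsilon>" using assms(8) by simp
  moreover have "integrable (theta_measure ix m t) (\<lambda>q. (cmod (?D q))\<^sup>2)"
    unfolding theta_measure_def using DT_int by (subst integrable_distr_eq[OF measurable_theta D_meas'])
  then have "?D \<in> L2_space (theta_measure ix m t)" using D_meas by (simp add: L2_space_def)
  ultimately show ?thesis using h(1) by blast
qed

end
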